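(* Let $Z=\{P_1,\ldots,P_s\}$, $s\geq 1$, be a finite set of points in $\mathbb{P}^2$ and let $I=I(Z)$ be its radical ideal. If $\widehat{\alpha}(I)<\frac{9}{4}$, then one of the following holds: (a) $Z$ is contained in a line (and then $\widehat{\alpha}(I)=1$) or $Z$ is contained in a conic (and then $\widehat{\alpha}(I)\leq 2$); or (b) $Z$ is a $4$-star, and in this case $\widehat{\alpha}(I)=2$ and $s=6$. Moreover, if $\frac{\alpha(I^{(m)})}{m}=\frac{9}{4}$ for some $m\geq 1$, then $Z$ is a $3$-quasi star.
   Context: The ground field is algebraically closed of characteristic $0$; $\mathbb{P}^2$ is the projective plane over it. For a finite set $Z=\{P_1,\dots,P_s\}\subset\mathbb{P}^2$, $I(P_i)$ is the homogeneous ideal of all forms vanishing at $P_i$, $I=I(Z)=\bigcap_i I(P_i)$, and for $m\geq 1$ the symbolic power is $I^{(m)}=\bigcap_i I(P_i)^m$ (generated by the forms vanishing to order at least $m$ at every $P_i$). For a nonzero homogeneous ideal $J=\bigoplus_{d\geq 0}J_d$, the initial degree is $\alpha(J)=\min\{d: J_d\neq 0\}$. The Waldschmidt constant is $\widehat{\alpha}(I)=\lim_{m\to\infty}\alpha(I^{(m)})/m=\inf_{m\geq 1}\alpha(I^{(m)})/m$. A conic is a (possibly reducible) curve of degree $2$. A $d$-star is a set consisting of all the pairwise intersection points of $d$ general lines in $\mathbb{P}^2$ (distinct lines, no three of them through one point); it has $d(d-1)/2$ points. A $d$-quasi star is a set $Z$ consisting of all the pairwise intersection points of $d$ general lines (distinct,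 no three through one point) and, additionally, exactly one more point on each of the $d$ lines, where these $d$ additional points are not collinear; it has $d(d+1)/2$ points. *)

theory Defs
  imports
    "HOL-Analysis.Analysis"
    "HOL-Library.Poly_Mapping"
    "HOL-Computational_Algebra.Polynomial"
begin

section \<open>The projective plane\<close>

definition proj_rel :: "'k::field ^ 3 \<Rightarrow> 'k ^ 3 \<Rightarrow> bool"
  where "proj_rel u v \<longleftrightarrow> u \<noteq> 0 \<and> v \<noteq> 0 \<and> (\<exists>c. c \<noteq> 0 \<and> v = c *s u)"

lemma part_equivp_proj_rel: "part_equivp (proj_rel :: 'k::field ^ 3 \<Rightarrow> 'k ^ 3 \<Rightarrow> bool)"
proof (rule part_equivpI)
  have "proj_rel (axis 1 1 :: 'k ^ 3) (axis 1 1)"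
    unfolding proj_rel_def by (auto simp: axis_eq_0_iff intro!: exI[of _ 1])
  then show "\<exists>x :: 'k ^ 3. proj_rel x x" ..
  show "symp (proj_rel :: 'k ^ 3 \<Rightarrow> 'k ^ 3 \<Rightarrow> bool)"
  proof (rule sympI)
    fix u v :: "'k ^ 3"
    assume "proj_rel u v"
    then obtain c where c: "u \<noteq> 0" "v \<noteq> 0" "c \<noteq> 0" "v = c *s u"
      unfolding proj_rel_def by blast
    then have "inverse c \<noteq> 0" "u = inverse c *s v"
      by (auto simp: vector_smult_assoc)
    with c show "proj_rel v u" unfolding proj_rel_def by blast
  qed
  show "transp (proj_rel :: 'k ^ 3 \<Rightarrow> 'k ^ 3 \<Rightarrow> bool)"
    unfolding proj_rel_def
    by (rule transpI) (metis mult_eq_0_iff vector_smult_assoc)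
qed

quotient_type (overloaded) 'k proj_plane = "'k::field ^ 3" / partial: "proj_rel"
  by (rule part_equivp_proj_rel)

section \<open>Forms in three variables\<close>

text \<open>The polynomial ring \<open>k[x\<^sub>1, x\<^sub>2, x\<^sub>3]\<close>: a polynomial maps each exponent vector to its coefficient.\<close>

type_synonym 'k poly3 = "(3 \<Rightarrow>\<^sub>0 nat) \<Rightarrow>\<^sub>0 'k"

definition eval3 :: "'k::field poly3 \<Rightarrow> 'k ^ 3 \<Rightarrow> 'k"
  where "eval3 F v = (\<Sum>e\<in>Poly_Mapping.keys F. Poly_Mapping.lookup F e * (\<Prod>i\<in>UNIV. (v $ i) ^ Poly_Mapping.lookup e i))"

text \<open>The zero polynomial is a form of every degree.\<close>

definition is_form :: "nat \<Rightarrow> 'k::field poly3 \<Rightarrow> bool"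
  where "is_form d F \<longleftrightarrow> (\<forall>e\<in>Poly_Mapping.keys F. (\<Sum>i\<in>UNIV. Poly_Mapping.lookup e i) = d)"

text \<open>For a form it does not matter which homogeneous coordinates of the point are used.\<close>

definition vanishes_at :: "'k::field poly3 \<Rightarrow> 'k proj_plane \<Rightarrow> bool"
  where "vanishes_at F P \<longleftrightarrow> (\<forall>v. v \<noteq> 0 \<and> abs_proj_plane v = P \<longrightarrow> eval3 F v = 0)"

definition is_curve :: "nat \<Rightarrow> 'k::field proj_plane set \<Rightarrow> bool"
  where "is_curve d C \<longleftrightarrow> (\<exists>F. F \<noteq> 0 \<and> is_form d F \<and> C = {P. vanishes_at F P})"

abbreviation is_line :: "'k::field proj_plane set \<Rightarrow> bool"
  where "is_line \<equiv> is_curve 1"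

abbreviation is_conic :: "'k::field proj_plane set \<Rightarrow> bool"
  where "is_conic \<equiv> is_curve 2"

section \<open>Symbolic powers and the Waldschmidt constant\<close>

lemma module_times: "module ((*) :: 'a::comm_ring_1 \<Rightarrow> 'a \<Rightarrow> 'a)"
  by unfold_locales (simp_all add: algebra_simps)

definition ideal_gen :: "'a::comm_ring_1 set \<Rightarrow> 'a set"
  where "ideal_gen = module.span (*)"

definition ideal_mult :: "'a::comm_ring_1 set \<Rightarrow> 'a set \<Rightarrow> 'a set"
  where "ideal_mult I J = ideal_gen {a * b | a b. a \<in> I \<and> b \<in> J}"

primrec ideal_power :: "'a::comm_ring_1 set \<Rightarrow> nat \<Rightarrow> 'a set"
  where
    "ideal_power I 0 = UNIV"
  | "ideal_power I (Suc m) = ideal_mult I (ideal_power I m)"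

definition point_ideal :: "'k::field proj_plane \<Rightarrow> 'k poly3 set"
  where "point_ideal P = ideal_gen {F. (\<exists>d. is_form d F) \<and> vanishes_at F P}"

text \<open>
  The \<open>m\<close>-th symbolic power of the radical ideal \<open>I(Z)\<close> of a finite set \<open>Z\<close> of points;
  \<open>I(Z)\<close> itself is the case \<open>m = 1\<close>.
\<close>

definition symbolic_power :: "'k::field proj_plane set \<Rightarrow> nat \<Rightarrow> 'k poly3 set"
  where "symbolic_power Z m = (\<Inter>P\<in>Z. ideal_power (point_ideal P) m)"

definition initial_degree :: "'k::field poly3 set \<Rightarrow> nat"
  where "initial_degree J = (LEAST d. \<exists>F\<in>J. F \<noteq> 0 \<and> is_form d F)"

definition waldschmidt :: "'k::field proj_plane set \<Rightarrow> real"
  where "waldschmidt Z = lim (\<lambda>m. real (initial_degree (symbolic_power Z m)) / real m)"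

section \<open>Stars and quasi stars\<close>

definition general_lines :: "nat \<Rightarrow> 'k::field proj_plane set set \<Rightarrow> bool"
  where "general_lines d \<L> \<longleftrightarrow>
    finite \<L> \<and> card \<L> = d \<and> (\<forall>L\<in>\<L>. is_line L) \<and>
    (\<forall>L\<in>\<L>. \<forall>M\<in>\<L>. \<forall>N\<in>\<L>. L \<noteq> M \<and> L \<noteq> N \<and> M \<noteq> N \<longrightarrow> L \<inter> M \<inter> N = {})"

definition pairwise_intersections :: "'k::field proj_plane set set \<Rightarrow> 'k proj_plane set"
  where "pairwise_intersections \<L> = {P. \<exists>L\<in>\<L>. \<exists>M\<in>\<L>. L \<noteq> M \<and> P \<in> L \<inter> M}"

definition is_star :: "nat \<Rightarrow> 'k::field proj_plane set \<Rightarrow> bool"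
  where "is_star d Z \<longleftrightarrow> (\<exists>\<L>. general_lines d \<L> \<and> Z = pairwise_intersections \<L>)"

definition is_quasi_star :: "nat \<Rightarrow> 'k::field proj_plane set \<Rightarrow> bool"
  where "is_quasi_star d Z \<longleftrightarrow>
    (\<exists>\<L> A. general_lines d \<L> \<and>
      Z = pairwise_intersections \<L> \<union> A \<and>
      A \<inter> pairwise_intersections \<L> = {} \<and>
      A \<subseteq> \<Union>\<L> \<and> (\<forall>L\<in>\<L>. \<exists>!P. P \<in> A \<inter> L) \<and>
      \<not> (\<exists>M. is_line M \<and> A \<subseteq> M))"

end

theory Submission
  imports Defs
begin

text \<open>
  A form of degree \<open>d\<close> vanishing to order at least \<open>m\<close> at every point of \<open>Z\<close> is divisible by every
  line, or smooth conic, that violates Bezout's inequality with it. Splitting off finitely many such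
  curves leaves a form satisfying all these inequalities, and \<open>d\<close> is then bounded by linear arithmetic.
  Let \<open>Z\<close> lie on no conic. If \<open>Z\<close> contains five points, no three collinear, take a sixth point \<open>P\<close> off
  their conic. Lines through \<open>P\<close> pair up at most four of the five points, so the line joining \<open>P\<close> to some
  \<open>E\<close> of them avoids the other four; the conic together with the line \<open>PE\<close> gives \<open>3 d \<ge> 7 m\<close>.
  Otherwise \<open>Z\<close> contains a triangle with a further point on every side. If these three points are not
  collinear, the three sides and the three lines joining the further points give \<open>4 d \<ge> 9 m\<close>; equality
  forces the form to be a product of these six lines, which vanishes to order less than \<open>m\<close> at every
  other point. If they are collinear the six points form a 4-star, and any further point of \<open>Z\<close> yields a
  triangle of the former kind, because the diagonal points of a quadrangle are not collinear in
  characteristic different from 2.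
\<close>

section \<open>Polynomial functions and order of vanishing\<close>

text \<open>Polynomials enter as functions on \<open>k ^ 3\<close>: over an infinite field nothing
  is lost, restriction to a curve is composition, and divisibility is a pointwise identity. Lower
  bounds on degrees use the order of these functions at the points; upper bounds come from explicit
  products and powers of forms. The components split off may occur with any exponents, so these stay
  unknowns. A line or a smooth conic has order at most 1 at a point, which bounds the order lost by
  the remaining form; a weighted sum of the Bezout inequalities in which the exponents are absorbed
  by the degree gives the constants. Bezout's theorem concerns only lines and one conic, both
  rational: restricted to a parametrization, a form becomes a binary form, whose zeros are
  univariate roots together with the degree deficit at infinity. Five general points are moved to
  the conic y^2 = x z by a linear change of coordinates.\<close>

inductive polyfun :: "('k::comm_ring_1 ^ 3 \<Rightarrow> 'k) \<Rightarrow> bool"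
  where
    const: "polyfun (\<lambda>_. c)"
  | coord: "polyfun (\<lambda>v. v $ i)"
  | add: "polyfun f \<Longrightarrow> polyfun g \<Longrightarrow> polyfun (\<lambda>v. f v + g v)"
  | mult: "polyfun f \<Longrightarrow> polyfun g \<Longrightarrow> polyfun (\<lambda>v. f v * g v)"

lemma polyfun_minus: "polyfun f \<Longrightarrow> polyfun (\<lambda>v. - f v)"
  using polyfun.mult[OF polyfun.const[of "-1"]] by simp

lemma polyfun_diff: "polyfun f \<Longrightarrow> polyfun g \<Longrightarrow> polyfun (\<lambda>v. f v - g v)"
  using polyfun.add[OF _ polyfun_minus] by simp

lemma polyfun_sum: "(\<And>i. i \<in> I \<Longrightarrow> polyfun (f i)) \<Longrightarrow> polyfun (\<lambda>v. \<Sum>i\<in>I. f i v)"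
  by (induction I rule: infinite_finite_induct) (auto intro: polyfun.intros)

lemma polyfun_prod: "(\<And>i. i \<in> I \<Longrightarrow> polyfun (f i)) \<Longrightarrow> polyfun (\<lambda>v. \<Prod>i\<in>I. f i v)"
  by (induction I rule: infinite_finite_induct) (auto intro: polyfun.intros)

lemma polyfun_power: "polyfun f \<Longrightarrow> polyfun (\<lambda>v. f v ^ n)"
  by (induction n) (auto intro: polyfun.intros)

lemmas polyfun_intros = polyfun.intros polyfun_minus polyfun_diff polyfun_sum polyfun_prod polyfun_power

lemma polyfun_compose:
  assumes "polyfun f" and "\<And>i. polyfun (\<lambda>v. h v $ i)"
  shows "polyfun (\<lambda>v. f (h v))"
  using assms(1) by induction (auto intro: polyfun_intros assms(2))

section \<open>Polynomial functions of one variable\<close>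

definition polyuni :: "('k::comm_ring_1 \<Rightarrow> 'k) \<Rightarrow> bool"
  where "polyuni r \<longleftrightarrow> (\<exists>p. \<forall>t. r t = poly p t)"

lemma polyuni_poly: "polyuni (poly p)"
  by (auto simp: polyuni_def)

lemma polyuni_const: "polyuni (\<lambda>_. c)"
  unfolding polyuni_def by (rule exI[of _ "[:c:]"]) simp

lemma polyuni_id: "polyuni (\<lambda>t. t)"
  unfolding polyuni_def by (rule exI[of _ "[:0, 1:]"]) simp

lemma polyuni_add: "polyuni f \<Longrightarrow> polyuni g \<Longrightarrow> polyuni (\<lambda>t. f t + g t)"
  unfolding polyuni_def by (metis poly_add)

lemma polyuni_mult: "polyuni f \<Longrightarrow> polyuni g \<Longrightarrow> polyuni (\<lambda>t. f t * g t)"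
  unfolding polyuni_def by (metis poly_mult)

lemma polyuni_power: "polyuni f \<Longrightarrow> polyuni (\<lambda>t. f t ^ n)"
  unfolding polyuni_def by (metis poly_power)

lemma polyuni_diff: "polyuni f \<Longrightarrow> polyuni g \<Longrightarrow> polyuni (\<lambda>t. f t - g t)"
  unfolding polyuni_def by (metis poly_diff)

lemmas polyuni_intros =
  polyuni_poly polyuni_const polyuni_id polyuni_add polyuni_mult polyuni_power polyuni_diff

lemma polyuni_compose:
  assumes "polyfun f" and "\<And>i. polyuni (\<lambda>t. w t $ i)"
  shows "polyuni (\<lambda>t. f (w t))"
  using assms(1) by induction (auto intro: polyuni_intros assms(2))

text \<open>A nonzero polynomial has finitely many roots in an infinite field. This covers the
  parameter value at which a scaling argument would divide by 0.\<close>

lemma polyuni_eqI: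
  fixes f g :: "'k::field_char_0 \<Rightarrow> 'k"
  assumes "polyuni f" and "polyuni g" and "\<And>t. t \<noteq> a \<Longrightarrow> f t = g t"
  shows "f t = g t"
proof -
  obtain p q where p: "\<And>t. f t = poly p t" and q: "\<And>t. g t = poly q t"
    using assms(1,2) unfolding polyuni_def by blast
  have "UNIV - {a} \<subseteq> {t. poly (p - q) t = 0}"
    using assms(3) p q by auto
  moreover have "infinite (UNIV - {a})"
    by (simp add: infinite_UNIV_char_0)
  ultimately have "p - q = 0"
    using poly_roots_finite finite_subset by metis
  then show ?thesis
    using p q by simp
qed

text \<open>The Taylor expansion of \<open>f\<close> at \<open>p\<close> in the direction
  \<open>v\<close>, as a univariate polynomial. \<open>THE\<close> is legitimate for polynomial
  \<open>f\<close>: existence is shown in \<open>poly_jet\<close>, uniqueness holds because the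
  field is infinite.\<close>

definition jet :: "('k::field_char_0 ^ 3 \<Rightarrow> 'k) \<Rightarrow> 'k ^ 3 \<Rightarrow> 'k ^ 3 \<Rightarrow> 'k poly"
  where "jet f p v = (THE r. \<forall>t. f (p + t *s v) = poly r t)"

lemma jet_eqI: "(\<And>t. f (p + t *s v) = poly r t) \<Longrightarrow> jet f p v = r"
  unfolding jet_def by (rule the_equality) (auto simp: poly_eq_poly_eq_iff[symmetric])

lemma poly_jet:
  assumes "polyfun f"
  shows "poly (jet f p v) t = f (p + t *s v)"
proof -
  have "polyuni (\<lambda>t. f (p + t *s v))"
    by (rule polyuni_compose[OF assms]) (simp, intro polyuni_intros)
  then obtain r where r: "\<And>t. f (p + t *s v) = poly r t"
    unfolding polyuni_def by blast
  then show ?thesis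
    using jet_eqI[of f p v r] by simp
qed

lemma jet_mult:
  "polyfun f \<Longrightarrow> polyfun g \<Longrightarrow> jet (\<lambda>v. f v * g v) p v = jet f p v * jet g p v"
  by (rule jet_eqI) (simp add: poly_jet)

lemma jet_add:
  "polyfun f \<Longrightarrow> polyfun g \<Longrightarrow> jet (\<lambda>v. f v + g v) p v = jet f p v + jet g p v"
  by (rule jet_eqI) (simp add: poly_jet)

lemma jet_const: "jet (\<lambda>_. c) p v = [:c:]"
  by (rule jet_eqI) simp

lemma jet_coord: "jet (\<lambda>v. v $ i) p v = [:p $ i, v $ i:]"
  by (rule jet_eqI) simp

text \<open>The \<open>k\<close>-th coefficient is the homogeneous Taylor part of degree
  \<open>k\<close>, a polynomial in the direction. Hence Taylor parts can be cancelled as in an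
  integral domain, and the direction may itself vary along a curve.\<close>

lemma polyfun_coeff_jet:
  assumes "polyfun f"
  shows "polyfun (\<lambda>v. coeff (jet f p v) k)"
  using assms
proof (induction arbitrary: k)
  case (const c)
  then show ?case by (auto simp: jet_const intro: polyfun_intros)
next
  case (coord i)
  consider "k = 0" | "k = 1" | n where "k = Suc (Suc n)"
    by (metis One_nat_def not0_implies_Suc)
  then show ?case
    by cases (simp_all add: jet_coord polyfun.const polyfun.coord)
next
  case (add f g)
  then show ?case by (auto simp: jet_add intro: polyfun_intros)
next
  case (mult f g)
  then show ?case by (auto simp: jet_mult coeff_mult intro!: polyfun_intros)
qed

text \<open>A bound uniform in the direction makes expansions along varying directions sums over one
  fixed range.\<close>

lemma degree_jet_bounded:
  assumes "polyfun f"
  shows "\<exists>N. \<forall>v. degree (jet f p v) \<le> N"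
  using assms
proof induction
  case (const c)
  then show ?case by (auto simp: jet_const)
next
  case (coord i)
  then show ?case by (auto simp: jet_coord intro!: exI[of _ 1])
next
  case (add f g)
  then obtain M N where "\<forall>v. degree (jet f p v) \<le> M" "\<forall>v. degree (jet g p v) \<le> N"
    by blast
  then have "\<forall>v. degree (jet (\<lambda>v. f v + g v) p v) \<le> max M N"
    using add.hyps by (metis jet_add degree_add_le max.coboundedI1 max.coboundedI2)
  then show ?case ..
next
  case (mult f g)
  then obtain M N where "\<forall>v. degree (jet f p v) \<le> M" "\<forall>v. degree (jet g p v) \<le> N"
    by blast
  then have "\<forall>v. degree (jet (\<lambda>v. f v * g v) p v) \<le> M + N"
    using mult.hyps by (metis jet_mult degree_mult_le add_mono order_trans)
  then show ?case ..
qed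

text \<open>On the line through \<open>u\<close> and \<open>w\<close> both functions restrict to
  univariate polynomials with product 0; the value at parameter 0 keeps one factor from vanishing,
  the value at 1 the other.\<close>

lemma polyfun_mult_eq_0:
  fixes f g :: "'k::field_char_0 ^ 3 \<Rightarrow> 'k"
  assumes f: "polyfun f" and g: "polyfun g" and fg: "\<And>v. f v * g v = 0" and u: "f u \<noteq> 0"
  shows "g w = 0"
proof (rule ccontr)
  assume w: "g w \<noteq> 0"
  have "jet f u (w - u) * jet g u (w - u) = jet (\<lambda>v. f v * g v) u (w - u)"
    by (simp add: jet_mult f g)
  also have "\<dots> = 0"
    by (rule jet_eqI) (simp add: fg)
  finally have "jet f u (w - u) = 0 \<or> jet g u (w - u) = 0"
    by simp
  moreover have "poly (jet f u (w - u)) 0 \<noteq> 0" "poly (jet g u (w - u)) 1 \<noteq> 0"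
    using u w by (simp_all add: poly_jet f g)
  ultimately show False by auto
qed

text \<open>Order of vanishing at least \<open>m\<close>, without derivatives: the Taylor parts of
  degree below \<open>m\<close> vanish in every direction. An upper bound \<open>j\<close> on the
  order is accordingly written \<open>\<not> vord f p (Suc j)\<close>.\<close>

definition vord :: "('k::field_char_0 ^ 3 \<Rightarrow> 'k) \<Rightarrow> 'k ^ 3 \<Rightarrow> nat \<Rightarrow> bool"
  where "vord f p m \<longleftrightarrow> (\<forall>v. \<forall>k<m. coeff (jet f p v) k = 0)"

lemma vord_0: "vord f p 0"
  by (simp add: vord_def)

lemma vord_add: "polyfun f \<Longrightarrow> polyfun g \<Longrightarrow> vord f p m \<Longrightarrow> vord g p m \<Longrightarrow> vord (\<lambda>v. f v + g v) p m"
  by (simp add: vord_def jet_add)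

lemma vord_mult:
  assumes "polyfun f" "polyfun g" "vord f p m" "vord g p n"
  shows "vord (\<lambda>v. f v * g v) p (m + n)"
proof -
  have "monom 1 (m + n) dvd jet f p v * jet g p v" for v
    using assms(3,4) unfolding vord_def monom_1_dvd_iff'[symmetric]
    by (metis mult_dvd_mono mult_monom mult_1)
  then show ?thesis
    by (simp add: vord_def jet_mult assms(1,2) monom_1_dvd_iff')
qed

lemma vord_1: "polyfun f \<Longrightarrow> f p = 0 \<Longrightarrow> vord f p 1"
  using poly_jet[of f p _ 0] by (auto simp: vord_def poly_0_coeff_0)

lemma not_vord_1: "polyfun f \<Longrightarrow> f p \<noteq> 0 \<Longrightarrow> \<not> vord f p (Suc 0)"
  using poly_jet[of f p _ 0] by (auto simp: vord_def poly_0_coeff_0)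

text \<open>If \<open>i\<close> is the lowest degree of a nonzero Taylor part of \<open>f\<close>,
  then \<open>i \<le> j\<close>, and the parts of \<open>g\<close> vanish in turn: in degree
  \<open>i + k\<close> of the product only the part of \<open>f\<close> of degree \<open>i\<close>
  times that of \<open>g\<close> of degree \<open>k\<close> survives.\<close>

lemma vord_divide:
  fixes f g :: "'k::field_char_0 ^ 3 \<Rightarrow> 'k"
  assumes f: "polyfun f" and g: "polyfun g"
    and m: "vord (\<lambda>v. f v * g v) p m" and j: "\<not> vord f p (Suc j)"
  shows "vord g p (m - j)"
proof -
  define P where "P i \<longleftrightarrow> (\<exists>v. coeff (jet f p v) i \<noteq> 0)" for i
  obtain i0 where i0: "i0 \<le> j" "P i0"
    using j by (auto simp: vord_def P_def less_Suc_eq_le)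
  define i where "i = (LEAST i. P i)"
  have i: "P i" "i \<le> j"
    using i0 LeastI[of P i0] Least_le[of P i0] by (auto simp: i_def)
  have below: "coeff (jet f p v) a = 0" if "a < i" for a v
    using that not_less_Least[of a P] by (auto simp: i_def P_def)
  obtain v0 where v0: "coeff (jet f p v0) i \<noteq> 0"
    using i by (auto simp: P_def)
  have "\<forall>v. coeff (jet g p v) k = 0" if "k < m - i" for k
    using that
  proof (induction k rule: less_induct)
    case (less k)
    have "coeff (jet f p v) i * coeff (jet g p v) k = 0" for v
    proof -
      have "0 = coeff (jet f p v * jet g p v) (i + k)"
        using m less.prems by (auto simp: vord_def jet_mult f g)
      also have "\<dots> = (\<Sum>a\<le>i + k. coeff (jet f p v) a * coeff (jet g p v) (i + k - a))"
        by (simp add: coeff_mult)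
      also have "\<dots> = (\<Sum>a\<in>{i}. coeff (jet f p v) a * coeff (jet g p v) (i + k - a))"
      proof (rule sum.mono_neutral_right, goal_cases)
        case 3
        show ?case
        proof
          fix a assume a: "a \<in> {..i + k} - {i}"
          show "coeff (jet f p v) a * coeff (jet g p v) (i + k - a) = 0"
            using a less.IH[of "i + k - a"] less.prems below[of a v]
            by (cases "a < i") auto
        qed
      qed auto
      finally show ?thesis by simp
    qed
    \<comment> \<open>\<open>coeff (jet f p v) i\<close> is known to be nonzero only for
      \<open>v0\<close>; since both parts are polynomial in \<open>v\<close>, that of
      \<open>g\<close> still vanishes in every direction.\<close>
    then show ?case
      using polyfun_mult_eq_0[OF polyfun_coeff_jet[OF f] polyfun_coeff_jet[OF g] _ v0] by blast
  qed
  then show ?thesis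
    using i by (auto simp: vord_def)
qed

lemma not_vord_mult:
  assumes "polyfun f" "polyfun g" "\<not> vord f p (Suc i)" "\<not> vord g p (Suc j)"
  shows "\<not> vord (\<lambda>v. f v * g v) p (Suc (i + j))"
  using vord_divide[OF assms(1,2) _ assms(3), of "Suc (i + j)"] assms(4) by auto

lemma not_vord_power:
  assumes "polyfun f" "\<not> vord f p (Suc i)"
  shows "\<not> vord (\<lambda>v. f v ^ n) p (Suc (n * i))"
proof (induction n)
  case 0
  then show ?case using not_vord_1[of "\<lambda>_. 1" p] by (auto intro: polyfun_intros)
next
  case (Suc n)
  then show ?case
    using not_vord_mult[OF assms(1) polyfun_power[OF assms(1)] assms(2), of n "n * i"] by simp
qed

lemma not_vord_prod:
  assumes "finite I" "\<And>i. i \<in> I \<Longrightarrow> polyfun (f i)" "\<And>i. i \<in> I \<Longrightarrow> \<not> vord (f i) p (Suc (k i))"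
  shows "\<not> vord (\<lambda>v. \<Prod>i\<in>I. f i v) p (Suc (\<Sum>i\<in>I. k i))"
  using assms
proof (induction I)
  case empty
  then show ?case using not_vord_1[of "\<lambda>_. 1" p] by (auto intro: polyfun_intros)
next
  case (insert i I)
  then show ?case
    using not_vord_mult[of "f i" "\<lambda>v. \<Prod>i\<in>I. f i v" p "k i" "\<Sum>i\<in>I. k i"]
    by (auto intro: polyfun_intros)
qed

text \<open>The direction may depend on the parameter. With \<open>w\<close> constant this is the
  expansion along a line; a polynomial \<open>w\<close> gives a curve through \<open>p\<close>, such
  as a conic in a local parameter.\<close>

lemma vord_curve:
  fixes f :: "'k::field_char_0 ^ 3 \<Rightarrow> 'k"
  assumes f: "polyfun f" and m: "vord f p m" and w: "\<And>i. polyuni (\<lambda>t. w t $ i)"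
  shows "\<exists>q. \<forall>t. f (p + t *s w t) = t ^ m * poly q t"
proof -
  obtain N where N: "\<And>v. degree (jet f p v) \<le> N"
    using degree_jet_bounded[OF f] by blast
  define s where "s t = (\<Sum>k\<le>N. coeff (jet f p (w t)) (k + m) * t ^ k)" for t
  have "polyuni s"
    unfolding s_def polyuni_def
  proof -
    have "\<exists>q. \<forall>t. coeff (jet f p (w t)) (k + m) = poly q t" for k
      using polyuni_compose[OF polyfun_coeff_jet[OF f] w] by (auto simp: polyuni_def)
    then obtain q where "\<And>k t. coeff (jet f p (w t)) (k + m) = poly (q k) t"
      by metis
    then show "\<exists>r. \<forall>t. (\<Sum>k\<le>N. coeff (jet f p (w t)) (k + m) * t ^ k) = poly r t"
      by (intro exI[of _ "\<Sum>k\<le>N. q k * monom 1 k"]) (simp add: poly_sum poly_monom)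
  qed
  moreover have "f (p + t *s w t) = t ^ m * s t" for t
  proof -
    have "f (p + t *s w t) = poly (jet f p (w t)) t"
      by (simp add: poly_jet f)
    also have "\<dots> = (\<Sum>k\<le>N + m. coeff (jet f p (w t)) k * t ^ k)"
      unfolding poly_altdef
      by (rule sum.mono_neutral_left) (auto simp: coeff_eq_0 intro: le_trans[OF N])
    also have "\<dots> = (\<Sum>k\<in>{m..N + m}. coeff (jet f p (w t)) k * t ^ k)"
      using m by (intro sum.mono_neutral_right) (auto simp: vord_def)
    also have "\<dots> = (\<Sum>k\<le>N. coeff (jet f p (w t)) (k + m) * t ^ (k + m))"
      by (rule sum.reindex_bij_witness[of _ "\<lambda>k. k + m" "\<lambda>k. k - m"]) auto
    also have "\<dots> = t ^ m * s t"
      by (simp add: s_def sum_distrib_left power_add mult_ac)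
    finally show ?thesis .
  qed
  ultimately show ?thesis
    unfolding polyuni_def by auto
qed

section \<open>Forms\<close>

text \<open>Homogeneity by the scaling law, for \<open>c = 0\<close> as well. In characteristic 0
  this agrees with the condition on monomials, by \<open>form_eval3\<close> and
  \<open>form_is_eval3\<close>.\<close>

definition form :: "nat \<Rightarrow> ('k::field_char_0 ^ 3 \<Rightarrow> 'k) \<Rightarrow> bool"
  where "form d f \<longleftrightarrow> polyfun f \<and> (\<forall>c v. f (c *s v) = c ^ d * f v)"

lemma form_polyfun: "form d f \<Longrightarrow> polyfun f"
  by (simp add: form_def)

lemma form_mult: "form d f \<Longrightarrow> form e g \<Longrightarrow> form (d + e) (\<lambda>v. f v * g v)"
  by (auto simp: form_def power_add intro: polyfun_intros)

text \<open>Scaling gives c^e g(c v) = c^d g(v) wherever \<open>l\<close> does not vanish. On the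
  ray through \<open>u\<close> this forces \<open>e \<le> d\<close>; in general \<open>l\<close> is
  cancelled by integrality and \<open>c = 0\<close> is filled in by
  \<open>polyuni_eqI\<close>.\<close>

lemma form_divide:
  assumes f: "form d (\<lambda>v. l v * g v)" and l: "form e l" and g: "polyfun g"
    and nz: "l u * g u \<noteq> 0"
  shows "e \<le> d" "form (d - e) g"
proof -
  have ph: "polyuni (\<lambda>c. g (c *s v))" for v
    by (rule polyuni_compose[OF g]) (simp, intro polyuni_intros)
  have eq: "l v * (c ^ e * g (c *s v)) = l v * (c ^ d * g v)" for c v
    using f l by (simp add: form_def)
  obtain r where r: "\<And>c. g (c *s u) = poly r c"
    using ph by (auto simp: polyuni_def)
  have "poly (monom 1 e * r) = poly (monom (g u) d)"
    using eq[of u] nz r by (auto simp: poly_monom fun_eq_iff mult.commute)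
  then have *: "monom 1 e * r = monom (g u) d"
    by (simp add: poly_eq_poly_eq_iff)
  then have "monom 1 e dvd monom (g u) d"
    by (metis dvd_triv_left)
  then show ed: "e \<le> d"
    using nz by (auto simp: monom_1_dvd_iff' not_less[symmetric])
  have **: "g (c *s v) = c ^ (d - e) * g v" if "c \<noteq> 0" for c v
  proof -
    have "polyfun (\<lambda>v. g (c *s v) - c ^ (d - e) * g v)"
      by (intro polyfun_intros polyfun_compose[OF g] g) (simp, intro polyfun_intros)
    moreover have "l v * (g (c *s v) - c ^ (d - e) * g v) = 0" for v
    proof -
      have "c ^ e * (l v * (g (c *s v) - c ^ (d - e) * g v)) = 0"
        using eq[of v c] ed by (simp add: algebra_simps flip: power_add)
      then show ?thesis using that by simp
    qed
    moreover have "l u \<noteq> 0" "polyfun l"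
      using nz l by (auto simp: form_def)
    ultimately show ?thesis
      using polyfun_mult_eq_0[of l "\<lambda>v. g (c *s v) - c ^ (d - e) * g v" u v] by simp
  qed
  have "g (c *s v) = c ^ (d - e) * g v" for c v
    by (rule polyuni_eqI[OF ph _ **]) (intro polyuni_intros)
  then show "form (d - e) g"
    using g by (simp add: form_def)
qed

lemma vord_scale:
  assumes f: "form d f" and p: "vord f p m" and c: "c \<noteq> 0"
  shows "vord f (c *s p) m"
proof -
  have "jet f (c *s p) v = smult (c ^ d) (jet f p (inverse c *s v))" for v
  proof (rule jet_eqI)
    fix t
    have "c *s p + t *s v = c *s (p + t *s (inverse c *s v))"
      using c by (simp add: vec_eq_iff field_simps)
    then have "f (c *s p + t *s v) = c ^ d * f (p + t *s (inverse c *s v))"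
      using f unfolding form_def by metis
    then show "f (c *s p + t *s v) = poly (smult (c ^ d) (jet f p (inverse c *s v))) t"
      by (simp only: poly_smult poly_jet[OF form_polyfun[OF f]])
  qed
  then show ?thesis
    using p by (simp add: vord_def)
qed

text \<open>\<open>r\<close> and \<open>s\<close> are the two affine charts of one binary form of
  degree \<open>n\<close>. It has at most \<open>degree r\<close> zeros at finite parameters, and
  its order at infinity is the deficit \<open>n - degree r\<close>.\<close>

lemma binary_form_zeros:
  fixes r s :: "'k::field_char_0 poly"
  assumes rev: "\<And>t. t \<noteq> 0 \<Longrightarrow> poly r t = t ^ n * poly s (1 / t)" and "r \<noteq> 0"
    and S: "finite S" "\<And>a. a \<in> S \<Longrightarrow> [:-a, 1:] ^ \<mu> a dvd r" and inf: "monom 1 k dvd s"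
  shows "(\<Sum>a\<in>S. \<mu> a) + k \<le> n"
proof -
  \<comment> \<open>Points with \<open>\<mu> a = 0\<close> need not be roots and are dropped before
    comparing with the set of roots.\<close>
  have "(\<Sum>a\<in>S. \<mu> a) = (\<Sum>a\<in>{a\<in>S. \<mu> a > 0}. \<mu> a)"
    by (rule sum.mono_neutral_right) (auto simp: S)
  also have "\<dots> \<le> (\<Sum>a\<in>{a\<in>S. \<mu> a > 0}. order a r)"
    by (rule sum_mono) (use S \<open>r \<noteq> 0\<close> order_divides in blast)
  also have "\<dots> \<le> (\<Sum>a | poly r a = 0. order a r)"
  proof (rule sum_mono2)
    show "{a \<in> S. 0 < \<mu> a} \<subseteq> {a. poly r a = 0}"
    proof safe
      fix a assume "a \<in> S" "0 < \<mu> a"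
      then have "[:-a, 1:] dvd r"
        by (meson S(2) dvd_power dvd_trans)
      then show "poly r a = 0"
        by (simp add: poly_eq_0_iff_dvd)
    qed
  qed (auto simp: poly_roots_finite \<open>r \<noteq> 0\<close>)
  also have "\<dots> \<le> degree r"
    by (rule sum_order_le_degree[OF \<open>r \<noteq> 0\<close>])
  finally have *: "(\<Sum>a\<in>S. \<mu> a) \<le> degree r" .
  \<comment> \<open>\<open>reflect_poly r\<close> has a nonzero constant term, the leading
    coefficient of \<open>r\<close>. So the left side has order exactly \<open>n\<close> at 0, while
    the right side has order at least \<open>degree r + k\<close>.\<close>
  have "poly (monom 1 n * reflect_poly r) u = poly (monom 1 (degree r) * s) u" for u
  proof (rule polyuni_eqI[of "poly (monom 1 n * reflect_poly r)" "poly (monom 1 (degree r) * s)" 0])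
    fix u :: 'k assume "u \<noteq> 0"
    then show "poly (monom 1 n * reflect_poly r) u = poly (monom 1 (degree r) * s) u"
      using rev[of "1 / u"] by (simp add: poly_reflect_poly_nz poly_monom inverse_eq_divide power_one_over)
  qed (rule polyuni_poly)+
  then have eq: "monom 1 n * reflect_poly r = monom 1 (degree r) * s"
    by (simp add: poly_eq_poly_eq_iff[symmetric] fun_eq_iff)
  have "monom 1 (degree r + k) dvd monom 1 (degree r) * s"
    using inf by (metis mult_dvd_mono dvd_refl mult_monom mult_1)
  then have "monom 1 (degree r + k) dvd monom 1 n * reflect_poly r"
    by (simp add: eq)
  moreover have "coeff (monom 1 n * reflect_poly r) n \<noteq> 0"
    using \<open>r \<noteq> 0\<close> by (simp add: coeff_monom_mult)
  ultimately have "degree r + k \<le> n"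
    unfolding monom_1_dvd_iff' using not_less by blast
  with * show ?thesis by simp
qed

text \<open>In the chart \<open>A + t *s B\<close> the vector \<open>B\<close> is the point at
  infinity, and exchanging \<open>A\<close> and \<open>B\<close> gives the other chart.\<close>

lemma line_bezout:
  assumes f: "form d f" and nz: "f (A + t0 *s B) \<noteq> 0"
    and S: "finite S" "\<And>a. a \<in> S \<Longrightarrow> vord f (A + a *s B) (\<mu> a)" and inf: "vord f B k"
  shows "(\<Sum>a\<in>S. \<mu> a) + k \<le> d"
proof (rule binary_form_zeros[of "jet f A B" d "jet f B A"])
  have pf: "polyfun f" using f by (rule form_polyfun)
  show "poly (jet f A B) t = t ^ d * poly (jet f B A) (1 / t)" if "t \<noteq> 0" for t
  proof -
    have "A + t *s B = t *s (B + (1 / t) *s A)"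
      using that by (simp add: vec_eq_iff field_simps)
    then have "f (A + t *s B) = t ^ d * f (B + (1 / t) *s A)"
      using f unfolding form_def by metis
    then show ?thesis
      by (simp only: poly_jet[OF pf])
  qed
  show "jet f A B \<noteq> 0"
    using nz poly_jet[OF pf, of A B t0] by auto
  show "[:-a, 1:] ^ \<mu> a dvd jet f A B" if a: "a \<in> S" for a
  proof -
    obtain q where q: "jet f (A + a *s B) B = monom 1 (\<mu> a) * q"
      using S(2)[OF a] by (auto simp: vord_def simp flip: monom_1_dvd_iff')
    have "jet f A B = [:-a, 1:] ^ \<mu> a * pcompose q [:-a, 1:]"
    proof (rule jet_eqI)
      fix t
      have "A + t *s B = A + a *s B + (t - a) *s B"
        by (simp add: vec_eq_iff algebra_simps)
      then have "f (A + t *s B) = poly (jet f (A + a *s B) B) (t - a)"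
        by (simp only: poly_jet[OF pf])
      then show "f (A + t *s B) = poly ([:-a, 1:] ^ \<mu> a * pcompose q [:-a, 1:]) t"
        by (simp add: q poly_monom poly_pcompose poly_power)
    qed
    then show ?thesis by simp
  qed
  show "monom 1 k dvd jet f B A"
    using inf by (simp add: vord_def monom_1_dvd_iff')
qed (rule S)

text \<open>Bezout on the line from \<open>p\<close> to a point where \<open>f\<close> does not
  vanish.\<close>

lemma vord_le_degree:
  assumes "form d f" "f u \<noteq> 0" "vord f p m"
  shows "m \<le> d"
  using line_bezout[of d f p 1 "u - p" "{0}" "\<lambda>_. m" 0] assms by (simp add: vord_0)

section \<open>Determinants and divisibility by linear forms\<close>

definition det3 :: "'k::comm_ring_1 ^ 3 \<Rightarrow> 'k ^ 3 \<Rightarrow> 'k ^ 3 \<Rightarrow> 'k"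
  where "det3 a b c =
    a $ 1 * (b $ 2 * c $ 3 - b $ 3 * c $ 2) - a $ 2 * (b $ 1 * c $ 3 - b $ 3 * c $ 1)
    + a $ 3 * (b $ 1 * c $ 2 - b $ 2 * c $ 1)"

lemma det3_cramer:
  "det3 a b c *s v = det3 v b c *s a + det3 a v c *s b + det3 a b v *s c"
  by (simp add: vec_eq_iff forall_3 det3_def) (simp add: algebra_simps)

lemma form_det3: "form 1 (det3 a b)"
  by (simp add: form_def det3_def[abs_def] algebra_simps) (intro polyfun_intros)

text \<open>The values of a polynomial at two points differing by a multiple of \<open>l v\<close>
  differ by a multiple of \<open>l v\<close>. For linear \<open>l\<close> with
  \<open>l w = 1\<close>, the point \<open>v - l v *s w\<close> is the projection of
  \<open>v\<close> to the line \<open>l = 0\<close>.\<close>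

lemma linear_decomposition:
  assumes "polyfun f" and l: "polyfun l"
  shows "\<exists>g. polyfun g \<and> (\<forall>v. f v - f (v - l v *s w) = l v * g v)"
  using assms(1)
proof induction
  case (const c)
  show ?case by (rule exI[of _ "\<lambda>_. 0"]) (simp add: polyfun.const)
next
  case (coord i)
  show ?case by (rule exI[of _ "\<lambda>_. w $ i"]) (simp add: polyfun.const)
next
  case (add f g)
  then obtain f' g' where "polyfun f'" "\<And>v. f v - f (v - l v *s w) = l v * f' v"
    "polyfun g'" "\<And>v. g v - g (v - l v *s w) = l v * g' v" by blast
  then show ?case
    by (intro exI[of _ "\<lambda>v. f' v + g' v"]) (simp add: polyfun.add distrib_left add_diff_add)
next
  case (mult f g)
  then obtain f' g' where *: "polyfun f'" "\<And>v. f v - f (v - l v *s w) = l v * f' v"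
    "polyfun g'" "\<And>v. g v - g (v - l v *s w) = l v * g' v" by blast
  have "f v * g v - f (v - l v *s w) * g (v - l v *s w)
      = l v * (f' v * g v + f (v - l v *s w) * g' v)" for v
  proof -
    have "f v * g v - f (v - l v *s w) * g (v - l v *s w)
        = (f v - f (v - l v *s w)) * g v + f (v - l v *s w) * (g v - g (v - l v *s w))"
      by (simp add: algebra_simps)
    then show ?thesis by (simp only: *) (simp add: algebra_simps)
  qed
  moreover have "polyfun (\<lambda>v. f (v - l v *s w))"
    by (rule polyfun_compose[OF mult.hyps(1)]) (simp, intro polyfun_intros l)
  then have "polyfun (\<lambda>v. f' v * g v + f (v - l v *s w) * g' v)"
    using * mult.hyps by (intro polyfun_intros)
  ultimately show ?case by blast
qed

definition pdvd :: "('k::field_char_0 ^ 3 \<Rightarrow> 'k) \<Rightarrow> ('k ^ 3 \<Rightarrow> 'k) \<Rightarrow> bool"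
  where "pdvd l f \<longleftrightarrow> (\<exists>g. polyfun g \<and> (\<forall>v. f v = l v * g v))"

lemma det3_rotate: "det3 b c a = det3 a b c"
  by (simp add: det3_def algebra_simps)

lemma det3_swap: "det3 b a c = - det3 a b c"
  by (simp add: det3_def algebra_simps)

lemma det3_eq_0_span:
  fixes a b v w :: "'k::field ^ 3"
  assumes "det3 a b w \<noteq> 0" and "det3 a b v = 0"
  shows "\<exists>x y. v = x *s a + y *s b"
proof -
  have "det3 a b w *s v = det3 v b w *s a + det3 a v w *s b"
    using det3_cramer[of a b w v] assms(2) by simp
  then have "inverse (det3 a b w) *s (det3 a b w *s v)
      = inverse (det3 a b w) *s (det3 v b w *s a + det3 a v w *s b)"
    by simp
  then have "v = (inverse (det3 a b w) * det3 v b w) *s a + (inverse (det3 a b w) * det3 a v w) *s b"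
    using assms(1) by (simp add: vector_add_ldistrib vector_smult_assoc)
  then show ?thesis by blast
qed

text \<open>The chart \<open>A + t *s B\<close> omits the multiples of \<open>B\<close>; they
  correspond to \<open>x = 0\<close>, which a polynomial identity in \<open>x\<close>
  supplies.\<close>

lemma form_vanish_on_line:
  assumes f: "form d f" and z: "\<And>t. f (A + t *s B) = 0"
  shows "f (x *s A + y *s B) = 0"
proof -
  have *: "f (x *s A + y *s B) = 0" if "x \<noteq> 0" for x
  proof -
    have "x *s A + y *s B = x *s (A + (y / x) *s B)"
      using that by (simp add: vec_eq_iff field_simps)
    then have "f (x *s A + y *s B) = x ^ d * f (A + (y / x) *s B)"
      using f unfolding form_def by metis
    then show ?thesis by (simp add: z)
  qed
  have "polyuni (\<lambda>x. f (x *s A + y *s B))"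
    by (rule polyuni_compose[OF form_polyfun[OF f]]) (simp, intro polyuni_intros)
  then show ?thesis
    using polyuni_eqI[of "\<lambda>x. f (x *s A + y *s B)" "\<lambda>_. 0" 0 x] * polyuni_const by blast
qed

text \<open>After normalising \<open>w\<close>, projection along it lands on the line, where
  \<open>f\<close> vanishes; the decomposition then leaves \<open>f\<close> as a multiple of the
  line form.\<close>

lemma pdvd_line:
  assumes f: "form d f" and z: "\<And>t. f (A + t *s B) = 0" and w: "det3 A B w \<noteq> 0"
  shows "pdvd (det3 A B) f"
proof -
  define w' where "w' = inverse (det3 A B w) *s w"
  have w': "det3 A B w' = 1"
    using w form_det3[of A B] by (simp add: w'_def form_def)
  obtain g where g: "polyfun g" "\<And>v. f v - f (v - det3 A B v *s w') = det3 A B v * g v"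
    using linear_decomposition[OF form_polyfun[OF f] form_polyfun[OF form_det3], of A B w'] by blast
  have "f (v - det3 A B v *s w') = 0" for v
  proof -
    have "det3 A B (v - det3 A B v *s w') = det3 A B v - det3 A B v * det3 A B w'"
      by (simp add: det3_def algebra_simps)
    then have "det3 A B (v - det3 A B v *s w') = 0"
      by (simp add: w')
    then obtain x y where "v - det3 A B v *s w' = x *s A + y *s B"
      using det3_eq_0_span[of A B w' "v - det3 A B v *s w'"] w' by auto
    then show ?thesis
      using form_vanish_on_line[OF f z] by simp
  qed
  then show ?thesis
    using g unfolding pdvd_def by (metis diff_zero)
qed

text \<open>Taking \<open>c = 0\<close> covers lines through two points only.\<close>

lemma pdvd_line3:
  assumes f: "form d f" and w: "det3 A B w \<noteq> 0"
    and C: "C = \<alpha> *s A + \<beta> *s B" "\<alpha> \<noteq> 0" "\<beta> \<noteq> 0"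
    and v: "vord f A a" "vord f B b" "vord f C c" and big: "d < a + b + c"
  shows "pdvd (det3 A B) f"
proof (rule pdvd_line[OF f _ w], rule ccontr)
  fix t0 assume nz: "f (A + t0 *s B) \<noteq> 0"
  have "A + (\<beta> / \<alpha>) *s B = inverse \<alpha> *s C"
    using C by (simp add: vec_eq_iff field_simps)
  then have "vord f (A + (\<beta> / \<alpha>) *s B) c"
    using vord_scale[OF f v(3), of "inverse \<alpha>"] C(2) by (metis nonzero_imp_inverse_nonzero)
  then have "(\<Sum>x\<in>{0, \<beta> / \<alpha>}. if x = 0 then a else c) + b \<le> d"
    using v by (intro line_bezout[OF f nz]) auto
  then show False
    using big C by simp
qed

text \<open>Each division lowers the degree by a positive \<open>e i\<close>, so repeated division
  stops.\<close>

lemma strip_components: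
  fixes f :: "'k::field_char_0 ^ 3 \<Rightarrow> 'k"
  assumes "finite I" and "form d f" and "f u \<noteq> 0" and l: "\<And>i. i \<in> I \<Longrightarrow> form (e i) (l i)"
    and e: "\<And>i. i \<in> I \<Longrightarrow> 0 < e i"
  shows "\<exists>a g dg. form dg g \<and> g u \<noteq> 0 \<and> (\<forall>v. f v = (\<Prod>i\<in>I. l i v ^ a i) * g v) \<and>
    d = (\<Sum>i\<in>I. a i * e i) + dg \<and> (\<forall>i\<in>I. \<not> pdvd (l i) g)"
  using assms(2,3)
proof (induction d arbitrary: f rule: less_induct)
  case (less d f)
  show ?case
  proof (cases "\<exists>j\<in>I. pdvd (l j) f")
    case False
    then show ?thesis
      using less.prems by (intro exI[of _ "\<lambda>_. 0"] exI[of _ f] exI[of _ d]) auto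
  next
    case True
    then obtain j h where j: "j \<in> I" and h: "polyfun h" "\<And>v. f v = l j v * h v"
      unfolding pdvd_def by blast
    have "form d (\<lambda>v. l j v * h v)"
      using less.prems(1) h(2) by (simp add: form_def)
    from form_divide[OF this l[OF j] h(1), of u]
    have d: "e j \<le> d" "form (d - e j) h"
      using less.prems h(2) by auto
    obtain a g dg where *: "form dg g" "g u \<noteq> 0" "\<And>v. h v = (\<Prod>i\<in>I. l i v ^ a i) * g v"
      "d - e j = (\<Sum>i\<in>I. a i * e i) + dg" "\<forall>i\<in>I. \<not> pdvd (l i) g"
      using less.IH[of "d - e j" h] d e[OF j] less.prems(2) h(2) by auto
    define a' where "a' = a(j := Suc (a j))"
    have "f v = (\<Prod>i\<in>I. l i v ^ a' i) * g v" for v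
      using j \<open>finite I\<close> by (simp add: h(2) *(3) a'_def prod.remove[of I j] mult_ac)
    moreover have "(\<Sum>i\<in>I. a' i * e i) = (\<Sum>i\<in>I. a i * e i) + e j"
      using j \<open>finite I\<close> by (simp add: a'_def sum.remove[of I j])
    then have "d = (\<Sum>i\<in>I. a' i * e i) + dg"
      using *(4) d(1) by linarith
    ultimately show ?thesis
      using * by blast
  qed
qed

text \<open>The split-off product has order at most the sum of \<open>a i * k i\<close> at
  \<open>p\<close>, and \<open>vord_divide\<close> passes the rest of \<open>m\<close> to
  \<open>g\<close>. The last clause keeps \<open>p\<close>, \<open>k\<close>, \<open>m\<close>
  general so that one and the same splitting serves all points.\<close>

lemma strip_components_vord:
  fixes f :: "'k::field_char_0 ^ 3 \<Rightarrow> 'k"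
  assumes "finite I" and "form d f" and "f u \<noteq> 0" and l: "\<And>i. i \<in> I \<Longrightarrow> form (e i) (l i)"
    and e: "\<And>i. i \<in> I \<Longrightarrow> 0 < e i"
  obtains a g dg where "form dg g" "g u \<noteq> 0" "d = (\<Sum>i\<in>I. a i * e i) + dg"
    "\<And>i. i \<in> I \<Longrightarrow> \<not> pdvd (l i) g"
    "\<And>p k m. (\<And>i. i \<in> I \<Longrightarrow> \<not> vord (l i) p (Suc (k i))) \<Longrightarrow> vord f p m \<Longrightarrow>
      vord g p (m - (\<Sum>i\<in>I. a i * k i))"
proof -
  obtain a g dg where *: "form dg g" "g u \<noteq> 0" "\<And>v. f v = (\<Prod>i\<in>I. l i v ^ a i) * g v"
    "d = (\<Sum>i\<in>I. a i * e i) + dg" "\<And>i. i \<in> I \<Longrightarrow> \<not> pdvd (l i) g"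
    using strip_components[of I d f u e l] assms by blast
  show thesis
  proof (rule that[OF *(1,2,4,5)])
    fix p k m assume k: "\<And>i. i \<in> I \<Longrightarrow> \<not> vord (l i) p (Suc (k i))" and m: "vord f p m"
    have pl: "polyfun (\<lambda>v. l i v ^ a i)" if "i \<in> I" for i
      using l[OF that] by (intro polyfun_power form_polyfun)
    have "\<not> vord (\<lambda>v. \<Prod>i\<in>I. l i v ^ a i) p (Suc (\<Sum>i\<in>I. a i * k i))"
      using l k by (intro not_vord_prod not_vord_power pl assms(1) form_polyfun) auto
    moreover have "vord (\<lambda>v. (\<Prod>i\<in>I. l i v ^ a i) * g v) p m"
      using m *(3) by (metis (no_types, lifting) ext)
    ultimately show "vord g p (m - (\<Sum>i\<in>I. a i * k i))"
      using pl form_polyfun[OF *(1)] by (intro vord_divide[of "\<lambda>v. \<Prod>i\<in>I. l i v ^ a i" g] polyfun_prod)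
  qed
qed

lemma not_vord_det3: "det3 A B w \<noteq> 0 \<Longrightarrow> \<not> vord (det3 A B) p (Suc 1)"
  using vord_le_degree[OF form_det3] by fastforce

section \<open>A conic\<close>

text \<open>The conic y^2 = x z, parametrized by (1, t, t^2) with (0, 0, 1) at infinity.\<close>

definition conic :: "'k::comm_ring_1 ^ 3 \<Rightarrow> 'k"
  where "conic v = v $ 2 ^ 2 - v $ 1 * v $ 3"

lemma form_conic: "form 2 conic"
  unfolding form_def
proof
  show "polyfun (conic :: 'a ^ 3 \<Rightarrow> 'a)"
    unfolding conic_def[abs_def] by (intro polyfun_intros)
qed (simp add: conic_def algebra_simps power2_eq_square)

text \<open>Division with remainder by a polynomial monic in the second coordinate. The two
  invariance clauses say that \<open>a\<close> and \<open>b\<close> do not involve this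
  coordinate.\<close>

lemma conic_decomposition:
  fixes f :: "'k::comm_ring_1 ^ 3 \<Rightarrow> 'k"
  assumes "polyfun f"
  shows "\<exists>g a b. polyfun g \<and> polyfun a \<and> polyfun b \<and>
    (\<forall>x y y' z. a (vector [x, y, z]) = a (vector [x, y', z])) \<and>
    (\<forall>x y y' z. b (vector [x, y, z]) = b (vector [x, y', z])) \<and>
    (\<forall>v. f v = conic v * g v + a v + v $ 2 * b v)"
  using assms
proof induction
  case (const c)
  show ?case
    by (rule exI[of _ "\<lambda>_. 0"], rule exI[of _ "\<lambda>_. c"], rule exI[of _ "\<lambda>_. 0"]) (simp add: polyfun.const)
next
  case (coord i)
  consider "i = 1 \<or> i = 3" | "i = 2"
    using exhaust_3 by blast
  then show ?case
  proof cases
    case 1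
    then show ?thesis
      by (intro exI[of _ "\<lambda>_. 0"] exI[of _ "\<lambda>v. v $ i"]) (auto simp: polyfun.const polyfun.coord)
  next
    case 2
    then show ?thesis
      by (intro exI[of _ "\<lambda>_. 0"] exI[of _ "\<lambda>_. 1"]) (auto simp: polyfun.const polyfun.coord)
  qed
next
  case (add f f')
  then obtain g a b g' a' b' where *:
    "polyfun g" "polyfun a" "polyfun b"
    "\<And>x y y' z. a (vector [x, y, z]) = a (vector [x, y', z])"
    "\<And>x y y' z. b (vector [x, y, z]) = b (vector [x, y', z])"
    "\<And>v. f v = conic v * g v + a v + v $ 2 * b v"
    "polyfun g'" "polyfun a'" "polyfun b'"
    "\<And>x y y' z. a' (vector [x, y, z]) = a' (vector [x, y', z])"
    "\<And>x y y' z. b' (vector [x, y, z]) = b' (vector [x, y', z])"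
    "\<And>v. f' v = conic v * g' v + a' v + v $ 2 * b' v"
    by metis
  show ?case
  proof (rule exI[of _ "\<lambda>v. g v + g' v"], rule exI[of _ "\<lambda>v. a v + a' v"],
      rule exI[of _ "\<lambda>v. b v + b' v"], intro conjI allI)
    fix x y y' z
    show "a (vector [x, y, z]) + a' (vector [x, y, z]) = a (vector [x, y', z]) + a' (vector [x, y', z])"
      "b (vector [x, y, z]) + b' (vector [x, y, z]) = b (vector [x, y', z]) + b' (vector [x, y', z])"
      using *(4,5,10,11)[of x y z y'] by simp_all
  qed (use * in \<open>auto intro: polyfun.add simp: algebra_simps\<close>)
next
  case (mult f f')
  then obtain g a b g' a' b' where *:
    "polyfun g" "polyfun a" "polyfun b"
    "\<And>x y y' z. a (vector [x, y, z]) = a (vector [x, y', z])"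
    "\<And>x y y' z. b (vector [x, y, z]) = b (vector [x, y', z])"
    "\<And>v. f v = conic v * g v + a v + v $ 2 * b v"
    "polyfun g'" "polyfun a'" "polyfun b'"
    "\<And>x y y' z. a' (vector [x, y, z]) = a' (vector [x, y', z])"
    "\<And>x y y' z. b' (vector [x, y, z]) = b' (vector [x, y', z])"
    "\<And>v. f' v = conic v * g' v + a' v + v $ 2 * b' v"
    by metis
  \<comment> \<open>The product of the remainders contains y^2 b b', rewritten as
    \<open>conic\<close> times b b' plus x z b b'; these are the last terms of \<open>?g\<close> and
    \<open>?a\<close>.\<close>
  let ?g = "\<lambda>v. g v * (conic v * g' v + a' v + v $ 2 * b' v) + (a v + v $ 2 * b v) * g' v + b v * b' v"
  let ?a = "\<lambda>v. a v * a' v + v $ 1 * v $ 3 * (b v * b' v)"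
  let ?b = "\<lambda>v. a v * b' v + a' v * b v"
  show ?case
  proof (rule exI[of _ ?g], rule exI[of _ ?a], rule exI[of _ ?b], intro conjI)
    show "\<forall>v. f v * f' v = conic v * ?g v + ?a v + v $ 2 * ?b v"
      by (simp add: *(6,12)) (simp add: conic_def power2_eq_square algebra_simps)
    have "polyfun (conic :: 'k ^ 3 \<Rightarrow> 'k)"
      unfolding conic_def[abs_def] by (intro polyfun_intros)
    then show "polyfun ?g" "polyfun ?a" "polyfun ?b"
      using * by (auto intro!: polyfun_intros)
    show "\<forall>x y y' z. ?a (vector [x, y, z]) = ?a (vector [x, y', z])"
    proof (intro allI)
      fix x y y' z
      show "?a (vector [x, y, z]) = ?a (vector [x, y', z])"
        using *(4,5,10,11)[of x y z y'] by simp
    qed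
    show "\<forall>x y y' z. ?b (vector [x, y, z]) = ?b (vector [x, y', z])"
    proof (intro allI)
      fix x y y' z
      show "?b (vector [x, y, z]) = ?b (vector [x, y', z])"
        using *(4,5,10,11)[of x y z y'] by simp
    qed
  qed
qed

text \<open>For fixed x \<noteq> 0 and z, both square roots s and -s of x z give points of the
  conic, so the remainder satisfies a + s b = a - s b = 0. As 2 is invertible, a = 0 and s b = 0;
  integrality removes the excluded values of x and z.\<close>

lemma pdvd_conic:
  fixes f :: "'k::{alg_closed_field, field_char_0} ^ 3 \<Rightarrow> 'k"
  assumes f: "form d f" and z: "\<And>t. f (vector [1, t, t ^ 2]) = 0"
  shows "pdvd conic f"
proof -
  obtain g a b where *: "polyfun g" "polyfun a" "polyfun b"
    "\<And>x y y' z. a (vector [x, y, z]) = a (vector [x, y', z])"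
    "\<And>x y y' z. b (vector [x, y, z]) = b (vector [x, y', z])"
    "\<And>v. f v = conic v * g v + a v + v $ 2 * b v"
    using conic_decomposition[OF form_polyfun[OF f]] by metis
  have f0: "f (vector [x, y, z]) = 0" if "x \<noteq> 0" "y ^ 2 = x * z" for x y z
  proof -
    have "vector [x, y, z] = x *s (vector [1, y / x, (y / x) ^ 2] :: 'k ^ 3)"
      using that by (simp add: vec_eq_iff forall_3 field_simps power2_eq_square)
    then show ?thesis
      using f z unfolding form_def by simp
  qed
  \<comment> \<open>Where x z = 0 the two square roots coincide and say nothing about
    \<open>b\<close>, hence the factor \<open>v $ 3\<close>.\<close>
  have ab: "a v = 0 \<and> v $ 3 * b v = 0" if v1: "v $ 1 \<noteq> 0" for v
  proof -
    define x y z where "x = v $ 1" and "y = v $ 2" and "z = v $ 3"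
    have v: "v = vector [x, y, z]"
      by (simp add: vec_eq_iff forall_3 x_def y_def z_def)
    obtain s where s: "s ^ 2 = x * z"
      using nth_root_exists[of 2 "x * z"] by auto
    have c0: "conic (vector [x, s, z]) = 0" "conic (vector [x, - s, z]) = 0"
      using s by (simp_all add: conic_def)
    have "0 = a (vector [x, s, z]) + s * b (vector [x, s, z])"
      using f0[of x s z] *(6)[of "vector [x, s, z]"] v1 s c0 by (simp add: x_def)
    then have "0 = a v + s * b v"
      using *(4,5)[of x s z y] v by simp
    moreover have "0 = a (vector [x, - s, z]) + (- s) * b (vector [x, - s, z])"
      using f0[of x "- s" z] *(6)[of "vector [x, - s, z]"] v1 s c0 by (simp add: x_def)
    then have "0 = a v - s * b v"
      using *(4,5)[of x "- s" z y] v by simp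
    ultimately have "2 * a v = 0" "2 * (s * b v) = 0"
      by algebra+
    then have "a v = 0" "s * b v = 0" by simp_all
    moreover have "v $ 3 = 0" if "s = 0"
      using s that v1 by (auto simp: x_def z_def)
    ultimately show ?thesis by auto
  qed
  have "a v = 0" for v
    using polyfun_mult_eq_0[of "\<lambda>v. v $ 1" a "axis 1 1" v] ab *(2)
    by (auto simp: polyfun.coord axis_def)
  moreover have "b v = 0" for v
    using polyfun_mult_eq_0[of "\<lambda>v. v $ 1 * v $ 3" b "vector [1, 0, 1]" v] ab *(3)
    by (force intro: polyfun_intros)
  ultimately show ?thesis
    using *(1,6) unfolding pdvd_def by auto
qed

section \<open>Bezout for a form and the conic\<close>

lemma polyuni_vector:
  fixes a b c :: "'k::comm_ring_1 \<Rightarrow> 'k"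
  assumes "polyuni a" "polyuni b" "polyuni c"
  shows "polyuni (\<lambda>t. (vector [a t, b t, c t] :: 'k ^ 3) $ i)"
  using assms exhaust_3[of i] by auto

text \<open>The parametrization is quadratic, so \<open>f\<close> restricts to a binary form of
  degree \<open>2 * d\<close>; its chart at infinity is (u^2, u, 1).\<close>

lemma conic_bezout:
  fixes f :: "'k::field_char_0 ^ 3 \<Rightarrow> 'k"
  assumes f: "form d f" and nz: "f (vector [1, t0, t0 ^ 2]) \<noteq> 0"
    and S: "finite S" "\<And>a. a \<in> S \<Longrightarrow> vord f (vector [1, a, a ^ 2]) (\<mu> a)"
    and inf: "vord f (vector [0, 0, 1]) k"
  shows "(\<Sum>a\<in>S. \<mu> a) + k \<le> 2 * d"
proof -
  note pf = form_polyfun[OF f]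
  have "polyuni (\<lambda>t. f (vector [1, t, t ^ 2]))" "polyuni (\<lambda>u. f (vector [u ^ 2, u, 1]))"
    by (intro polyuni_compose[OF pf] polyuni_vector polyuni_const polyuni_id polyuni_power)+
  then obtain r s where r: "\<And>t. f (vector [1, t, t ^ 2]) = poly r t"
    and s: "\<And>u. f (vector [u ^ 2, u, 1]) = poly s u"
    unfolding polyuni_def by metis
  show ?thesis
  proof (rule binary_form_zeros[of r "2 * d" s])
    show "poly r t = t ^ (2 * d) * poly s (1 / t)" if "t \<noteq> 0" for t
    proof -
      have "vector [1, t, t ^ 2] = (t ^ 2) *s (vector [(1 / t) ^ 2, 1 / t, 1] :: 'k ^ 3)"
        using that by (simp add: vec_eq_iff forall_3 field_simps power2_eq_square)
      then have "f (vector [1, t, t ^ 2]) = (t ^ 2) ^ d * f (vector [(1 / t) ^ 2, 1 / t, 1])"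
        using f unfolding form_def by metis
      then show ?thesis
        by (simp only: r s power_mult)
    qed
    show "r \<noteq> 0"
      using nz r by auto
    show "[:-a, 1:] ^ \<mu> a dvd r" if a: "a \<in> S" for a
    proof -
      \<comment> \<open>The conic in a local parameter at a: (a + t)^2 = a^2 + t (t + 2 a).\<close>
      obtain q where q: "\<And>t. f (vector [1, a, a ^ 2] + t *s vector [0, 1, t + 2 * a]) = t ^ \<mu> a * poly q t"
        using vord_curve[OF pf S(2)[OF a], of "\<lambda>t. vector [0, 1, t + 2 * a]"]
          polyuni_vector[OF polyuni_const polyuni_const polyuni_add[OF polyuni_id polyuni_const]]
        by blast
      have "poly r t = poly ([:-a, 1:] ^ \<mu> a * pcompose q [:-a, 1:]) t" for t
      proof -
        have "vector [1, t, t ^ 2] = vector [1, a, a ^ 2] + (t - a) *s (vector [0, 1, (t - a) + 2 * a] :: 'k ^ 3)"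
          by (simp add: vec_eq_iff forall_3 algebra_simps power2_eq_square)
        then have "poly r t = (t - a) ^ \<mu> a * poly q (t - a)"
          by (simp only: q flip: r)
        then show ?thesis
          by (simp add: poly_pcompose poly_power)
      qed
      then have "r = [:-a, 1:] ^ \<mu> a * pcompose q [:-a, 1:]"
        by (simp add: poly_eq_poly_eq_iff[symmetric] fun_eq_iff)
      then show ?thesis by simp
    qed
    obtain q where q: "\<And>t. f (vector [0, 0, 1] + t *s vector [t, 1, 0]) = t ^ k * poly q t"
      using vord_curve[OF pf inf, of "\<lambda>t. vector [t, 1, 0]"]
        polyuni_vector[OF polyuni_id polyuni_const polyuni_const]
      by blast
    have "poly s t = poly (monom 1 k * q) t" for t
    proof -
      have "vector [t ^ 2, t, 1] = vector [0, 0, 1] + t *s (vector [t, 1, 0] :: 'k ^ 3)"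
        by (simp add: vec_eq_iff forall_3 power2_eq_square)
      then have "poly s t = t ^ k * poly q t"
        by (simp only: q flip: s)
      then show ?thesis by (simp add: poly_monom)
    qed
    then have "s = monom 1 k * q"
      by (simp add: poly_eq_poly_eq_iff[symmetric] fun_eq_iff)
    then show "monom 1 k dvd s" by simp
  qed (rule S)
qed

lemma conic_expand:
  fixes p v :: "'k::comm_ring_1 ^ 3"
  shows
  "conic (p + t *s v) = poly [:conic p, 2 * (p $ 2 * v $ 2) - p $ 1 * v $ 3 - v $ 1 * p $ 3, conic v:] t"
  by (simp add: conic_def algebra_simps power2_eq_square)

text \<open>Smoothness: the linear Taylor term is the polar form of the conic, nondegenerate because
  2 \<noteq> 0.\<close>

lemma not_vord_conic:
  fixes p :: "'k::field_char_0 ^ 3"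
  assumes "p \<noteq> 0"
  shows "\<not> vord conic p (Suc 1)"
proof
  assume "vord conic p (Suc 1)"
  then have *: "2 * (p $ 2 * v $ 2) - p $ 1 * v $ 3 - v $ 1 * p $ 3 = 0" for v :: "'k ^ 3"
  proof -
    have "coeff (jet conic p v) 1 = 0"
      using \<open>vord conic p (Suc 1)\<close> unfolding vord_def by blast
    then show ?thesis
      by (simp add: jet_eqI[OF conic_expand])
  qed
  have "p $ 3 = 0" "p $ 2 = 0" "p $ 1 = 0"
    using *[of "vector [1, 0, 0]"] *[of "vector [0, 1, 0]"] *[of "vector [0, 0, 1]"] by simp_all
  then show False
    using assms by (simp add: vec_eq_iff forall_3)
qed

section \<open>Points and lines of the projective plane\<close>

abbreviation rep :: "'k::field proj_plane \<Rightarrow> 'k ^ 3"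
  where "rep \<equiv> rep_proj_plane"

lemma rep_nonzero: "rep P \<noteq> 0"
  using Quotient_rep_reflp[OF Quotient_proj_plane, of P] by (simp add: proj_rel_def)

lemma abs_rep: "abs_proj_plane (rep P) = P"
  by (rule Quotient_abs_rep[OF Quotient_proj_plane])

lemma rep_eqI:
  assumes "rep P = c *s rep Q"
  shows "P = Q"
proof -
  have "c \<noteq> 0"
    using assms rep_nonzero[of P] by auto
  then have "proj_rel (rep Q) (rep P)"
    using assms rep_nonzero by (auto simp: proj_rel_def)
  then show ?thesis
    using Quotient_rel_rep[OF Quotient_proj_plane] by metis
qed

lemma rep_abs:
  assumes "v \<noteq> 0"
  obtains c where "c \<noteq> 0" "rep (abs_proj_plane v) = c *s v"
proof -
  have "proj_rel v v"
    using assms by (auto simp: proj_rel_def intro!: exI[of _ 1])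
  then have "proj_rel (rep (abs_proj_plane v)) v"
    using Quotient_rep_abs[OF Quotient_proj_plane] by blast
  then obtain c where "c \<noteq> 0" "v = c *s rep (abs_proj_plane v)"
    by (auto simp: proj_rel_def)
  then have "inverse c *s v = inverse c *s (c *s rep (abs_proj_plane v))"
    by simp
  also have "\<dots> = rep (abs_proj_plane v)"
    using \<open>c \<noteq> 0\<close> by (simp add: vector_smult_assoc)
  finally have "rep (abs_proj_plane v) = inverse c *s v" "inverse c \<noteq> 0"
    using \<open>c \<noteq> 0\<close> by simp_all
  then show ?thesis using that by blast
qed

text \<open>Repeated points count as collinear, so \<open>\<not> col P Q R\<close> also makes the
  three points distinct.\<close>

definition col :: "'k::field proj_plane \<Rightarrow> 'k proj_plane \<Rightarrow> 'k proj_plane \<Rightarrow> bool"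
  where "col P Q R \<longleftrightarrow> det3 (rep P) (rep Q) (rep R) = 0"

abbreviation line_form :: "'k::field proj_plane \<Rightarrow> 'k proj_plane \<Rightarrow> 'k ^ 3 \<Rightarrow> 'k"
  where "line_form P Q \<equiv> det3 (rep P) (rep Q)"

lemma col_rotate: "col P Q R \<Longrightarrow> col Q R P"
  unfolding col_def using det3_rotate by metis

lemma col_swap: "col P Q R \<Longrightarrow> col Q P R"
  unfolding col_def using det3_swap by (metis add.inverse_neutral)

lemma col_same: "col P P Q"
  by (simp add: col_def det3_def algebra_simps)

text \<open>Vanishing on the basis vectors would make all 2 by 2 minors of \<open>a\<close> and
  \<open>b\<close> vanish, and \<open>a\<close> would be a multiple of \<open>b\<close>.\<close>

lemma ex_det3_nonzero:
  fixes a b :: "'k::field ^ 3"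
  assumes "b \<noteq> 0" and "\<And>c. a \<noteq> c *s b"
  shows "\<exists>w. det3 a b w \<noteq> 0"
proof (rule ccontr)
  assume "\<not> ?thesis"
  then have *: "det3 a b w = 0" for w by blast
  have e: "b $ 2 * a $ 3 = b $ 3 * a $ 2" "b $ 1 * a $ 3 = b $ 3 * a $ 1" "b $ 1 * a $ 2 = b $ 2 * a $ 1"
    using *[of "vector [1, 0, 0]"] *[of "vector [0, 1, 0]"] *[of "vector [0, 0, 1]"]
    by (simp_all add: det3_def algebra_simps)
  obtain i where i: "b $ i \<noteq> 0"
    using assms(1) by (auto simp: vec_eq_iff)
  have "a $ j * b $ i = a $ i * b $ j" for j
    using exhaust_3[of i] exhaust_3[of j] e by (auto simp: mult.commute)
  then have "a = (a $ i / b $ i) *s b"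
    using i by (simp add: vec_eq_iff field_simps)
  then show False using assms(2) by blast
qed

lemma ex_ln_nonzero: "P \<noteq> Q \<Longrightarrow> \<exists>w. line_form P Q w \<noteq> 0"
  using ex_det3_nonzero rep_nonzero rep_eqI by metis

lemma col_span:
  assumes "P \<noteq> Q" and "col P Q R"
  obtains x y where "rep R = x *s rep P + y *s rep Q"
  using assms ex_ln_nonzero det3_eq_0_span unfolding col_def by metis

lemma col_trans:
  assumes "P \<noteq> Q" and "col P Q R" and "col P Q S"
  shows "col P R S"
proof -
  obtain x y where R: "rep R = x *s rep P + y *s rep Q"
    using col_span[OF assms(1,2)] by blast
  obtain x' y' where S: "rep S = x' *s rep P + y' *s rep Q"
    using col_span[OF assms(1,3)] by blast
  show ?thesis
    by (simp add: col_def R S det3_def algebra_simps)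
qed

lemma col_refl: "col P P Q" "col P Q P" "col P Q Q"
  by (simp_all add: col_def det3_def algebra_simps)

lemma col_trans':
  assumes "P \<noteq> Q" and "col P Q R" and "col P Q S"
  shows "col Q R S"
  using col_trans[OF assms(1)[symmetric]] assms(2,3) col_swap by blast

lemma col_commute: "col P Q R = col Q P R"
  using col_swap by blast

lemma col_commute': "col P Q R = col P R Q"
  using col_swap col_rotate by blast

lemmas col_ac = col_commute col_commute'

section \<open>Multiplicities of a form along lines through given points\<close>

lemma pdvd_ln3:
  assumes f: "form d f" and PQ: "P \<noteq> Q" and R: "col P Q R" "R \<noteq> P" "R \<noteq> Q"
    and v: "vord f (rep P) a" "vord f (rep Q) b" "vord f (rep R) c" and n: "\<not> pdvd (line_form P Q) f"
  shows "a + b + c \<le> d"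
proof -
  obtain w where w: "line_form P Q w \<noteq> 0"
    using ex_ln_nonzero[OF PQ] by blast
  obtain x y where xy: "rep R = x *s rep P + y *s rep Q"
    using col_span[OF PQ R(1)] by blast
  have "x \<noteq> 0" "y \<noteq> 0"
    using rep_eqI[of R y Q] rep_eqI[of R x P] R(2,3) xy by auto
  then show ?thesis
    using pdvd_line3[OF f w xy] v n by (meson not_less)
qed

lemma pdvd_ln2:
  assumes f: "form d f" and PQ: "P \<noteq> Q"
    and v: "vord f (rep P) a" "vord f (rep Q) b" and n: "\<not> pdvd (line_form P Q) f"
  shows "a + b \<le> d"
proof -
  obtain w where w: "line_form P Q w \<noteq> 0"
    using ex_ln_nonzero[OF PQ] by blast
  show ?thesis
    using pdvd_line3[OF f w, of "rep P + rep Q" 1 1 a b 0] v n vord_0 by fastforce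
qed

text \<open>The order is 0 off the line and at most 1 on it; \<open>of_bool\<close> lets the loss of
  order at a point count the lines through it with their exponents.\<close>

lemma not_vord_ln:
  assumes "P \<noteq> Q"
  shows "\<not> vord (line_form P Q) (rep R) (Suc (of_bool (col P Q R)))"
proof (cases "col P Q R")
  case True
  then show ?thesis using ex_ln_nonzero[OF assms] not_vord_det3 by fastforce
next
  case False
  then show ?thesis
    using not_vord_1[OF form_polyfun[OF form_det3]] by (auto simp: col_def)
qed

lemma strip_lines:
  fixes f :: "'k::field_char_0 ^ 3 \<Rightarrow> 'k" and I :: "'b set"
  assumes "finite I" and "form d f" and "f u \<noteq> 0" and AB: "\<And>i. i \<in> I \<Longrightarrow> A i \<noteq> B i"
  obtains a g dg where "form dg g" "g u \<noteq> 0" "d = (\<Sum>i\<in>I. a i) + dg"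
    "\<And>i. i \<in> I \<Longrightarrow> \<not> pdvd (line_form (A i) (B i)) g"
    "\<And>R m. vord f (rep R) m \<Longrightarrow>
      vord g (rep R) (m - (\<Sum>i\<in>I. a i * of_bool (col (A i) (B i) R)))"
proof (rule strip_components_vord[OF assms(1-3), of "\<lambda>_. 1" "\<lambda>i. line_form (A i) (B i)"])
  show "form 1 (line_form (A i) (B i))" for i
    by (rule form_det3)
  fix a :: "'b \<Rightarrow> nat" and g dg
  assume *: "form dg g" "g u \<noteq> 0" "d = (\<Sum>i\<in>I. a i * 1) + dg"
    "\<And>i. i \<in> I \<Longrightarrow> \<not> pdvd (line_form (A i) (B i)) g"
    "\<And>p k m. (\<And>i. i \<in> I \<Longrightarrow> \<not> vord (line_form (A i) (B i)) p (Suc (k i))) \<Longrightarrow> vord f p m \<Longrightarrow>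
      vord g p (m - (\<Sum>i\<in>I. a i * k i))"
  have "vord g (rep R) (m - (\<Sum>i\<in>I. a i * of_bool (col (A i) (B i) R)))"
    if "vord f (rep R) m" for R m
    by (rule *(5)[OF _ that]) (rule not_vord_ln[OF AB])
  moreover have "d = (\<Sum>i\<in>I. a i) + dg"
    using *(3) by simp
  ultimately show thesis
    using that *(1,2,4) by blast
qed simp

section \<open>Triangles with a further point on every side\<close>

text \<open>\<open>X\<close>, \<open>Y\<close>, \<open>T\<close> lie on the sides opposite to
  \<open>U\<close>, \<open>V\<close>, \<open>W\<close>, away from the vertices; they may or may not
  be collinear.\<close>

definition tri :: "'k::field proj_plane \<Rightarrow> 'k proj_plane \<Rightarrow> 'k proj_plane \<Rightarrow>
    'k proj_plane \<Rightarrow> 'k proj_plane \<Rightarrow> 'k proj_plane \<Rightarrow> bool"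
  where "tri U V W X Y T \<longleftrightarrow> \<not> col U V W \<and>
    col V W X \<and> X \<noteq> V \<and> X \<noteq> W \<and> col U W Y \<and> Y \<noteq> U \<and> Y \<noteq> W \<and> col U V T \<and> T \<noteq> U \<and> T \<noteq> V"

lemma tri_rotate: "tri U V W X Y T \<Longrightarrow> tri V W U Y T X"
  by (auto simp: tri_def col_ac)

lemma tri_swap: "tri U V W X Y T \<Longrightarrow> tri V U W Y X T"
  by (auto simp: tri_def col_ac)

lemma tri_distinct:
  assumes "tri U V W X Y T"
  shows "distinct [U, V, W, X, Y, T]"
proof -
  \<comment> \<open>One inequality from each of three orbits under rotation; the others are part of
    \<open>tri\<close>.\<close>
  have *: "U \<noteq> V \<and> U \<noteq> X \<and> X \<noteq> Y" if t: "tri U V W X Y T" for U V W X Y T :: "'a proj_plane"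
  proof (intro conjI notI)
    assume "U = V"
    then show False using t col_same unfolding tri_def by blast
  next
    assume "U = X"
    then show False using t by (auto simp: tri_def col_ac)
  next
    assume "X = Y"
    then have "col W X V" "col W X U" "W \<noteq> X"
      using t by (auto simp: tri_def col_ac)
    then have "col W V U"
      using col_trans by blast
    then show False using t by (simp add: tri_def col_ac)
  qed
  show ?thesis
    using *[OF assms] *[OF tri_rotate[OF assms]] *[OF tri_rotate[OF tri_rotate[OF assms]]] assms
    unfolding tri_def by auto
qed

lemma tri_noncol:
  assumes "tri U V W X Y T"
  shows "\<not> col U V W" "\<not> col U V X" "\<not> col U V Y" "\<not> col U W V" "\<not> col U W X" "\<not> col U W T"
    "\<not> col V W U" "\<not> col V W Y" "\<not> col V W T"
    "\<not> col X Y U" "\<not> col X Y V" "\<not> col X Y W" "\<not> col X T U" "\<not> col X T V" "\<not> col X T W"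
    "\<not> col Y T U" "\<not> col Y T V" "\<not> col Y T W"
proof -
  \<comment> \<open>Representatives only: the six relabellings by rotation and swap carry them to
    the listed triples.\<close>
  have *: "\<not> col U V X \<and> \<not> col X Y U \<and> \<not> col X Y W"
    if t: "tri U V W X Y T" for U V W X Y T :: "'a proj_plane"
  proof (intro conjI notI)
    have W: "\<not> col U V W" and X: "col V X W" "col W X V" "V \<noteq> X" "W \<noteq> X"
      and Y: "col U Y W" "col W Y U" "U \<noteq> Y" "W \<noteq> Y"
      using t by (auto simp: tri_def col_ac)
    {
      assume "col U V X"
      then have "col V X U" by (simp add: col_ac)
      with X have "col V W U" using col_trans by blast
      then show False using W by (simp add: col_ac)
    next
      assume "col X Y U"
      then have "col U Y X" by (simp add: col_ac)
      with Y have "col U W X" using col_trans by blast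
      then have "col W X U" by (simp add: col_ac)
      with X have "col W V U" using col_trans by blast
      then show False using W by (simp add: col_ac)
    next
      assume "col X Y W"
      then have "col W X Y" by (simp add: col_ac)
      with X have "col W V Y" using col_trans by blast
      then have "col W Y V" by (simp add: col_ac)
      with Y have "col W V U" using col_trans by blast
      then show False using W by (simp add: col_ac)
    }
  qed
  note t = assms tri_rotate[OF assms] tri_rotate[OF tri_rotate[OF assms]]
  note s = t[THEN tri_swap]
  note all = t[THEN *] s[THEN *]
  show "\<not> col U V W" "\<not> col U W V" "\<not> col V W U"
    using assms by (auto simp: tri_def col_ac)
  show "\<not> col U V X" "\<not> col U V Y" "\<not> col U W X" "\<not> col U W T" "\<not> col V W Y" "\<not> col V W T"
    "\<not> col X Y U" "\<not> col X Y V" "\<not> col X Y W" "\<not> col X T U" "\<not> col X T V" "\<not> col X T W"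
    "\<not> col Y T U" "\<not> col Y T V" "\<not> col Y T W"
    using all by (simp_all add: col_ac)
qed

lemma sum_lessThan_numeral:
  fixes f :: "nat \<Rightarrow> nat"
  shows "(\<Sum>i<4. f i) = f 0 + f 1 + f 2 + f 3"
    and "(\<Sum>i<6. f i) = f 0 + f 1 + f 2 + f 3 + f 4 + f 5"
  by (simp_all add: eval_nat_numeral)

text \<open>Each of the four lines carries three of the six points, and each point lies on two
  lines. With p the sum of the exponents split off and s the sum of the residual multiplicities,
  Bezout on the four lines gives 2 s \<le> 4 dg, while 6 m \<le> s + 3 p. Hence 6 m \<le> 2 dg + 3 p
  \<le> 3 d.\<close>

lemma star_degree_bound:
  fixes U V W X Y T :: "'k::field_char_0 proj_plane"
  assumes t: "tri U V W X Y T" and c: "col X Y T" and f: "form d f" "f u \<noteq> 0"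
    and v: "\<And>R. R \<in> {U, V, W, X, Y, T} \<Longrightarrow> vord f (rep R) m"
  shows "2 * m \<le> d"
proof -
  define A where "A i = [U, U, V, X] ! i" for i
  define B where "B i = [V, W, W, Y] ! i" for i
  have AB: "A i \<noteq> B i" if "i \<in> {..<4}" for i
    using tri_distinct[OF t] that by (auto simp: A_def B_def less_Suc_eq numeral_eq_Suc)
  obtain a g dg where g: "form dg g" "g u \<noteq> 0" and d: "d = (\<Sum>i<4. a i) + dg"
    and n: "\<And>i. i \<in> {..<4} \<Longrightarrow> \<not> pdvd (line_form (A i) (B i)) g"
    and gv: "\<And>R m. vord f (rep R) m \<Longrightarrow>
      vord g (rep R) (m - (\<Sum>i<4. a i * of_bool (col (A i) (B i) R)))"
    using strip_lines[of "{..<4::nat}" d f u A B, OF finite_lessThan f AB] by blast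
  define mu where "mu R = m - (\<Sum>i<4. a i * of_bool (col (A i) (B i) R))" for R
  have mv: "vord g (rep R) (mu R)" if "R \<in> {U, V, W, X, Y, T}" for R
    unfolding mu_def using gv v that by blast
  note tt = t[unfolded tri_def]
  have c': "col X T Y = col X Y T" "col Y T X = col X Y T"
    by (simp_all add: col_ac)
  have nn: "\<not> pdvd (line_form U V) g" "\<not> pdvd (line_form U W) g" "\<not> pdvd (line_form V W) g" "\<not> pdvd (line_form X Y) g"
    using n[of 0] n[of 1] n[of 2] n[of 3] by (simp_all add: A_def B_def)
  have lines: "mu U + mu V + mu T \<le> dg" "mu U + mu W + mu Y \<le> dg" "mu V + mu W + mu X \<le> dg"
    "mu X + mu Y + mu T \<le> dg"
    using tri_distinct[OF t] tri_distinct[OF t, THEN distinct_rev[THEN iffD2]] tt c nn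
    by (simp_all add: pdvd_ln3[OF g(1) _ _ _ _ mv mv mv])
  have mus: "mu U = m - (a 0 + a 1)" "mu V = m - (a 0 + a 2)" "mu W = m - (a 1 + a 2)"
    "mu X = m - (a 2 + a 3)" "mu Y = m - (a 1 + a 3)" "mu T = m - (a 0 + a 3)"
    using tri_noncol[OF t] tt c c'
    by (simp_all add: mu_def A_def B_def sum_lessThan_numeral col_refl)
  \<comment> \<open>Truncated subtraction is turned into inequalities that stay valid when
    \<open>m\<close> is the smaller number.\<close>
  have le: "m \<le> mu U + (a 0 + a 1)" "m \<le> mu V + (a 0 + a 2)" "m \<le> mu W + (a 1 + a 2)"
    "m \<le> mu X + (a 2 + a 3)" "m \<le> mu Y + (a 1 + a 3)" "m \<le> mu T + (a 0 + a 3)"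
    using mus by linarith+
  define p s where "p = a 0 + a 1 + a 2 + a 3" and "s = mu U + mu V + mu W + mu X + mu Y + mu T"
  have "6 * m \<le> s + 3 * p" "2 * s \<le> 4 * dg"
    unfolding p_def s_def using le lines by simp_all
  moreover have "d = p + dg"
    by (simp add: d sum_lessThan_numeral p_def)
  ultimately show ?thesis by linarith
qed

text \<open>The three lower bounds already add up to twice the prescribed total, so each of them is
  an equality.\<close>

lemma three_sums:
  fixes x y z m :: nat
  assumes "m \<le> x + y" "m \<le> x + z" "m \<le> y + z" and "2 * (x + y + z) = 3 * m"
  shows "2 * x = m" "2 * y = m" "2 * z = m"
proof -
  have "x + y \<le> m" "x + z \<le> m" "y + z \<le> m"
    using add_mono[OF assms(2,3)] add_mono[OF assms(1,3)] add_mono[OF assms(1,2)] assms(4)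
    by (simp_all add: distrib_left)
  then have "x + y = m" "x + z = m" "y + z = m"
    using assms(1-3) by simp_all
  then show "2 * x = m" "2 * y = m" "2 * z = m"
    using assms(4) by simp_all
qed

lemma quasi_star_degree_bound:
  fixes U V W X Y T :: "'k::field_char_0 proj_plane"
  assumes t: "tri U V W X Y T" and c: "\<not> col X Y T" and f: "form d f" "f u \<noteq> 0"
    and v: "\<And>R. R \<in> {U, V, W, X, Y, T} \<Longrightarrow> vord f (rep R) m"
  shows "9 * m \<le> 4 * d"
    and "4 * d = 9 * m \<Longrightarrow> 0 < m \<Longrightarrow> vord f (rep Q) m \<Longrightarrow> Q \<in> {U, V, W, X, Y, T}"
proof -
  \<comment> \<open>The exponents \<open>a 0\<close>, \<open>a 1\<close>, \<open>a 2\<close> belong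
    to the sides, \<open>a 3\<close>, \<open>a 4\<close>, \<open>a 5\<close> to the lines joining X,
    Y, T.\<close>
  define A where "A i = [U, U, V, X, X, Y] ! i" for i
  define B where "B i = [V, W, W, Y, T, T] ! i" for i
  have AB: "A i \<noteq> B i" if "i \<in> {..<6}" for i
    using tri_distinct[OF t] that by (auto simp: A_def B_def less_Suc_eq numeral_eq_Suc)
  obtain a g dg where g: "form dg g" "g u \<noteq> 0" and d: "d = (\<Sum>i<6. a i) + dg"
    and n: "\<And>i. i \<in> {..<6} \<Longrightarrow> \<not> pdvd (line_form (A i) (B i)) g"
    and gv: "\<And>R m. vord f (rep R) m \<Longrightarrow>
      vord g (rep R) (m - (\<Sum>i<6. a i * of_bool (col (A i) (B i) R)))"
    using strip_lines[of "{..<6::nat}" d f u A B, OF finite_lessThan f AB] by blast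
  define mu where "mu R = m - (\<Sum>i<6. a i * of_bool (col (A i) (B i) R))" for R
  have mv: "vord g (rep R) (mu R)" if "R \<in> {U, V, W, X, Y, T}" for R
    unfolding mu_def using gv v that by blast
  note tt = t[unfolded tri_def]
  have c': "col X T Y = col X Y T" "col Y T X = col X Y T"
    by (simp_all add: col_ac)
  have nn: "\<not> pdvd (line_form U V) g" "\<not> pdvd (line_form U W) g" "\<not> pdvd (line_form V W) g"
    "\<not> pdvd (line_form X Y) g" "\<not> pdvd (line_form X T) g" "\<not> pdvd (line_form Y T) g"
    using n[of 0] n[of 1] n[of 2] n[of 3] n[of 4] n[of 5] by (simp_all add: A_def B_def)
  have lines: "mu U + mu V + mu T \<le> dg" "mu U + mu W + mu Y \<le> dg" "mu V + mu W + mu X \<le> dg"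
    using tri_distinct[OF t] tt nn by (simp_all add: pdvd_ln3[OF g(1) _ _ _ _ mv mv mv])
  have lines': "mu X + mu Y \<le> dg" "mu X + mu T \<le> dg" "mu Y + mu T \<le> dg"
    using tri_distinct[OF t] nn by (simp_all add: pdvd_ln2[OF g(1) _ mv mv])
  have mus: "mu U = m - (a 0 + a 1)" "mu V = m - (a 0 + a 2)" "mu W = m - (a 1 + a 2)"
    "mu X = m - (a 2 + a 3 + a 4)" "mu Y = m - (a 1 + a 3 + a 5)" "mu T = m - (a 0 + a 4 + a 5)"
    using tri_noncol[OF t] tt c c'
    by (simp_all add: mu_def A_def B_def sum_lessThan_numeral col_refl)
  have da: "d = a 0 + a 1 + a 2 + a 3 + a 4 + a 5 + dg"
    by (simp add: d sum_lessThan_numeral)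
  have le: "m \<le> mu U + a 0 + a 1" "m \<le> mu V + a 0 + a 2" "m \<le> mu W + a 1 + a 2"
    "m \<le> mu X + a 2 + a 3 + a 4" "m \<le> mu Y + a 1 + a 3 + a 5" "m \<le> mu T + a 0 + a 4 + a 5"
    using mus by linarith+
  define p q s1 s2 where "p = a 0 + a 1 + a 2" and "q = a 3 + a 4 + a 5"
    and "s1 = mu U + mu V + mu W" and "s2 = mu X + mu Y + mu T"
  \<comment> \<open>The first plus twice the second gives 9 m \<le> s1 + 2 s2 + 4 (p + q); half the
    third plus three quarters of the fourth gives s1 + 2 s2 \<le> 15/4 dg. So 9 m is at most 4 d -
    dg/4.\<close>
  have sums: "3 * m \<le> s1 + 2 * p" "3 * m \<le> s2 + p + 2 * q" "2 * s1 + s2 \<le> 3 * dg" "2 * s2 \<le> 3 * dg"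
    unfolding p_def q_def s1_def s2_def using le lines lines' by simp_all
  have dpq: "d = p + q + dg"
    by (simp add: da p_def q_def)
  show "9 * m \<le> 4 * d"
    using sums dpq by linarith
  assume eq: "4 * d = 9 * m" and m: "0 < m" and Q: "vord f (rep Q) m"
  \<comment> \<open>The slack dg/4 leaves no room for a residual form of positive degree.\<close>
  have "dg = 0"
    using sums dpq eq by linarith
  then have muz: "mu U = 0" "mu V = 0" "mu W = 0" "mu X = 0" "mu Y = 0" "mu T = 0"
    using lines lines' by simp_all
  \<comment> \<open>With residual degree 0, the bounds 3 m \<le> 2 p and 3 m \<le> p + 2 q against p
    + q = 9/4 m leave only these values.\<close>
  have pq: "2 * p = 3 * m" "4 * q = 3 * m"
    using sums dpq eq \<open>dg = 0\<close> by linarith+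
  have le0: "m \<le> a 0 + a 1" "m \<le> a 0 + a 2" "m \<le> a 1 + a 2"
    "m \<le> a 2 + a 3 + a 4" "m \<le> a 1 + a 3 + a 5" "m \<le> a 0 + a 4 + a 5"
    using le unfolding muz by simp_all
  have a012: "2 * a 0 = m" "2 * a 1 = m" "2 * a 2 = m"
    using three_sums[OF le0(1-3)] pq(1) unfolding p_def by blast+
  have "m \<le> 2 * a 3 + 2 * a 4" "m \<le> 2 * a 3 + 2 * a 5" "m \<le> 2 * a 4 + 2 * a 5"
    using le0(4-6) a012 by simp_all
  from three_sums[OF this] have a345: "4 * a 3 = m" "4 * a 4 = m" "4 * a 5 = m"
    using pq(2) unfolding q_def by simp_all
  show "Q \<in> {U, V, W, X, Y, T}"
  proof (rule ccontr)
    assume Q': "Q \<notin> {U, V, W, X, Y, T}"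
    have "m - (\<Sum>i<6. a i * of_bool (col (A i) (B i) Q)) \<le> dg"
      using vord_le_degree[OF g] gv[OF Q] by blast
    then have mle: "m \<le> (a 0 * of_bool (col U V Q) + a 1 * of_bool (col U W Q) + a 2 * of_bool (col V W Q))
      + (a 3 * of_bool (col X Y Q) + a 4 * of_bool (col X T Q) + a 5 * of_bool (col Y T Q))"
      using \<open>dg = 0\<close> by (simp add: A_def B_def sum_lessThan_numeral add.assoc)
    \<comment> \<open>Two sides meet only at a vertex, and two of the lines joining X, Y, T only at
      one of these points. So Q lies on at most one line of each kind, with exponents m/2 and m/4,
      too little for order m.\<close>
    have two: "\<not> (col P R Q \<and> col P S Q)" if "\<not> col P R S" "Q \<noteq> P" for P R S
    proof
      assume "col P R Q \<and> col P S Q"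
      then have "col P Q R" "col P Q S" by (auto simp: col_ac)
      then show False using col_trans that by metis
    qed
    have "\<not> (col U V Q \<and> col U W Q)" "\<not> (col V U Q \<and> col V W Q)" "\<not> (col W U Q \<and> col W V Q)"
      using tri_noncol(1,4,7)[OF t] Q' by (intro two; simp add: col_ac)+
    then have "a 0 * of_bool (col U V Q) + a 1 * of_bool (col U W Q) + a 2 * of_bool (col V W Q) \<le> a 0"
      using a012 by (auto simp: col_ac)
    moreover have "\<not> (col X Y Q \<and> col X T Q)" "\<not> (col Y X Q \<and> col Y T Q)" "\<not> (col T X Q \<and> col T Y Q)"
      using c Q' by (intro two; simp add: col_ac)+
    then have "a 3 * of_bool (col X Y Q) + a 4 * of_bool (col X T Q) + a 5 * of_bool (col Y T Q) \<le> a 3"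
      using a345 by (auto simp: col_ac)
    ultimately have "m \<le> a 0 + a 3"
      by (rule order.trans[OF mle add_mono])
    then show False
      using m a012(1) a345(1) by linarith
  qed
qed

section \<open>Five points in general position and a sixth point off their conic\<close>

definition cpt :: "'k::comm_ring_1 \<Rightarrow> 'k ^ 3"
  where "cpt t = vector [1, t, t ^ 2]"

definition cinf :: "'k::comm_ring_1 ^ 3"
  where "cinf = vector [0, 0, 1]"

lemma cpt_eq_iff: "cpt s = cpt t \<longleftrightarrow> s = t"
  by (auto simp: cpt_def vec_eq_iff forall_3)

lemma cpt_neq_cinf: "cpt s \<noteq> cinf"
  by (auto simp: cpt_def cinf_def vec_eq_iff forall_3)

lemma conic_cpt: "conic (cpt t) = 0" "conic cinf = 0"
  by (simp_all add: cpt_def cinf_def conic_def)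

text \<open>Vandermonde determinants; with the point at infinity they reduce to a difference of
  parameters.\<close>

lemma det3_conic_points:
  fixes S :: "'k::field set"
  assumes "X \<in> insert cinf (cpt ` S)" "Y \<in> insert cinf (cpt ` S)" "Z \<in> insert cinf (cpt ` S)"
    and "X \<noteq> Y" "Y \<noteq> Z" "X \<noteq> Z"
  shows "det3 X Y Z \<noteq> 0"
proof -
  have "det3 (cpt a) (cpt b) (cpt c) = (b - a) * (c - a) * (c - b)" for a b c :: 'k
    by (simp add: cpt_def det3_def algebra_simps power2_eq_square)
  moreover have "det3 (cpt a) (cpt b) cinf = b - a" "det3 cinf (cpt a) (cpt b) = b - a"
    "det3 (cpt a) cinf (cpt b) = a - b" for a b :: 'k
    by (simp_all add: cpt_def cinf_def det3_def algebra_simps)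
  ultimately show ?thesis
    using assms by (auto simp: cpt_eq_iff)
qed

text \<open>A symmetric relation with at most one partner for each element is a partial matching,
  and five is odd: two matched pairs leave a fifth element, whose partner would be matched
  twice.\<close>

lemma unmatched_of_five:
  assumes "finite S" "card S = 5" and sym: "\<And>x y. r x y \<Longrightarrow> r y x"
    and func: "\<And>x y z. x \<in> S \<Longrightarrow> y \<in> S \<Longrightarrow> z \<in> S \<Longrightarrow> x \<noteq> y \<Longrightarrow> x \<noteq> z \<Longrightarrow> r x y \<Longrightarrow> r x z \<Longrightarrow> y = z"
  shows "\<exists>x\<in>S. \<forall>y\<in>S - {x}. \<not> r x y"
proof (rule ccontr)
  assume "\<not> ?thesis"
  then have p: "\<exists>y\<in>T. y \<noteq> x \<and> r x y" if "x \<in> S" "T = S" for x T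
    using that by blast
  obtain x where x: "x \<in> S" using assms by (metis card.empty ex_in_conv zero_neq_numeral)
  obtain y where y: "y \<in> S" "y \<noteq> x" "r x y" using p[OF x refl] by blast
  have "card (S - {x, y}) = 3" using assms x y by (simp add: card_Diff_subset)
  then obtain z where z: "z \<in> S - {x, y}" by (metis card.empty ex_in_conv zero_neq_numeral)
  obtain w where w: "w \<in> S" "w \<noteq> z" "r z w" using p[of z] z by blast
  have wxy: "w \<notin> {x, y}"
    using func[of x z y] func[of y z x] sym w x y z by blast
  have "x \<noteq> y" "x \<noteq> z" "y \<noteq> z" "x \<noteq> w" "y \<noteq> w" "z \<noteq> w"
    using wxy z w y by auto
  then have "card {x, y, z, w} = 4" by simp
  moreover have "{x, y, z, w} \<subseteq> S" using x y z w by blast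
  ultimately have "card (S - {x, y, z, w}) = 1"
    using assms(1,2) by (simp only: card_Diff_subset[OF finite_subset])
  then obtain v where v: "v \<in> S - {x, y, z, w}" by (metis card.empty ex_in_conv zero_neq_one)
  obtain t where t: "t \<in> S" "t \<noteq> v" "r v t" using p[of v] v by blast
  have "t \<in> {x, y, z, w}"
  proof (rule ccontr)
    assume "t \<notin> {x, y, z, w}"
    then have "{v, t} \<subseteq> S - {x, y, z, w}" using t v by blast
    then have "card {v, t} \<le> 1"
      using \<open>card (S - {x, y, z, w}) = 1\<close> card_mono[of "S - {x, y, z, w}" "{v, t}"] assms(1) by simp
    then show False using t by simp
  qed
  then show False
    using func[of x v y] func[of y v x] func[of z v w] func[of w v z] sym t v w x y z wxy by blast
qed

lemma seven_thirds_std: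
  fixes f :: "'k::{alg_closed_field, field_char_0} ^ 3 \<Rightarrow> 'k"
  assumes S: "finite S" "card S = 4" and f: "form d f" "f u \<noteq> 0"
    and P: "conic P \<noteq> 0" "vord f P m"
    and v: "\<And>X. X \<in> insert cinf (cpt ` S) \<Longrightarrow> vord f X m"
  shows "7 * m \<le> 3 * d"
proof -
  define pts where "pts = insert cinf (cpt ` S)"
  have cpts: "finite pts" "card pts = 5"
  proof -
    have "card (cpt ` S) = 4" "cinf \<notin> cpt ` S"
      using S cpt_neq_cinf by (auto simp: card_image inj_on_def cpt_eq_iff image_iff dest: sym)
    then show "finite pts" "card pts = 5"
      using S by (simp_all add: pts_def)
  qed
  have pts0: "X \<noteq> 0" "conic X = 0" if "X \<in> pts" for X
  proof -
    show "X \<noteq> 0"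
      using that by (auto simp: pts_def vec_eq_iff forall_3 cpt_def cinf_def)
    show "conic X = 0"
      using that by (auto simp: pts_def conic_cpt)
  qed
  \<comment> \<open>Two points are related when their line passes through P. As P is off the conic
    and no line contains three points of \<open>pts\<close>, a point has at most one partner; an
    unmatched point is the wanted E.\<close>
  have "\<exists>E\<in>pts. \<forall>X\<in>pts - {E}. \<not> det3 E P X = 0"
  proof (rule unmatched_of_five[OF cpts])
    show "det3 y P x = 0" if "det3 x P y = 0" for x y
      using that det3_rotate[of P y x] det3_swap[of P y x] by simp
    fix x y z assume xyz: "x \<in> pts" "y \<in> pts" "z \<in> pts" "x \<noteq> y" "x \<noteq> z"
      and 0: "det3 x P y = 0" "det3 x P z = 0"
    have "P \<noteq> c *s x" for c
      using P(1) pts0(2)[OF xyz(1)] form_conic unfolding form_def by (metis mult_zero_right)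
    then obtain w where w: "det3 P x w \<noteq> 0"
      using ex_det3_nonzero[OF pts0(1)[OF xyz(1)]] by metis
    obtain s t where y: "y = s *s P + t *s x"
      using det3_eq_0_span[OF w, of y] 0(1) det3_swap[of x P y] by auto
    obtain s' t' where z: "z = s' *s P + t' *s x"
      using det3_eq_0_span[OF w, of z] 0(2) det3_swap[of x P z] by auto
    have "det3 x y z = 0"
      by (simp add: y z det3_def algebra_simps)
    then show "y = z"
      using det3_conic_points[of x S y z] xyz unfolding pts_def by blast
  qed
  then obtain E where E: "E \<in> pts" and EP: "\<And>X. X \<in> pts - {E} \<Longrightarrow> det3 E P X \<noteq> 0"
    by blast
  have "pts - {E} \<noteq> {}"
    using cpts E card_Diff_singleton[of E pts] by force
  then obtain w where w: "det3 E P w \<noteq> 0" using EP by blast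
  \<comment> \<open>\<open>True\<close> stands for the conic, \<open>False\<close> for the line
    through E and P.\<close>
  define l where "l b = (if b then conic else det3 E P)" for b
  define e where "e b = (if b then 2 else 1 :: nat)" for b
  obtain a g dg where g: "form dg g" "g u \<noteq> 0" and d: "d = (\<Sum>b\<in>UNIV. a b * e b) + dg"
    and n: "\<And>b. b \<in> UNIV \<Longrightarrow> \<not> pdvd (l b) g"
    and gv: "\<And>p k m. (\<And>b. b \<in> UNIV \<Longrightarrow> \<not> vord (l b) p (Suc (k b))) \<Longrightarrow> vord f p m \<Longrightarrow>
      vord g p (m - (\<Sum>b\<in>UNIV. a b * k b))"
  proof (rule strip_components_vord[of "UNIV :: bool set" d f u e l])
    show "form (e b) (l b)" "0 < e b" for b
      by (simp_all add: e_def l_def form_conic form_det3[simplified])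
  qed (use f in auto)
  have d': "d = 2 * a True + a False + dg"
    by (simp add: d e_def UNIV_bool)
  have n': "\<not> pdvd conic g" "\<not> pdvd (det3 E P) g"
    using n[of True] n[of False] by (simp_all add: l_def)
  have gv': "vord g p (m - (a True * i + a False * j))"
    if "\<not> vord conic p (Suc i)" "\<not> vord (det3 E P) p (Suc j)" "vord f p m" for p i j
  proof -
    have "vord g p (m - (\<Sum>b\<in>UNIV. a b * (if b then i else j)))"
      by (rule gv) (use that in \<open>auto simp: l_def\<close>)
    then show ?thesis by (simp add: UNIV_bool add.commute)
  qed
  have gP: "vord g P (m - a False)"
    using gv'[OF not_vord_1[OF form_polyfun[OF form_conic] P(1)] not_vord_det3[OF w] P(2)] by simp
  have gE: "vord g E (m - (a True + a False))"
    using gv'[OF not_vord_conic[OF pts0(1)[OF E]] not_vord_det3[OF w] v] E by (simp add: pts_def)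
  have gX: "vord g X (m - a True)" if X: "X \<in> pts - {E}" for X
    using gv'[OF not_vord_conic[OF pts0(1)] not_vord_1[OF form_polyfun[OF form_det3] EP[OF X]] v] X
    by (simp add: pts_def)
  define M where "M X = (if X = E then m - (a True + a False) else m - a True)" for X
  have gM: "vord g X (M X)" if "X \<in> pts" for X
    using that gX gE by (auto simp: M_def)
  obtain t0 where "g (vector [1, t0, t0 ^ 2]) \<noteq> 0"
    using pdvd_conic[OF g(1)] n' by blast
  then have "(\<Sum>a\<in>S. M (cpt a)) + M cinf \<le> 2 * dg"
    by (rule conic_bezout[OF g(1)]) (use S gM in \<open>auto simp: pts_def cpt_def cinf_def\<close>)
  also have "(\<Sum>a\<in>S. M (cpt a)) + M cinf = (\<Sum>X\<in>pts. M X)"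
  proof -
    have "cinf \<notin> cpt ` S"
      using cpt_neq_cinf by (auto dest: sym)
    then show ?thesis
      using S by (simp add: pts_def sum.reindex inj_on_def cpt_eq_iff)
  qed
  also have "\<dots> = M E + (\<Sum>X\<in>pts - {E}. M X)"
    using cpts E by (simp add: sum.remove)
  also have "(\<Sum>X\<in>pts - {E}. M X) = 4 * (m - a True)"
    using cpts E by (simp add: M_def)
  finally have 1: "M E + 4 * (m - a True) \<le> 2 * dg" .
  have 2: "M E + (m - a False) \<le> dg"
  proof (rule ccontr)
    assume "\<not> ?thesis"
    then show False
      using pdvd_line3[OF g(1) w, of "E + P" 1 1 "M E" "m - a False" 0] gM[OF E] gP n'(2)
      by (simp add: vord_0)
  qed
  \<comment> \<open>With x, y the exponents of conic and line, the sum of the inequalities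
    \<open>1\<close> and \<open>2\<close> gives 7 m - 6 x - 3 y \<le> 3 dg, and d = 2 x + y +
    dg.\<close>
  have "m \<le> M E + a True + a False"
    by (simp add: M_def)
  then show ?thesis
    using 1 2 d' by linarith
qed

text \<open>A + t T + t^2 C parametrizes the conic through the five points, with a, b, c at the
  parameters 0, 1 and infinity. In coordinates with respect to a, b, c, a conic through these three
  points is \<alpha> x2 x3 + \<beta> x1 x3 + \<gamma> x1 x2 = 0.\<close>

lemma conic_frame:
  fixes a b c d e :: "'k::field ^ 3"
  assumes nz: "det3 a b c \<noteq> 0" "det3 d b c \<noteq> 0" "det3 a d c \<noteq> 0" "det3 a b d \<noteq> 0"
    "det3 e b c \<noteq> 0" "det3 a e c \<noteq> 0" "det3 a b e \<noteq> 0"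
    "det3 a d e \<noteq> 0" "det3 b d e \<noteq> 0" "det3 c d e \<noteq> 0"
  obtains A T C \<delta> \<epsilon> s1 s2 s3 s4 s5 where "det3 A T C \<noteq> 0"
    "A = s1 *s a" "A + T + C = s2 *s b" "C = s3 *s c"
    "A + \<delta> *s T + \<delta>\<^sup>2 *s C = s4 *s d" "A + \<epsilon> *s T + \<epsilon>\<^sup>2 *s C = s5 *s e"
    "s1 \<noteq> 0" "s2 \<noteq> 0" "s3 \<noteq> 0" "s4 \<noteq> 0" "s5 \<noteq> 0" "distinct [0, 1, \<delta>, \<epsilon>]"
proof -
  define D where "D = det3 a b c"
  define d1 d2 d3 where "d1 = det3 d b c / D" and "d2 = det3 a d c / D" and "d3 = det3 a b d / D"
  define e1 e2 e3 where "e1 = det3 e b c / D" and "e2 = det3 a e c / D" and "e3 = det3 a b e / D"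
  have D0: "D \<noteq> 0" using nz by (simp add: D_def)
  have dc: "d = d1 *s a + d2 *s b + d3 *s c" and ec: "e = e1 *s a + e2 *s b + e3 *s c"
  proof -
    have "x = (det3 x b c / D) *s a + (det3 a x c / D) *s b + (det3 a b x / D) *s c" for x
    proof -
      have "inverse D *s (D *s x) = inverse D *s (det3 x b c *s a + det3 a x c *s b + det3 a b x *s c)"
        using det3_cramer[of a b c x] by (simp add: D_def)
      then show ?thesis
        using D0 by (simp add: vector_smult_assoc vector_add_ldistrib divide_inverse mult.commute)
    qed
    then show "d = d1 *s a + d2 *s b + d3 *s c" "e = e1 *s a + e2 *s b + e3 *s c"
      by (simp_all only: d1_def d2_def d3_def e1_def e2_def e3_def)
  qed
  have nz': "d1 \<noteq> 0" "d2 \<noteq> 0" "d3 \<noteq> 0" "e1 \<noteq> 0" "e2 \<noteq> 0" "e3 \<noteq> 0"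
    using nz D0 by (simp_all add: d1_def d2_def d3_def e1_def e2_def e3_def)
  have "det3 a d e = D * (d2 * e3 - d3 * e2)" "det3 b d e = D * (d3 * e1 - d1 * e3)"
    "det3 c d e = D * (d1 * e2 - d2 * e1)"
    by (simp_all add: dc ec D_def) (simp_all add: det3_def algebra_simps)
  then have minors: "d3 * e2 - d2 * e3 \<noteq> 0" "d1 * e3 - d3 * e1 \<noteq> 0" "d2 * e1 - d1 * e2 \<noteq> 0"
    using nz by auto
  \<comment> \<open>The cross product of (d2 d3, d1 d3, d1 d2) and (e2 e3, e1 e3, e1 e2), so that
    the conic passes through d and e. The factored shape shows that no coefficient vanishes.\<close>
  define \<alpha> \<beta> \<gamma> where "\<alpha> = d1 * e1 * (d3 * e2 - d2 * e3)" and "\<beta> = d2 * e2 * (d1 * e3 - d3 * e1)"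
    and "\<gamma> = d3 * e3 * (d2 * e1 - d1 * e2)"
  have abc: "\<alpha> \<noteq> 0" "\<beta> \<noteq> 0" "\<gamma> \<noteq> 0"
    using nz' minors by (simp_all add: \<alpha>_def \<beta>_def \<gamma>_def)
  define A T C where "A = \<alpha> *s a" and "T = \<beta> *s b - \<alpha> *s a - \<gamma> *s c" and "C = \<gamma> *s c"
  have on: "\<exists>\<delta> s. A + \<delta> *s T + \<delta>\<^sup>2 *s C = s *s x \<and> s \<noteq> 0 \<and> \<delta> \<noteq> 0 \<and> \<delta> \<noteq> 1"
    if x: "x = x1 *s a + x2 *s b + x3 *s c" and x0: "x1 \<noteq> 0" "x2 \<noteq> 0" "x3 \<noteq> 0"
      and eq: "\<alpha> * (x2 * x3) + \<beta> * (x1 * x3) + \<gamma> * (x1 * x2) = 0" for x x1 x2 x3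
  proof -
    define p q r where "p = x1 / \<alpha>" and "q = x2 / \<beta>" and "r = x3 / \<gamma>"
    have pqr: "p \<noteq> 0" "q \<noteq> 0" "r \<noteq> 0" "x1 = p * \<alpha>" "x2 = q * \<beta>" "x3 = r * \<gamma>"
      using x0 abc by (simp_all add: p_def q_def r_def)
    have "\<alpha> * \<beta> * \<gamma> * (q * r + p * r + p * q) = 0"
      using eq unfolding pqr(4-6) by (simp add: algebra_simps)
    then have "q * r + p * r + p * q = 0"
      using abc by simp
    then have q2: "(p + q) * (q + r) = q\<^sup>2"
      by (simp add: algebra_simps power2_eq_square)
    then have pq: "p + q \<noteq> 0"
      using pqr(2) by auto
    \<comment> \<open>On the parametrized conic p : q = 1 - \<delta> : \<delta>, which determines
      the parameter.\<close>
    define \<delta> where "\<delta> = q / (p + q)"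
    have d2: "\<delta>\<^sup>2 = (q + r) / (p + q)"
      unfolding \<delta>_def power_divide q2[symmetric] by (simp add: power2_eq_square pq)
    have "A + \<delta> *s T + \<delta>\<^sup>2 *s C = (1 / (p + q)) *s x"
    proof -
      have "(p + q) * \<delta> = q" "(p + q) * \<delta>\<^sup>2 = q + r"
        unfolding d2 using pq by (simp_all add: \<delta>_def)
      then have "(p + q) *s (A + \<delta> *s T + \<delta>\<^sup>2 *s C) = (p + q) *s A + q *s T + (q + r) *s C"
        by (simp add: vector_add_ldistrib vector_smult_assoc)
      also have "\<dots> = x"
        by (simp add: vec_eq_iff A_def T_def C_def x pqr(4-6) algebra_simps)
      finally have "(1 / (p + q)) *s ((p + q) *s (A + \<delta> *s T + \<delta>\<^sup>2 *s C)) = (1 / (p + q)) *s x"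
        by simp
      then show ?thesis
        using pq by (simp only: vector_smult_assoc) simp
    qed
    moreover have "\<delta> \<noteq> 0" "\<delta> \<noteq> 1"
      using pq pqr by (auto simp: \<delta>_def divide_eq_1_iff)
    ultimately show ?thesis
      using pq by (intro exI[of _ \<delta>] exI[of _ "1 / (p + q)"]) simp
  qed
  obtain \<delta> s4 where \<delta>: "A + \<delta> *s T + \<delta>\<^sup>2 *s C = s4 *s d" "s4 \<noteq> 0" "\<delta> \<noteq> 0" "\<delta> \<noteq> 1"
    using on[OF dc nz'(1-3)] by (auto simp: \<alpha>_def \<beta>_def \<gamma>_def algebra_simps)
  obtain \<epsilon> s5 where \<epsilon>: "A + \<epsilon> *s T + \<epsilon>\<^sup>2 *s C = s5 *s e" "s5 \<noteq> 0" "\<epsilon> \<noteq> 0" "\<epsilon> \<noteq> 1"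
    using on[OF ec nz'(4-6)] by (auto simp: \<alpha>_def \<beta>_def \<gamma>_def algebra_simps)
  have "\<delta> \<noteq> \<epsilon>"
  proof
    assume "\<delta> = \<epsilon>"
    then have eq: "s4 *s d = s5 *s e"
      using \<delta>(1) \<epsilon>(1) by simp
    have "s4 * det3 a d e = det3 a (s4 *s d) e"
      by (simp add: det3_def algebra_simps)
    also have "\<dots> = s5 * det3 a e e"
      unfolding eq by (simp add: det3_def algebra_simps)
    finally have "s4 * det3 a d e = s5 * det3 a e e" .
    then show False
      using \<delta>(2) nz(8) by (simp add: det3_def[of a e e] algebra_simps)
  qed
  have "det3 A T C = \<alpha> * \<beta> * \<gamma> * D"
    by (simp add: A_def T_def C_def D_def det3_def algebra_simps)
  then have "det3 A T C \<noteq> 0"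
    using abc D0 by simp
  moreover have "A + T + C = \<beta> *s b"
    by (simp add: A_def T_def C_def)
  ultimately show thesis
    using that[of A T C \<alpha> \<beta> \<gamma> \<delta> s4 \<epsilon> s5] abc \<delta> \<epsilon> \<open>\<delta> \<noteq> \<epsilon>\<close> by (auto simp: A_def C_def)
qed

definition gen5 :: "'k::field proj_plane \<Rightarrow> 'k proj_plane \<Rightarrow> 'k proj_plane \<Rightarrow>
    'k proj_plane \<Rightarrow> 'k proj_plane \<Rightarrow> bool"
  where "gen5 A B C D E \<longleftrightarrow>
    \<not> col A B C \<and> \<not> col A B D \<and> \<not> col A B E \<and> \<not> col A C D \<and> \<not> col A C E \<and>
    \<not> col A D E \<and> \<not> col B C D \<and> \<not> col B C E \<and> \<not> col B D E \<and> \<not> col C D E"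

text \<open>\<open>q\<close> is an equation of the conic through the five points, pulled back from
  the standard conic; its nonvanishing singles out the admissible sixth points.\<close>

lemma gen5_seven_thirds:
  fixes A B C D E :: "'k::{alg_closed_field, field_char_0} proj_plane"
  assumes gen: "gen5 A B C D E"
  obtains q where "form 2 q" "\<exists>v. q v \<noteq> (0::'k)"
    "\<And>P f d m u. q (rep P) \<noteq> 0 \<Longrightarrow> form d f \<Longrightarrow> f u \<noteq> 0 \<Longrightarrow>
      (\<And>R. R \<in> {A, B, C, D, E, P} \<Longrightarrow> vord f (rep R) m) \<Longrightarrow> 7 * m \<le> 3 * d"
proof -
  have nz: "line_form A B (rep C) \<noteq> 0" "line_form D B (rep C) \<noteq> 0" "line_form A D (rep C) \<noteq> 0" "line_form A B (rep D) \<noteq> 0"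
    "line_form E B (rep C) \<noteq> 0" "line_form A E (rep C) \<noteq> 0" "line_form A B (rep E) \<noteq> 0"
    "line_form A D (rep E) \<noteq> 0" "line_form B D (rep E) \<noteq> 0" "line_form C D (rep E) \<noteq> 0"
    using gen unfolding gen5_def col_def[symmetric] by (simp_all add: col_ac)
  obtain a t c \<delta> \<epsilon> s1 s2 s3 s4 s5 where det: "det3 a t c \<noteq> 0"
    and fr: "a = s1 *s rep A" "a + t + c = s2 *s rep B" "c = s3 *s rep C"
    "a + \<delta> *s t + \<delta>\<^sup>2 *s c = s4 *s rep D" "a + \<epsilon> *s t + \<epsilon>\<^sup>2 *s c = s5 *s rep E"
    and s: "s1 \<noteq> 0" "s2 \<noteq> 0" "s3 \<noteq> 0" "s4 \<noteq> 0" "s5 \<noteq> 0" and dist: "distinct [0, 1, \<delta>, \<epsilon>]"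
    by (rule conic_frame[OF nz]) (rule that)
  define h where "h v = v $ 1 *s a + v $ 2 *s t + v $ 3 *s c" for v :: "'k ^ 3"
  \<comment> \<open>By Cramer's rule an inverse of \<open>h\<close> up to the scalar
    \<open>det3 a t c\<close>, written without division.\<close>
  define k where "k v = (vector [det3 v t c, det3 a v c, det3 a t v] :: 'k ^ 3)" for v :: "'k ^ 3"
  have hk: "h (k v) = det3 a t c *s v" for v
    using det3_cramer[of a t c v] by (simp add: h_def k_def)
  have kscale: "k (x *s v) = x *s k v" for x v
    by (simp add: k_def vec_eq_iff forall_3 det3_def algebra_simps)
  have kpoly: "polyfun (\<lambda>v. k v $ i)" for i
  proof -
    have "polyfun (\<lambda>v. det3 v t c)" "polyfun (\<lambda>v. det3 a v c)" "polyfun (\<lambda>v. det3 a t v)"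
      unfolding det3_def by (intro polyfun_intros)+
    then show ?thesis
      using exhaust_3[of i] by (auto simp: k_def)
  qed
  show thesis
  proof (rule that[of "\<lambda>v. conic (k v)"])
    show "form 2 (\<lambda>v. conic (k v))"
      using form_conic[where 'a = 'k] polyfun_compose[OF form_polyfun[OF form_conic] kpoly]
      by (simp add: form_def kscale)
    have "k t = det3 a t c *s vector [0, 1, 0]"
      by (simp add: k_def vec_eq_iff forall_3) (simp add: det3_def algebra_simps)
    then have "conic (k t) \<noteq> 0"
      using det by (simp add: conic_def)
    then show "\<exists>v. conic (k v) \<noteq> 0" ..
    fix P f d m u
    assume P: "conic (k (rep P)) \<noteq> 0" and f: "form d f" "f u \<noteq> 0"
      and v: "\<And>R. R \<in> {A, B, C, D, E, P} \<Longrightarrow> vord f (rep R) m"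
    define g where "g v = f (h v)" for v
    have g: "form d g"
    proof -
      have "polyfun g"
        unfolding g_def
        by (rule polyfun_compose[OF form_polyfun[OF f(1)]]) (simp add: h_def, intro polyfun_intros)
      moreover have "h (x *s v) = x *s h v" for x v
        by (simp add: h_def vector_add_ldistrib vector_smult_assoc)
      ultimately show ?thesis
        using f by (simp add: form_def g_def)
    qed
    have gv: "vord g p m" if "h p = x *s rep R" "x \<noteq> 0" "R \<in> {A, B, C, D, E, P}" for p x R
    proof -
      have fv: "vord f (h p) m"
        using vord_scale[OF f(1) v] that by simp
      \<comment> \<open>A linear substitution carries lines to lines, so orders of vanishing are
        compared direction by direction.\<close>
      have "jet g p w = jet f (h p) (h w)" for w
      proof (rule jet_eqI)
        fix \<tau>
        have "h (p + \<tau> *s w) = h p + \<tau> *s h w"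
          by (simp add: h_def vec_eq_iff algebra_simps)
        then show "g (p + \<tau> *s w) = poly (jet f (h p) (h w)) \<tau>"
          by (simp add: g_def poly_jet[OF form_polyfun[OF f(1)]])
      qed
      then show ?thesis
        using fv by (simp add: vord_def)
    qed
    have "g (inverse (det3 a t c) *s k u) = inverse (det3 a t c) ^ d * f (det3 a t c *s u)"
      using g by (simp add: form_def) (simp add: g_def hk)
    then have gu: "g (inverse (det3 a t c) *s k u) \<noteq> 0"
      using f det by (simp add: form_def)
    have hcpt: "h (cpt x) = a + x *s t + x\<^sup>2 *s c" "h cinf = c" for x
      by (simp_all add: h_def cpt_def cinf_def)
    show "7 * m \<le> 3 * d"
    proof (rule seven_thirds_std[of "{0, 1, \<delta>, \<epsilon>}" d g _ "k (rep P)" m])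
      show "vord g (k (rep P)) m"
        using gv[of "k (rep P)" "det3 a t c" P] det hk by simp
      fix X assume "X \<in> insert cinf (cpt ` {0, 1, \<delta>, \<epsilon>})"
      then consider "X = cinf" | "X = cpt 0" | "X = cpt 1" | "X = cpt \<delta>" | "X = cpt \<epsilon>"
        by blast
      then show "vord g X m"
      proof cases
        case 1
        then show ?thesis using gv[of X s3 C] hcpt fr s by simp
      next
        case 2
        then show ?thesis using gv[of X s1 A] hcpt(1)[of 0] fr s by simp
      next
        case 3
        then show ?thesis using gv[of X s2 B] hcpt(1)[of 1] fr s by simp
      next
        case 4
        then show ?thesis using gv[of X s4 D] hcpt fr s by simp
      next
        case 5
        then show ?thesis using gv[of X s5 E] hcpt fr s by simp
      qed
    qed (use dist g gu P in auto)
  qed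
qed

section \<open>Polynomials and polynomial functions\<close>

definition mon :: "(3 \<Rightarrow>\<^sub>0 nat) \<Rightarrow> 'k::field ^ 3 \<Rightarrow> 'k"
  where "mon e v = (\<Prod>i\<in>UNIV. (v $ i) ^ Poly_Mapping.lookup e i)"

lemma mon_add: "mon (e + e') v = mon e v * mon e' v"
  by (simp add: mon_def lookup_add power_add prod.distrib)

lemma mon_0: "mon 0 v = 1"
  by (simp add: mon_def)

lemma eval3_mon: "eval3 F v = (\<Sum>e\<in>Poly_Mapping.keys F. Poly_Mapping.lookup F e * mon e v)"
  by (simp add: eval3_def mon_def)

lemma eval3_superset:
  assumes "finite S" "Poly_Mapping.keys F \<subseteq> S"
  shows "eval3 F v = (\<Sum>e\<in>S. Poly_Mapping.lookup F e * mon e v)"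
  unfolding eval3_mon by (rule sum.mono_neutral_left) (use assms in \<open>auto simp: in_keys_iff\<close>)

lemma eval3_add: "eval3 (F + G) v = eval3 F v + eval3 G v"
proof -
  let ?S = "Poly_Mapping.keys F \<union> Poly_Mapping.keys G"
  have "Poly_Mapping.keys (F + G) \<subseteq> ?S"
    by (rule keys_add)
  then show ?thesis
    by (simp add: eval3_superset[of ?S] lookup_add distrib_right sum.distrib)
qed

lemma eval3_0: "eval3 0 v = 0"
  by (simp add: eval3_def)

lemma eval3_single: "eval3 (Poly_Mapping.single e c) v = c * mon e v"
  by (subst eval3_superset[of "{e}"]) auto

lemma poly_mapping_add_induct [case_names zero add]:
  assumes "P 0" and "\<And>f k c. P f \<Longrightarrow> P (f + Poly_Mapping.single k c)"
  shows "P f"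
proof (induction f rule: update_induct)
  case const
  then show ?case using assms(1) by simp
next
  case (update f a b)
  have "Poly_Mapping.update a b f = f + Poly_Mapping.single a b"
    using update(1) by (intro poly_mapping_eqI)
      (auto simp: lookup_update lookup_add lookup_single in_keys_iff)
  then show ?case using assms(2) update by simp
qed

lemma eval3_mult: "eval3 (F * G) v = eval3 F v * eval3 G v"
proof (induction F rule: poly_mapping_add_induct)
  case zero
  then show ?case by (simp add: eval3_0)
next
  case (add F e c)
  have "eval3 (Poly_Mapping.single e c * G) v = eval3 (Poly_Mapping.single e c) v * eval3 G v"
  proof (induction G rule: poly_mapping_add_induct)
    case zero
    then show ?case by (simp add: eval3_0)
  next
    case (add G e' c')
    then show ?case
      by (simp add: distrib_left eval3_add mult_single eval3_single mon_add)
  qed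
  with add show ?case
    by (simp add: distrib_right eval3_add)
qed

lemma polyfun_mon: "polyfun (mon e)"
  unfolding mon_def[abs_def] by (intro polyfun_intros)

lemma polyfun_eval3: "polyfun (eval3 F)"
  unfolding eval3_mon[abs_def] by (intro polyfun_intros polyfun_mon)

text \<open>Kronecker substitution (t, t^N, t^(N^2)) with N above all exponents: monomials go to
  powers of t whose exponents have distinct digits in base N, so no two of them collide.\<close>

lemma eval3_eq_0_iff:
  fixes F :: "'k::field_char_0 poly3"
  shows "(\<forall>v. eval3 F v = 0) \<longleftrightarrow> F = 0"
proof
  assume 0: "\<forall>v. eval3 F v = 0"
  show "F = 0"
  proof (rule ccontr)
    assume "F \<noteq> 0"
    define N where "N = Suc (\<Sum>e\<in>Poly_Mapping.keys F. \<Sum>i\<in>UNIV. Poly_Mapping.lookup e i)"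
    have N: "Poly_Mapping.lookup e i < N" if "e \<in> Poly_Mapping.keys F" for e i
    proof -
      have "Poly_Mapping.lookup e i \<le> (\<Sum>i\<in>UNIV. Poly_Mapping.lookup e i)"
        by (rule member_le_sum) auto
      also have "\<dots> \<le> (\<Sum>e\<in>Poly_Mapping.keys F. \<Sum>i\<in>UNIV. Poly_Mapping.lookup e i)"
        using that by (intro member_le_sum[of e]) auto
      finally show ?thesis by (simp add: N_def)
    qed
    define \<kappa> where "\<kappa> e = Poly_Mapping.lookup e 1 + N * (Poly_Mapping.lookup e 2 + N * Poly_Mapping.lookup e 3)"
      for e :: "3 \<Rightarrow>\<^sub>0 nat"
    have digits: "a = a' \<and> b = b'" if "a + N * b = a' + N * b'" "a < N" "a' < N" for a a' b b'
      using that by (metis mod_less mod_mult_self2 add_left_cancel mult_left_cancel not_less_zero bot_nat_0.not_eq_extremum)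
    have inj: "e = e'" if "\<kappa> e = \<kappa> e'" "e \<in> Poly_Mapping.keys F" "e' \<in> Poly_Mapping.keys F" for e e'
    proof -
      have 1: "Poly_Mapping.lookup e 1 = Poly_Mapping.lookup e' 1 \<and>
        Poly_Mapping.lookup e 2 + N * Poly_Mapping.lookup e 3 = Poly_Mapping.lookup e' 2 + N * Poly_Mapping.lookup e' 3"
        using that N by (intro digits) (auto simp: \<kappa>_def)
      then have "Poly_Mapping.lookup e 2 = Poly_Mapping.lookup e' 2 \<and> Poly_Mapping.lookup e 3 = Poly_Mapping.lookup e' 3"
        using that N by (intro digits) auto
      with 1 have "Poly_Mapping.lookup e i = Poly_Mapping.lookup e' i" for i
        using exhaust_3[of i] by auto
      then show ?thesis
        by (rule poly_mapping_eqI)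
    qed
    define p where "p = (\<Sum>e\<in>Poly_Mapping.keys F. monom (Poly_Mapping.lookup F e) (\<kappa> e))"
    have prod3: "(\<Prod>i\<in>UNIV. h i) = h 1 * h 2 * h 3" for h :: "3 \<Rightarrow> 'k"
      unfolding UNIV_3 by (simp add: mult.assoc)
    have "poly p t = 0" for t
    proof -
      have "mon e (vector [t, t ^ N, t ^ (N * N)]) = t ^ \<kappa> e" for e
      proof -
        have "mon e (vector [t, t ^ N, t ^ (N * N)]) = t ^ Poly_Mapping.lookup e 1 *
            ((t ^ N) ^ Poly_Mapping.lookup e 2 * (t ^ (N * N)) ^ Poly_Mapping.lookup e 3)"
          by (simp only: mon_def prod3 vector_3 mult.assoc)
        then show ?thesis
          by (simp only: \<kappa>_def power_add power_mult distrib_left mult.assoc)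
      qed
      then have "poly p t = eval3 F (vector [t, t ^ N, t ^ (N * N)])"
        by (simp add: eval3_mon p_def poly_sum poly_monom)
      then show ?thesis using 0 by simp
    qed
    then have "p = 0"
      by (simp add: poly_eq_poly_eq_iff[symmetric] fun_eq_iff)
    obtain e0 where e0: "e0 \<in> Poly_Mapping.keys F"
      using \<open>F \<noteq> 0\<close> poly_mapping_eqI[of F 0] by (auto simp: in_keys_iff)
    have "coeff p (\<kappa> e0) = (\<Sum>e\<in>Poly_Mapping.keys F. if e = e0 then Poly_Mapping.lookup F e else 0)"
      unfolding p_def coeff_sum by (rule sum.cong) (use inj e0 in auto)
    also have "\<dots> = Poly_Mapping.lookup F e0"
      using e0 by simp
    finally show False
      using e0 \<open>p = 0\<close> by (simp add: in_keys_iff)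
  qed
qed (simp add: eval3_0)

abbreviation expdeg :: "(3 \<Rightarrow>\<^sub>0 nat) \<Rightarrow> nat"
  where "expdeg e \<equiv> \<Sum>i\<in>UNIV. Poly_Mapping.lookup e i"

lemma mon_scale: "mon e (c *s v) = c ^ expdeg e * mon e v"
  by (simp add: mon_def power_mult_distrib prod.distrib power_sum)

lemma form_eval3:
  fixes F :: "'k::field_char_0 poly3"
  assumes "is_form d F"
  shows "form d (eval3 F)"
proof -
  have "eval3 F (c *s v) = c ^ d * eval3 F v" for c v
    unfolding eval3_mon sum_distrib_left
  proof (rule sum.cong[OF refl])
    fix e assume "e \<in> Poly_Mapping.keys F"
    then have "expdeg e = d"
      using assms by (simp add: is_form_def)
    then show "Poly_Mapping.lookup F e * mon e (c *s v) = c ^ d * (Poly_Mapping.lookup F e * mon e v)"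
      by (simp only: mon_scale mult.left_commute)
  qed
  then show ?thesis
    by (simp add: form_def polyfun_eval3)
qed

lemma polyfun_is_eval3:
  assumes "polyfun f"
  shows "\<exists>F. \<forall>v. eval3 F v = f v"
  using assms
proof induction
  case (const c)
  show ?case by (rule exI[of _ "Poly_Mapping.single 0 c"]) (simp add: eval3_single mon_0)
next
  case (coord i)
  have "mon (Poly_Mapping.single i 1) v = v $ i" for v :: "'a ^ 3"
  proof -
    have "mon (Poly_Mapping.single i 1) v = (\<Prod>j\<in>UNIV. if j = i then v $ j else 1)"
      unfolding mon_def by (rule prod.cong) (auto simp: lookup_single)
    then show ?thesis by simp
  qed
  then show ?case
    by (intro exI[of _ "Poly_Mapping.single (Poly_Mapping.single i 1) 1"]) (simp add: eval3_single)
next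
  case (add f g)
  then show ?case by (metis eval3_add)
next
  case (mult f g)
  then show ?case by (metis eval3_mult)
qed

text \<open>Comparing F(2 v) with 2^d F(v) multiplies the coefficient at a monomial of degree k by
  2^k - 2^d, which in characteristic 0 vanishes only for k = d.\<close>

lemma form_is_eval3:
  fixes f :: "'k::field_char_0 ^ 3 \<Rightarrow> 'k"
  assumes f: "form d f"
  obtains F where "is_form d F" "\<And>v. eval3 F v = f v"
proof -
  obtain F where F: "\<And>v. eval3 F v = f v"
    using polyfun_is_eval3 f unfolding form_def by metis
  define G where "G = (\<Sum>e\<in>Poly_Mapping.keys F.
    Poly_Mapping.single e (Poly_Mapping.lookup F e * (2 ^ expdeg e - 2 ^ d)))"
  have "eval3 G v = 0" for v
  proof -
    have "eval3 (sum h S) v = (\<Sum>e\<in>S. eval3 (h e) v)" for h and S :: "(3 \<Rightarrow>\<^sub>0 nat) set"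
      by (induction S rule: infinite_finite_induct) (simp_all add: eval3_0 eval3_add)
    then have "eval3 G v = (\<Sum>e\<in>Poly_Mapping.keys F. Poly_Mapping.lookup F e * (2 ^ expdeg e - 2 ^ d) * mon e v)"
      by (simp add: G_def eval3_single)
    also have "\<dots> = eval3 F (2 *s v) - 2 ^ d * eval3 F v"
      by (simp add: eval3_mon mon_scale sum_distrib_left sum_subtractf algebra_simps)
    also have "\<dots> = 0"
      using f by (simp add: F form_def)
    finally show ?thesis .
  qed
  then have "G = 0"
    using eval3_eq_0_iff by blast
  have "expdeg e = d" if "e \<in> Poly_Mapping.keys F" for e
  proof -
    have "Poly_Mapping.lookup G e =
        (\<Sum>e'\<in>Poly_Mapping.keys F. if e' = e then Poly_Mapping.lookup F e * (2 ^ expdeg e - 2 ^ d) else 0)"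
      unfolding G_def lookup_sum by (rule sum.cong) (auto simp: lookup_single)
    then have "Poly_Mapping.lookup F e * (2 ^ expdeg e - 2 ^ d) = 0"
      using that \<open>G = 0\<close> by simp
    then have "(2 :: 'k) ^ expdeg e = 2 ^ d"
      using that by (simp add: in_keys_iff)
    then have "(of_nat (2 ^ expdeg e) :: 'k) = of_nat (2 ^ d)"
      by simp
    then show ?thesis
      unfolding of_nat_eq_iff by (simp add: power_inject_exp)
  qed
  then show thesis
    using that[of F] F by (auto simp: is_form_def)
qed

lemma is_form_mult:
  assumes "is_form d F" "is_form e G"
  shows "is_form (d + e) (F * G)"
  unfolding is_form_def
proof
  fix k assume "k \<in> Poly_Mapping.keys (F * G)"
  then obtain a b where "a \<in> Poly_Mapping.keys F" "b \<in> Poly_Mapping.keys G" "k = a + b"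
    using keys_mult by blast
  then show "expdeg k = d + e"
    using assms by (simp add: is_form_def lookup_add sum.distrib)
qed

lemma is_form_power: "is_form d F \<Longrightarrow> is_form (n * d) (F ^ n)"
proof (induction n)
  case 0
  then show ?case by (simp add: is_form_def)
next
  case (Suc n)
  then show ?case using is_form_mult[of d F "n * d" "F ^ n"] by simp
qed

lemma poly3_mult_neq_0:
  fixes F G :: "'k::field_char_0 poly3"
  shows "F \<noteq> 0 \<Longrightarrow> G \<noteq> 0 \<Longrightarrow> F * G \<noteq> 0"
  using polyfun_mult_eq_0[OF polyfun_eval3 polyfun_eval3, of F G]
  by (metis eval3_eq_0_iff eval3_mult)

lemma poly3_power_neq_0:
  fixes F :: "'k::field_char_0 poly3"
  shows "F \<noteq> 0 \<Longrightarrow> F ^ n \<noteq> 0"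
  by (induction n) (auto intro: poly3_mult_neq_0)

lemma vanishes_at_iff:
  fixes F :: "'k::field_char_0 poly3"
  assumes "is_form d F"
  shows "vanishes_at F P \<longleftrightarrow> eval3 F (rep P) = 0"
proof
  assume "vanishes_at F P"
  then show "eval3 F (rep P) = 0"
    unfolding vanishes_at_def using rep_nonzero abs_rep by blast
next
  assume 0: "eval3 F (rep P) = 0"
  show "vanishes_at F P"
    unfolding vanishes_at_def
  proof (intro allI impI)
    fix v :: "'k ^ 3" assume v: "v \<noteq> 0 \<and> abs_proj_plane v = P"
    then obtain c where c: "c \<noteq> 0" "rep P = c *s v"
      using rep_abs[of v] by metis
    have "c ^ d * eval3 F v = 0"
      using form_eval3[OF assms] 0 c by (simp add: form_def)
    then show "eval3 F v = 0" using c by simp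
  qed
qed

section \<open>Symbolic powers\<close>

interpretation ring_module: module "(*) :: 'a::comm_ring_1 \<Rightarrow> 'a \<Rightarrow> 'a"
  by (rule module_times)

lemma ideal_gen_induct [consumes 1, case_names base zero add mult]:
  assumes "x \<in> ideal_gen S" "\<And>x. x \<in> S \<Longrightarrow> P x" "P 0" "\<And>x y. P x \<Longrightarrow> P y \<Longrightarrow> P (x + y)"
    "\<And>c x. P x \<Longrightarrow> P (c * x)"
  shows "P x"
  using assms(1) unfolding ideal_gen_def
  by (rule ring_module.span_induct) (use assms in \<open>auto simp: ring_module.subspace_def\<close>)

lemma ideal_gen_base: "x \<in> S \<Longrightarrow> x \<in> ideal_gen S"
  unfolding ideal_gen_def by (rule ring_module.span_base)

lemma ideal_gen_zero: "0 \<in> ideal_gen S"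
  unfolding ideal_gen_def by (rule ring_module.span_zero)

lemma ideal_gen_add: "x \<in> ideal_gen S \<Longrightarrow> y \<in> ideal_gen S \<Longrightarrow> x + y \<in> ideal_gen S"
  unfolding ideal_gen_def by (rule ring_module.span_add)

lemma ideal_gen_mult: "x \<in> ideal_gen S \<Longrightarrow> c * x \<in> ideal_gen S"
  unfolding ideal_gen_def by (rule ring_module.span_scale)

lemma ideal_power_mult_left: "x \<in> ideal_power I m \<Longrightarrow> c * x \<in> ideal_power I m"
  by (cases m) (auto simp: ideal_mult_def intro: ideal_gen_mult)

lemma ideal_power_add:
  assumes "x \<in> ideal_power I m" and y: "y \<in> ideal_power I n"
  shows "x * y \<in> ideal_power I (m + n)"
  using assms(1)
proof (induction m arbitrary: x)
  case 0
  then show ?case using ideal_power_mult_left[OF y] by simp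
next
  case (Suc m)
  have "x \<in> ideal_gen {a * b | a b. a \<in> I \<and> b \<in> ideal_power I m}"
    using Suc.prems by (simp add: ideal_mult_def)
  then have "x * y \<in> ideal_gen {a * b | a b. a \<in> I \<and> b \<in> ideal_power I (m + n)}"
  proof (induction rule: ideal_gen_induct)
    case (base x)
    then obtain a b where "x = a * b" "a \<in> I" "b \<in> ideal_power I m" by blast
    then have "x * y = a * (b * y)" and "b * y \<in> ideal_power I (m + n)"
      using Suc.IH[of b] by (simp_all only: mult.assoc)
    then show ?case using \<open>a \<in> I\<close> by (intro ideal_gen_base) blast
  next
    case (mult c x)
    then show ?case unfolding mult.assoc by (rule ideal_gen_mult)
  qed (simp_all add: distrib_right ideal_gen_zero ideal_gen_add)
  then show ?case by (simp add: ideal_mult_def)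
qed

lemma ideal_power_power: "x \<in> I \<Longrightarrow> x ^ m \<in> ideal_power I m"
  by (induction m) (auto simp: ideal_mult_def intro!: ideal_gen_base)

lemma symbolic_power_mult:
  "F \<in> symbolic_power Z m \<Longrightarrow> G \<in> symbolic_power Z n \<Longrightarrow> F * G \<in> symbolic_power Z (m + n)"
  by (auto simp: symbolic_power_def intro: ideal_power_add)

lemma symbolic_power_power:
  assumes F: "is_form d F" and "\<And>P. P \<in> Z \<Longrightarrow> vanishes_at F P"
  shows "F ^ m \<in> symbolic_power Z m"
  using assms unfolding symbolic_power_def point_ideal_def
  by (blast intro: ideal_power_power ideal_gen_base)

text \<open>The passage from ideals to orders of vanishing: elements of the point ideal vanish at
  \<open>P\<close>, and orders add up in products. Through it the degree bounds apply to
  \<open>initial_degree\<close>.\<close>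

lemma symbolic_power_vord:
  fixes F :: "'k::field_char_0 poly3"
  assumes "F \<in> symbolic_power Z m" and "P \<in> Z"
  shows "vord (eval3 F) (rep P) m"
proof -
  have base: "eval3 G (rep P) = 0" if "G \<in> point_ideal P" for G
    using that unfolding point_ideal_def
    by (induction rule: ideal_gen_induct)
      (auto simp: vanishes_at_iff eval3_0 eval3_add eval3_mult)
  have "vord (eval3 G) (rep P) m" if "G \<in> ideal_power (point_ideal P) m" for G
    using that
  proof (induction m arbitrary: G)
    case 0
    then show ?case by (simp add: vord_0)
  next
    case (Suc m)
    have zero: "vord (\<lambda>_. 0) p n" for p :: "'k ^ 3" and n
      by (simp add: vord_def jet_const)
    have "G \<in> ideal_gen {a * b | a b. a \<in> point_ideal P \<and> b \<in> ideal_power (point_ideal P) m}"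
      using Suc.prems by (simp add: ideal_mult_def)
    then show ?case
    proof (induction rule: ideal_gen_induct)
      case (base x)
      then obtain a b where x: "x = a * b" and ab: "a \<in> point_ideal P" "b \<in> ideal_power (point_ideal P) m"
        by blast
      have "vord (eval3 a) (rep P) 1"
        using \<open>\<And>G. G \<in> point_ideal P \<Longrightarrow> eval3 G (rep P) = 0\<close> ab by (intro vord_1 polyfun_eval3)
      then show ?case
        using vord_mult[OF polyfun_eval3 polyfun_eval3 _ Suc.IH[OF ab(2)]]
        by (fastforce simp: x eval3_mult[abs_def])
    next
      case (mult c x)
      then show ?case
        using vord_mult[OF polyfun_eval3 polyfun_eval3 vord_0 mult] by (simp add: eval3_mult[abs_def])
    qed (auto simp: eval3_0[abs_def] eval3_add[abs_def] zero intro: vord_add polyfun_eval3)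
  qed
  then show ?thesis
    using assms by (auto simp: symbolic_power_def)
qed

section \<open>The Waldschmidt constant as a limit\<close>

lemma ex_line_through:
  fixes P :: "'k::field_char_0 proj_plane"
  obtains F where "is_form 1 F" "F \<noteq> 0" "vanishes_at F P"
proof -
  obtain w where w: "rep P $ w \<noteq> 0"
    using rep_nonzero[of P] by (auto simp: vec_eq_iff)
  obtain j where "j \<noteq> w"
    by (metis zero_neq_one)
  have "axis j 1 \<noteq> c *s rep P" for c
  proof
    assume eq: "axis j 1 = c *s rep P"
    have "(axis j 1 :: 'k ^ 3) $ w = 0" "(axis j 1 :: 'k ^ 3) $ j = 1"
      using \<open>j \<noteq> w\<close> by (simp_all add: axis_def)
    then show False
      using w by (simp add: eq)
  qed
  then obtain b :: "'k ^ 3" where b: "\<And>c. b \<noteq> c *s rep P" by blast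
  then obtain v where v: "det3 b (rep P) v \<noteq> 0"
    using ex_det3_nonzero[OF rep_nonzero] by blast
  obtain F where F: "is_form 1 F" "\<And>v. eval3 F v = det3 b (rep P) v"
    using form_is_eval3[OF form_det3] by blast
  show thesis
  proof (rule that[OF F(1)])
    show "F \<noteq> 0"
      using F(2)[of v] v by (auto simp: eval3_0)
    show "vanishes_at F P"
    proof -
      have "det3 b (rep P) (rep P) = 0"
        by (simp add: det3_def mult.commute)
      then show ?thesis
        by (simp add: vanishes_at_iff[OF F(1)] F(2))
    qed
  qed
qed

abbreviation (input) \<alpha> :: "'k::field proj_plane set \<Rightarrow> nat \<Rightarrow> nat"
  where "\<alpha> Z m \<equiv> initial_degree (symbolic_power Z m)"

text \<open>A product of lines, one through each point. It makes the \<open>LEAST\<close> in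
  \<open>initial_degree\<close> an attained minimum.\<close>

lemma ex_form_vanishing:
  fixes Z :: "'k::field_char_0 proj_plane set"
  assumes "finite Z"
  shows "\<exists>d F. is_form d F \<and> F \<noteq> 0 \<and> (\<forall>P\<in>Z. vanishes_at F P)"
  using assms
proof induction
  case empty
  show ?case by (rule exI[of _ 0], rule exI[of _ 1]) (simp add: is_form_def)
next
  case (insert P Z)
  then obtain d F where F: "is_form d F" "F \<noteq> 0" "\<And>Q. Q \<in> Z \<Longrightarrow> vanishes_at F Q" by blast
  obtain L where L: "is_form 1 L" "L \<noteq> 0" "vanishes_at L P"
    using ex_line_through by blast
  have "is_form (d + 1) (F * L)" "F * L \<noteq> 0"
    using is_form_mult[OF F(1) L(1)] poly3_mult_neq_0[OF F(2) L(2)] .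
  moreover have "\<forall>Q\<in>insert P Z. vanishes_at (F * L) Q"
    using F(3) L(3) by (auto simp: vanishes_at_def eval3_mult)
  ultimately show ?case by blast
qed

lemma initial_degree_attained:
  fixes Z :: "'k::field_char_0 proj_plane set"
  assumes "finite Z"
  obtains F where "F \<in> symbolic_power Z m" "F \<noteq> 0" "is_form (\<alpha> Z m) F"
proof -
  obtain d F where F: "is_form d F" "F \<noteq> 0" "\<forall>P\<in>Z. vanishes_at F P"
    using ex_form_vanishing[OF assms] by blast
  then have "\<exists>F\<in>symbolic_power Z m. F \<noteq> 0 \<and> is_form (m * d) F"
    using symbolic_power_power is_form_power poly3_power_neq_0 by metis
  then have "\<exists>F\<in>symbolic_power Z m. F \<noteq> 0 \<and> is_form (\<alpha> Z m) F"
    unfolding initial_degree_def by (rule LeastI)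
  then show thesis using that by blast
qed

lemma initial_degree_le:
  "F \<in> symbolic_power Z m \<Longrightarrow> F \<noteq> 0 \<Longrightarrow> is_form d F \<Longrightarrow> \<alpha> Z m \<le> d"
  unfolding initial_degree_def by (rule Least_le) blast

lemma initial_degree_subadditive:
  fixes Z :: "'k::field_char_0 proj_plane set"
  assumes "finite Z"
  shows "\<alpha> Z (m + n) \<le> \<alpha> Z m + \<alpha> Z n"
proof -
  obtain F where F: "F \<in> symbolic_power Z m" "F \<noteq> 0" "is_form (\<alpha> Z m) F"
    by (rule initial_degree_attained[OF assms])
  obtain G where G: "G \<in> symbolic_power Z n" "G \<noteq> 0" "is_form (\<alpha> Z n) G"
    by (rule initial_degree_attained[OF assms])
  show ?thesis
    using F G by (intro initial_degree_le[of "F * G"] symbolic_power_mult poly3_mult_neq_0 is_form_mult)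
qed

text \<open>Fekete's lemma: division with remainder k = q n + r gives a k \<le> q a n + M with M
  independent of k, and M / k becomes small.\<close>

lemma subadditive_convergent:
  fixes a :: "nat \<Rightarrow> nat"
  assumes sub: "\<And>m n. a (m + n) \<le> a m + a n"
  shows "convergent (\<lambda>n. real (a n) / real n)"
proof -
  \<comment> \<open>The infimum starts at 1, since at 0 the quotient is 0 by the convention on
    division.\<close>
  define L where "L = (INF n\<in>{1..}. real (a n) / real n)"
  have bdd: "bdd_below ((\<lambda>n. real (a n) / real n) ` {1..})"
    by (rule bdd_belowI[of _ 0]) auto
  have mult: "a (k * n + r) \<le> k * a n + a r" for k n r
  proof (induction k)
    case (Suc k)
    have "a (Suc k * n + r) = a (n + (k * n + r))" by (simp add: add.assoc)
    also have "\<dots> \<le> a n + a (k * n + r)" by (rule sub)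
    finally show ?case using Suc by simp
  qed simp
  have "(\<lambda>n. real (a n) / real n) \<longlonglongrightarrow> L"
  proof (rule LIMSEQ_I)
    fix \<epsilon> :: real assume "0 < \<epsilon>"
    then have "\<exists>n\<in>{1..}. real (a n) / real n < L + \<epsilon> / 2"
      using cINF_less_iff[OF _ bdd, of "L + \<epsilon> / 2"] by (simp add: L_def)
    then obtain n where n: "1 \<le> n" "real (a n) / real n < L + \<epsilon> / 2" by auto
    define M where "M = Max (a ` {..<n})"
    obtain N :: nat where N: "real M / (\<epsilon> / 2) < real N"
      using reals_Archimedean2 by blast
    have "norm (real (a k) / real k - L) < \<epsilon>" if "max N 1 \<le> k" for k
    proof -
      have k: "0 < k" using that by simp
      have "L \<le> real (a k) / real k"
        unfolding L_def using bdd k by (intro cINF_lower) auto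
      moreover have "a k \<le> (k div n) * a n + a (k mod n)"
        using mult[of "k div n" n "k mod n"] by simp
      moreover have "a (k mod n) \<le> M"
        unfolding M_def using n by (intro Max_ge) auto
      ultimately have "real (a k) \<le> real (k div n) * real (a n) + real M"
        by (metis (mono_tags, lifting) add_left_mono le_trans of_nat_add of_nat_le_iff of_nat_mult)
      also have "real (k div n) * real (a n) \<le> (real k / real n) * real (a n)"
        by (intro mult_right_mono of_nat_div_le_of_nat) auto
      also have "\<dots> = real k * (real (a n) / real n)"
        by simp
      also have "\<dots> \<le> real k * (L + \<epsilon> / 2)"
        using n by (intro mult_left_mono) auto
      finally have *: "real (a k) \<le> real k * (L + \<epsilon> / 2) + real M" by simp
      have "real M < real N * (\<epsilon> / 2)"
        using N \<open>0 < \<epsilon>\<close> by (simp add: divide_less_eq)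
      also have "\<dots> \<le> real k * (\<epsilon> / 2)"
        using that \<open>0 < \<epsilon>\<close> by (intro mult_right_mono) auto
      finally have "real (a k) < real k * (L + \<epsilon>)"
        using * by (simp add: algebra_simps)
      then have "real (a k) / real k < L + \<epsilon>"
        using k by (simp add: divide_less_eq mult.commute)
      with \<open>L \<le> real (a k) / real k\<close> show ?thesis by simp
    qed
    then show "\<exists>N. \<forall>k\<ge>N. norm (real (a k) / real k - L) < \<epsilon>" by blast
  qed
  then show ?thesis by (rule convergentI)
qed

lemma waldschmidt_limit:
  fixes Z :: "'k::field_char_0 proj_plane set"
  assumes "finite Z"
  shows "(\<lambda>m. real (\<alpha> Z m) / real m) \<longlonglongrightarrow> waldschmidt Z"
  unfolding waldschmidt_def
  using subadditive_convergent[of "\<alpha> Z", OF initial_degree_subadditive[OF assms]]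
  by (simp add: convergent_LIMSEQ_iff)

section \<open>Lines as point sets\<close>

abbreviation lset :: "'k::field proj_plane \<Rightarrow> 'k proj_plane \<Rightarrow> 'k proj_plane set"
  where "lset P Q \<equiv> {R. col P Q R}"

lemma is_line_lset:
  fixes P Q :: "'k::field_char_0 proj_plane"
  assumes "P \<noteq> Q"
  shows "is_line (lset P Q)"
proof -
  obtain w where w: "line_form P Q w \<noteq> 0"
    using ex_ln_nonzero[OF assms] by blast
  obtain F where F: "is_form 1 F" "\<And>v. eval3 F v = line_form P Q v"
    using form_is_eval3[OF form_det3] by blast
  have "F \<noteq> 0"
    using F(2)[of w] w by (auto simp: eval3_0)
  moreover have "lset P Q = {R. vanishes_at F R}"
    by (simp add: vanishes_at_iff[OF F(1)] F(2) col_def)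
  ultimately show ?thesis
    unfolding is_curve_def using F(1) by blast
qed

lemma is_form_1_linear:
  assumes "is_form 1 F"
  shows "eval3 F v = (\<Sum>i\<in>UNIV. Poly_Mapping.lookup F (Poly_Mapping.single i 1) * v $ i)"
proof -
  have mon: "mon (Poly_Mapping.single i 1) v = v $ i" for i
  proof -
    have "mon (Poly_Mapping.single i 1) v = (\<Prod>j\<in>UNIV. if j = i then v $ j else 1)"
      unfolding mon_def by (rule prod.cong) (auto simp: lookup_single)
    then show ?thesis by simp
  qed
  have inj: "inj (\<lambda>i::3. Poly_Mapping.single i (1::nat))"
    by (rule injI) (metis lookup_single_eq lookup_single_not_eq zero_neq_one)
  have "Poly_Mapping.keys F \<subseteq> range (\<lambda>i. Poly_Mapping.single i 1)"
  proof
    fix e assume "e \<in> Poly_Mapping.keys F"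
    then have e: "expdeg e = 1"
      using assms by (simp add: is_form_def)
    then obtain i where i: "Poly_Mapping.lookup e i \<noteq> 0"
      by (metis sum.neutral zero_neq_one)
    have "expdeg e = Poly_Mapping.lookup e i + (\<Sum>j\<in>UNIV - {i}. Poly_Mapping.lookup e j)"
      by (simp add: sum.remove)
    then have *: "Poly_Mapping.lookup e i = 1" "(\<Sum>j\<in>UNIV - {i}. Poly_Mapping.lookup e j) = 0"
      using e i by linarith+
    have "Poly_Mapping.lookup e j = Poly_Mapping.lookup (Poly_Mapping.single i 1) j" for j
      using * by (cases "j = i") (auto simp: lookup_single)
    then have "e = Poly_Mapping.single i 1"
      by (rule poly_mapping_eqI)
    then show "e \<in> range (\<lambda>i. Poly_Mapping.single i 1)" by blast
  qed
  then have "eval3 F v = (\<Sum>e\<in>range (\<lambda>i. Poly_Mapping.single i 1). Poly_Mapping.lookup F e * mon e v)"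
    by (intro eval3_superset) auto
  then show ?thesis
    using inj by (simp add: sum.reindex mon[unfolded One_nat_def])
qed

text \<open>The linear form of \<open>L\<close> vanishes at \<open>P\<close> and \<open>Q\<close>,
  so it is divisible by the line form of these points; the quotient has degree 0 and is a nonzero
  constant.\<close>

lemma line_eq_lset:
  fixes P Q :: "'k::field_char_0 proj_plane"
  assumes "is_line L" "P \<in> L" "Q \<in> L" "P \<noteq> Q"
  shows "L = lset P Q"
proof -
  obtain F where F: "F \<noteq> 0" "is_form 1 F" "L = {R. vanishes_at F R}"
    using assms(1) unfolding is_curve_def by blast
  have L: "R \<in> L \<longleftrightarrow> eval3 F (rep R) = 0" for R
    by (simp add: F(3) vanishes_at_iff[OF F(2)])
  have f: "form 1 (eval3 F)"
    by (rule form_eval3[OF F(2)])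
  have "vord (eval3 F) (rep P) 1" "vord (eval3 F) (rep Q) 1"
    using assms(2,3) vord_1[OF polyfun_eval3] unfolding L by blast+
  then have "pdvd (line_form P Q) (eval3 F)"
    using pdvd_ln2[OF f assms(4)] by fastforce
  then obtain g where g: "polyfun g" "\<And>v. eval3 F v = line_form P Q v * g v"
    unfolding pdvd_def by blast
  obtain u where u: "eval3 F u \<noteq> 0"
    using F(1) eval3_eq_0_iff by blast
  have "form 1 (\<lambda>v. line_form P Q v * g v)"
    using f by (simp add: g(2)[symmetric])
  then have "form (1 - 1) g"
    by (rule form_divide(2)[OF _ form_det3 g(1)]) (use u g(2) in auto)
  then have "g (c *s v) = c ^ (1 - 1) * g v" for c v
    unfolding form_def by blast
  \<comment> \<open>With exponent 0 the scaling law at \<open>c = 0\<close> says that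
    \<open>g\<close> is constant.\<close>
  from this[of 0] have "g 0 = g v" for v
    by simp
  then have "g v = g u" for v
    by metis
  moreover have "g u \<noteq> 0"
    using u g(2) by auto
  ultimately show ?thesis
    by (auto simp: L g(2) col_def) (metis mult_eq_0_iff)
qed

lemma line_two_points:
  fixes L :: "'k::field_char_0 proj_plane set"
  assumes "is_line L"
  obtains P Q where "P \<noteq> Q" "L = lset P Q"
proof -
  obtain F where F: "F \<noteq> 0" "is_form 1 F" "L = {R. vanishes_at F R}"
    using assms unfolding is_curve_def by blast
  define c where "c i = Poly_Mapping.lookup F (Poly_Mapping.single i 1)" for i
  have ev: "eval3 F v = (\<Sum>i\<in>UNIV. c i * v $ i)" for v
    unfolding c_def by (rule is_form_1_linear[OF F(2)])
  have evax: "eval3 F (x *s axis i 1 - y *s axis j 1) = x * c i - y * c j" for x y i j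
  proof -
    have "eval3 F (v - w) = eval3 F v - eval3 F w" "eval3 F (x *s v) = x * eval3 F v" for v w x
      using form_eval3[OF F(2)] by (simp_all add: form_def) (simp add: ev right_diff_distrib sum_subtractf)
    moreover have "eval3 F (axis i 1) = c i" for i
      by (simp add: ev axis_def if_distrib cong: if_cong)
    ultimately show ?thesis by simp
  qed
  obtain i where i: "c i \<noteq> 0"
  proof (rule ccontr)
    assume "\<not> thesis"
    then have "c i = 0" for i using that by blast
    then have "F = 0" using eval3_eq_0_iff[of F] by (simp add: ev)
    then show False using F(1) by simp
  qed
  obtain j k where jk: "j \<noteq> i" "k \<noteq> i" "j \<noteq> k"
    using exhaust_3[of i] that[of 2 3] that[of 1 3] that[of 1 2] by auto
  \<comment> \<open>For \<open>c i \<noteq> 0\<close> these are two independent zeros of the linear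
    form with coefficients \<open>c\<close>.\<close>
  define a b where "a = c i *s axis j 1 - c j *s axis i 1"
    and "b = c i *s axis k 1 - (c k *s axis i 1 :: 'k ^ 3)"
  have ab: "a $ j = c i" "b $ j = 0" "b $ k = c i"
    using jk by (auto simp: a_def b_def axis_def)
  have nz: "a \<noteq> 0" "b \<noteq> 0"
    using ab i by auto
  obtain s where s: "s \<noteq> 0" "rep (abs_proj_plane a) = s *s a"
    using rep_abs[OF nz(1)] by blast
  obtain t where t: "t \<noteq> 0" "rep (abs_proj_plane b) = t *s b"
    using rep_abs[OF nz(2)] by blast
  have "abs_proj_plane a \<noteq> abs_proj_plane b"
  proof
    assume "abs_proj_plane a = abs_proj_plane b"
    then have "(s *s a) $ j = (t *s b) $ j" using s t by simp
    then show False using ab i s by simp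
  qed
  moreover have "eval3 F (rep (abs_proj_plane a)) = 0" "eval3 F (rep (abs_proj_plane b)) = 0"
    using form_eval3[OF F(2)] evax[of "c i" j "c j" i] evax[of "c i" k "c k" i]
    by (simp_all add: s t form_def flip: a_def b_def)
  then have "abs_proj_plane a \<in> L" "abs_proj_plane b \<in> L"
    by (simp_all add: F(3) vanishes_at_iff[OF F(2)])
  ultimately show thesis
    using that line_eq_lset[OF assms] by blast
qed

lemma lines_meet:
  fixes L M :: "'k::field_char_0 proj_plane set"
  assumes "is_line L" "is_line M"
  obtains P where "P \<in> L" "P \<in> M"
proof -
  obtain A B where L: "A \<noteq> B" "L = lset A B"
    using line_two_points[OF assms(1)] by blast
  obtain C D where M: "C \<noteq> D" "M = lset C D"
    using line_two_points[OF assms(2)] by blast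
  show thesis
  proof (cases "C \<in> L")
    case True
    then show ?thesis using that M by (simp add: col_refl)
  next
    case False
    \<comment> \<open>The combination of C and D on which the linear form of AB vanishes; it is
      nonzero as C is off that line and differs from D.\<close>
    define v where "v = line_form A B (rep D) *s rep C - line_form A B (rep C) *s rep D"
    have "v \<noteq> 0"
    proof
      assume "v = 0"
      then have "line_form A B (rep C) *s rep D = line_form A B (rep D) *s rep C"
        by (simp add: v_def)
      then have "inverse (line_form A B (rep C)) *s (line_form A B (rep C) *s rep D)
          = inverse (line_form A B (rep C)) *s (line_form A B (rep D) *s rep C)"
        by simp
      then have "rep D = (inverse (line_form A B (rep C)) * line_form A B (rep D)) *s rep C"
        using False by (simp add: L col_def vector_smult_assoc)
      then show False
        using rep_eqI M(1) by blast
    qed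
    then obtain c where c: "rep (abs_proj_plane v) = c *s v"
      using rep_abs by blast
    have lin: "det3 a b (x *s p) = x * det3 a b p" "det3 a b (p - q) = det3 a b p - det3 a b q"
      for a b p q :: "'k ^ 3" and x
    proof -
      show "det3 a b (x *s p) = x * det3 a b p"
        using form_det3[of a b] by (simp add: form_def)
      show "det3 a b (p - q) = det3 a b p - det3 a b q"
        unfolding det3_def vector_minus_component by algebra
    qed
    have "det3 a b b = 0" "det3 b a b = 0" for a b :: "'k ^ 3"
      unfolding det3_def by algebra+
    then have "line_form A B v = 0" "line_form C D v = 0"
      by (simp_all add: v_def lin mult.commute)
    then have "abs_proj_plane v \<in> L" "abs_proj_plane v \<in> M"
      unfolding L M by (simp_all add: col_def c lin)
    then show ?thesis using that by blast
  qed
qed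

lemma lines_inter:
  fixes L M :: "'k::field_char_0 proj_plane set"
  assumes "is_line L" "is_line M" "L \<noteq> M" "P \<in> L" "P \<in> M"
  shows "L \<inter> M = {P}"
proof -
  have "Q = P" if "Q \<in> L" "Q \<in> M" for Q
    using line_eq_lset[OF assms(1), of P Q] line_eq_lset[OF assms(2), of P Q] assms(3-5) that by metis
  then show ?thesis using assms(4,5) by blast
qed

lemma lset_inter:
  assumes "\<not> col P Q R"
  shows "lset P Q \<inter> lset P R = {P}"
proof -
  have "S = P" if "col P Q S" "col P R S" for S
  proof (rule ccontr)
    assume "S \<noteq> P"
    moreover have "col P S Q" "col P S R"
      using that by (auto simp: col_ac)
    ultimately show False
      using col_trans[of P S Q R] assms by auto
  qed
  then show ?thesis
    by (auto simp: col_refl)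
qed

section \<open>Stars and quasi stars from triangles\<close>

lemma lset_commute: "lset P Q = lset Q P"
  using col_commute by blast

lemma tri_lset_inter:
  assumes "tri U V W X Y T"
  shows "lset U V \<inter> lset U W = {U}" "lset U V \<inter> lset V W = {V}" "lset U W \<inter> lset V W = {W}"
proof -
  have n: "\<not> col U V W" "\<not> col V U W" "\<not> col W U V"
    using assms by (auto simp: tri_def col_ac)
  show "lset U V \<inter> lset U W = {U}"
    by (rule lset_inter[OF n(1)])
  show "lset U V \<inter> lset V W = {V}"
    using lset_inter[OF n(2)] by (simp only: lset_commute[of V U])
  show "lset U W \<inter> lset V W = {W}"
    using lset_inter[OF n(3)] by (simp only: lset_commute[of W U] lset_commute[of W V])
qed

lemma no_three_concurrent:
  assumes "\<And>P. \<not> (P \<in> a \<and> P \<in> b \<and> P \<in> c)" "\<And>P. \<not> (P \<in> a \<and> P \<in> b \<and> P \<in> d)"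
    "\<And>P. \<not> (P \<in> a \<and> P \<in> c \<and> P \<in> d)" "\<And>P. \<not> (P \<in> b \<and> P \<in> c \<and> P \<in> d)"
  shows "\<forall>L\<in>{a, b, c, d}. \<forall>M\<in>{a, b, c, d}. \<forall>N\<in>{a, b, c, d}.
    L \<noteq> M \<and> L \<noteq> N \<and> M \<noteq> N \<longrightarrow> L \<inter> M \<inter> N = {}"
proof (intro ballI impI, rule ccontr)
  fix L M N
  assume LMN: "L \<in> {a, b, c, d}" "M \<in> {a, b, c, d}" "N \<in> {a, b, c, d}" "L \<noteq> M \<and> L \<noteq> N \<and> M \<noteq> N"
    and "L \<inter> M \<inter> N \<noteq> {}"
  then obtain P where "P \<in> L" "P \<in> M" "P \<in> N" by blast
  then show False
    using LMN assms[of P] by (elim insertE emptyE) simp_all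
qed

lemma pairwise_intersections_3:
  assumes "distinct [a, b, c]"
  shows "pairwise_intersections {a, b, c} = a \<inter> b \<union> a \<inter> c \<union> b \<inter> c"
proof (rule set_eqI)
  fix P
  show "P \<in> pairwise_intersections {a, b, c} \<longleftrightarrow> P \<in> a \<inter> b \<union> a \<inter> c \<union> b \<inter> c"
    using assms unfolding pairwise_intersections_def distinct.simps list.set mem_Collect_eq bex_simps Int_iff Un_iff
    by (simp, argo)
qed

lemma pairwise_intersections_4:
  assumes "distinct [a, b, c, d]"
  shows "pairwise_intersections {a, b, c, d} =
    a \<inter> b \<union> a \<inter> c \<union> b \<inter> c \<union> a \<inter> d \<union> b \<inter> d \<union> c \<inter> d"
proof (rule set_eqI)
  fix P
  show "P \<in> pairwise_intersections {a, b, c, d} \<longleftrightarrow> P \<in> a \<inter> b \<union> a \<inter> c \<union> b \<inter> c \<union> a \<inter> d \<union> b \<inter> d \<union> c \<inter> d"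
    using assms unfolding pairwise_intersections_def distinct.simps list.set mem_Collect_eq bex_simps Int_iff Un_iff
    by (simp, argo)
qed

lemma quasi_star_of_tri:
  fixes U V W X Y T :: "'k::field_char_0 proj_plane"
  assumes t: "tri U V W X Y T" and nc: "\<not> col X Y T"
  shows "is_quasi_star 3 {U, V, W, X, Y, T}"
proof -
  note tt = t[unfolded tri_def]
  note d = tri_distinct[OF t]
  note n = tri_noncol[OF t]
  define a b c where "a = lset U V" and "b = lset U W" and "c = lset V W"
  note abc = a_def b_def c_def
  have mem: "U \<in> a" "V \<in> a" "T \<in> a" "U \<in> b" "W \<in> b" "Y \<in> b" "V \<in> c" "W \<in> c" "X \<in> c"
    "W \<notin> a" "X \<notin> a" "Y \<notin> a" "V \<notin> b" "X \<notin> b" "T \<notin> b" "U \<notin> c" "Y \<notin> c" "T \<notin> c"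
    using tt n by (auto simp: abc col_refl)
  note i = tri_lset_inter[OF t, folded abc]
  have ne: "a \<noteq> b" "a \<noteq> c" "b \<noteq> c"
    using mem by blast+
  have "general_lines 3 {a, b, c}"
    unfolding general_lines_def
  proof (intro conjI)
    show "card {a, b, c} = 3"
      using ne by simp
    show "\<forall>L\<in>{a, b, c}. is_line L"
      using d is_line_lset by (auto simp: abc)
    have "\<not> (P \<in> a \<and> P \<in> b \<and> P \<in> c)" for P
      using i(1) mem(16) by (metis IntI singletonD)
    then show "\<forall>L\<in>{a, b, c}. \<forall>M\<in>{a, b, c}. \<forall>N\<in>{a, b, c}.
        L \<noteq> M \<and> L \<noteq> N \<and> M \<noteq> N \<longrightarrow> L \<inter> M \<inter> N = {}"
      \<comment> \<open>The empty set as fourth member makes the other three conditions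
        vacuous.\<close>
      using no_three_concurrent[of a b c "{}"] by simp
  qed simp
  moreover have "pairwise_intersections {a, b, c} = {U, V, W}"
    using ne by (simp add: pairwise_intersections_3 i insert_commute)
  moreover have "\<not> (\<exists>M. is_line M \<and> {X, Y, T} \<subseteq> M)"
    using line_eq_lset[of _ X Y] nc d by auto
  moreover have "\<forall>L\<in>{a, b, c}. \<exists>!P. P \<in> {X, Y, T} \<inter> L"
  proof -
    have "{X, Y, T} \<inter> a = {T}" "{X, Y, T} \<inter> b = {Y}" "{X, Y, T} \<inter> c = {X}"
      using mem by auto
    moreover have "\<exists>!P. P \<in> {Q}" for Q :: "'k proj_plane"
      by simp
    ultimately show ?thesis
      by (intro ballI) (metis insertE singletonD)
  qed
  moreover have "{U, V, W, X, Y, T} = {U, V, W} \<union> {X, Y, T}" "{X, Y, T} \<inter> {U, V, W} = {}"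
    "{X, Y, T} \<subseteq> \<Union>{a, b, c}"
    using d mem by auto
  ultimately show ?thesis
    unfolding is_quasi_star_def by (intro exI[of _ "{a, b, c}"] exI[of _ "{X, Y, T}"]) simp
qed

lemma star_of_tri:
  fixes U V W X Y T :: "'k::field_char_0 proj_plane"
  assumes t: "tri U V W X Y T" and cl: "col X Y T"
  shows "is_star 4 {U, V, W, X, Y, T}"
proof -
  note tt = t[unfolded tri_def]
  note dis = tri_distinct[OF t]
  note n = tri_noncol[OF t]
  define a b c d where "a = lset U V" and "b = lset U W" and "c = lset V W" and "d = lset X Y"
  note abcd = a_def b_def c_def d_def
  have mem: "U \<in> a" "V \<in> a" "T \<in> a" "U \<in> b" "W \<in> b" "Y \<in> b" "V \<in> c" "W \<in> c" "X \<in> c"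
    "W \<notin> a" "X \<notin> a" "Y \<notin> a" "V \<notin> b" "X \<notin> b" "T \<notin> b" "U \<notin> c" "Y \<notin> c" "T \<notin> c"
    "X \<in> d" "Y \<in> d" "T \<in> d" "U \<notin> d" "V \<notin> d" "W \<notin> d"
    using tt n cl by (auto simp: abcd col_refl)
  have ne: "a \<noteq> b" "a \<noteq> c" "b \<noteq> c" "a \<noteq> d" "b \<noteq> d" "c \<noteq> d"
    using mem by blast+
  have ln: "is_line a" "is_line b" "is_line c" "is_line d"
    using dis is_line_lset by (auto simp: abcd)
  have i: "a \<inter> b = {U}" "a \<inter> c = {V}" "b \<inter> c = {W}" "a \<inter> d = {T}" "b \<inter> d = {Y}" "c \<inter> d = {X}"
    by (rule lines_inter; (rule ln ne mem))+
  have "general_lines 4 {a, b, c, d}"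
    unfolding general_lines_def
  proof (intro conjI)
    show "card {a, b, c, d} = 4"
      using ne by simp
    show "\<forall>L\<in>{a, b, c, d}. is_line L"
      using ln by simp
    have "\<not> (P \<in> a \<and> P \<in> b \<and> P \<in> c)" "\<not> (P \<in> a \<and> P \<in> b \<and> P \<in> d)"
      "\<not> (P \<in> a \<and> P \<in> c \<and> P \<in> d)" "\<not> (P \<in> b \<and> P \<in> c \<and> P \<in> d)" for P
      using i(1-3) mem(16,22-24) by (metis IntI singletonD)+
    then show "\<forall>L\<in>{a, b, c, d}. \<forall>M\<in>{a, b, c, d}. \<forall>N\<in>{a, b, c, d}.
        L \<noteq> M \<and> L \<noteq> N \<and> M \<noteq> N \<longrightarrow> L \<inter> M \<inter> N = {}"
      by (rule no_three_concurrent)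
  qed simp
  moreover have "pairwise_intersections {a, b, c, d} = {U, V, W, X, Y, T}"
    using ne by (auto simp: pairwise_intersections_4 i)
  ultimately show ?thesis
    unfolding is_star_def by (intro exI[of _ "{a, b, c, d}"]) simp
qed

text \<open>Three of the lines form the triangle, and the fourth meets its sides in three collinear
  points, away from the vertices because no three lines are concurrent.\<close>

lemma tri_of_star:
  fixes Z :: "'k::field_char_0 proj_plane set"
  assumes "is_star 4 Z"
  obtains U V W X Y T where "tri U V W X Y T" "col X Y T" "Z = {U, V, W, X, Y, T}"
proof -
  obtain \<L> where g: "general_lines 4 \<L>" and Z: "Z = pairwise_intersections \<L>"
    using assms unfolding is_star_def by blast
  have "card \<L> = 4" "finite \<L>" and lines: "\<And>L. L \<in> \<L> \<Longrightarrow> is_line L"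
    and gen: "\<And>L M N P. L \<in> \<L> \<Longrightarrow> M \<in> \<L> \<Longrightarrow> N \<in> \<L> \<Longrightarrow> L \<noteq> M \<Longrightarrow> L \<noteq> N \<Longrightarrow> M \<noteq> N \<Longrightarrow>
      P \<in> L \<Longrightarrow> P \<in> M \<Longrightarrow> P \<in> N \<Longrightarrow> False"
  proof -
    show "card \<L> = 4" "finite \<L>" "\<And>L. L \<in> \<L> \<Longrightarrow> is_line L"
      using g unfolding general_lines_def by simp_all
    fix L M N P assume "L \<in> \<L>" "M \<in> \<L>" "N \<in> \<L>" "L \<noteq> M" "L \<noteq> N" "M \<noteq> N"
      and P: "P \<in> L" "P \<in> M" "P \<in> N"
    then have "L \<inter> M \<inter> N = {}"
      using g unfolding general_lines_def by simp
    then show False using P by blast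
  qed
  then obtain a b c d where abcd: "\<L> = {a, b, c, d}" "distinct [a, b, c, d]"
    by (auto simp: numeral_eq_Suc card_Suc_eq)
  have ln: "is_line a" "is_line b" "is_line c" "is_line d"
    using lines abcd(1) by auto
  obtain U where U: "U \<in> a" "U \<in> b" using lines_meet[OF ln(1,2)] by blast
  obtain V where V: "V \<in> a" "V \<in> c" using lines_meet[OF ln(1,3)] by blast
  obtain W where W: "W \<in> b" "W \<in> c" using lines_meet[OF ln(2,3)] by blast
  obtain T where T: "T \<in> a" "T \<in> d" using lines_meet[OF ln(1,4)] by blast
  obtain Y where Y: "Y \<in> b" "Y \<in> d" using lines_meet[OF ln(2,4)] by blast
  obtain X where X: "X \<in> c" "X \<in> d" using lines_meet[OF ln(3,4)] by blast
  have no3: "\<not> (P \<in> a \<and> P \<in> b \<and> P \<in> c)" "\<not> (P \<in> a \<and> P \<in> b \<and> P \<in> d)"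
    "\<not> (P \<in> a \<and> P \<in> c \<and> P \<in> d)" "\<not> (P \<in> b \<and> P \<in> c \<and> P \<in> d)" for P
    using gen[of a b c P] gen[of a b d P] gen[of a c d P] gen[of b c d P] abcd by auto
  have ne: "U \<noteq> V" "U \<noteq> W" "V \<noteq> W" "X \<noteq> Y" "X \<noteq> V" "X \<noteq> W" "Y \<noteq> U" "Y \<noteq> W" "T \<noteq> U" "T \<noteq> V"
    using no3 U V W X Y T by metis+
  have ls: "a = lset U V" "b = lset U W" "c = lset V W" "d = lset X Y"
    using line_eq_lset ln U V W X Y ne by blast+
  have "W \<notin> a" using no3 W by blast
  then have tri: "tri U V W X Y T"
    unfolding tri_def using ls U V W X Y T ne by blast
  have "col X Y T" using ls T by blast
  moreover have "a \<inter> b = {U}" "a \<inter> c = {V}" "b \<inter> c = {W}" "a \<inter> d = {T}" "b \<inter> d = {Y}" "c \<inter> d = {X}"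
    using ln abcd(2) U V W X Y T by (simp_all add: lines_inter)
  then have "Z = {U, V, W, X, Y, T}"
    unfolding Z abcd(1) pairwise_intersections_4[OF abcd(2)] by auto
  ultimately show thesis using that tri by blast
qed

section \<open>Point sets not contained in a conic\<close>

definition nonconic :: "'k::field proj_plane set \<Rightarrow> bool"
  where "nonconic Z \<longleftrightarrow> \<not> (\<exists>C. is_conic C \<and> Z \<subseteq> C)"

lemma nonconicD:
  fixes Z :: "'k::field_char_0 proj_plane set"
  assumes "nonconic Z" and q: "form 2 q" "q v \<noteq> 0"
  shows "\<exists>P\<in>Z. q (rep P) \<noteq> 0"
proof (rule ccontr)
  assume 0: "\<not> ?thesis"
  obtain F where F: "is_form 2 F" "\<And>v. eval3 F v = q v"
    using form_is_eval3[OF q(1)] by blast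
  have "F \<noteq> 0"
    using F(2)[of v] q(2) by (auto simp: eval3_0)
  then have "is_conic {P. vanishes_at F P}"
    unfolding is_curve_def using F(1) by blast
  moreover have "Z \<subseteq> {P. vanishes_at F P}"
    using 0 by (auto simp: vanishes_at_iff[OF F(1)] F(2))
  ultimately show False
    using assms(1) unfolding nonconic_def by blast
qed

text \<open>The product of two linear forms defines a conic. The two lines may coincide, which gives
  a point off a single line.\<close>

lemma nonconic_two_lines:
  fixes Z :: "'k::field_char_0 proj_plane set"
  assumes "nonconic Z" and "A \<noteq> B" "C \<noteq> D"
  obtains P where "P \<in> Z" "\<not> col A B P" "\<not> col C D P"
proof -
  obtain u w where u: "line_form A B u \<noteq> 0" and w: "line_form C D w \<noteq> 0"
    using ex_ln_nonzero assms by metis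
  have "form 2 (\<lambda>v. line_form A B v * line_form C D v)"
    using form_mult[OF form_det3 form_det3] by (simp add: numeral_2_eq_2)
  moreover obtain v where "line_form A B v * line_form C D v \<noteq> 0"
    using polyfun_mult_eq_0[OF form_polyfun[OF form_det3] form_polyfun[OF form_det3] _ u, of "rep C" "rep D" w] w
    by blast
  ultimately obtain P where "P \<in> Z" "line_form A B (rep P) * line_form C D (rep P) \<noteq> 0"
    using nonconicD[OF assms(1)] by blast
  then show thesis
    using that by (auto simp: col_def)
qed

section \<open>Triangles and quadrangles in point sets\<close>

definition has_tri :: "'k::field proj_plane set \<Rightarrow> bool"
  where "has_tri Z \<longleftrightarrow> (\<exists>U V W X Y T. {U, V, W, X, Y, T} \<subseteq> Z \<and> tri U V W X Y T)"

definition gen4 :: "'k::field proj_plane \<Rightarrow> 'k proj_plane \<Rightarrow> 'k proj_plane \<Rightarrow> 'k proj_plane \<Rightarrow> bool"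
  where "gen4 A B C D \<longleftrightarrow> \<not> col A B C \<and> \<not> col A B D \<and> \<not> col A C D \<and> \<not> col B C D"

definition no_gen5 :: "'k::field proj_plane set \<Rightarrow> bool"
  where "no_gen5 Z \<longleftrightarrow> (\<forall>A\<in>Z. \<forall>B\<in>Z. \<forall>C\<in>Z. \<forall>D\<in>Z. \<forall>E\<in>Z. \<not> gen5 A B C D E)"

lemma has_triI: "tri U V W X Y T \<Longrightarrow> U \<in> Z \<Longrightarrow> V \<in> Z \<Longrightarrow> W \<in> Z \<Longrightarrow> X \<in> Z \<Longrightarrow> Y \<in> Z \<Longrightarrow> T \<in> Z \<Longrightarrow> has_tri Z"
  unfolding has_tri_def by blast

lemma noncol_distinct:
  assumes "\<not> col A B C"
  shows "A \<noteq> B" "A \<noteq> C" "B \<noteq> C"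
  using assms by (auto simp: col_refl)

lemma noncol_replace:
  assumes "\<not> col A B C" "col A B P" "P \<noteq> A"
  shows "\<not> col A P C"
proof
  assume "col A P C"
  moreover have "col A P B" using assms(2) by (simp add: col_ac)
  ultimately have "col A B C" using col_trans[of A P B C] assms(3) by simp
  then show False using assms(1) by simp
qed

text \<open>Given a noncollinear triple, choose for each pair of its sides a point of
  \<open>Z\<close> off both. Either each of these points lies on the third side, or one of them is
  on no side and completes a quadrangle.\<close>

lemma tri_or_gen4:
  fixes Z :: "'k::field_char_0 proj_plane set"
  assumes "nonconic Z"
  shows "has_tri Z \<or> (\<exists>A\<in>Z. \<exists>B\<in>Z. \<exists>C\<in>Z. \<exists>D\<in>Z. gen4 A B C D)"
proof -
  \<comment> \<open>Any conic will do here: that \<open>Z\<close> is not contained in it yields a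
    point of \<open>Z\<close>.\<close>
  have "form 2 (\<lambda>v. (v :: 'k ^ 3) $ 1 * v $ 1)"
    by (auto simp: form_def power2_eq_square intro: polyfun_intros)
  then obtain A where A: "A \<in> Z"
    using nonconicD[OF assms, of "\<lambda>v. v $ 1 * v $ 1" "axis 1 1"] by auto
  obtain f v where f: "form 1 f" "f v \<noteq> 0" "f (rep A) = 0"
  proof -
    obtain F where F: "is_form 1 F" "F \<noteq> 0" "vanishes_at F A"
      using ex_line_through by blast
    then obtain v where "eval3 F v \<noteq> 0"
      using eval3_eq_0_iff by blast
    with that[OF form_eval3[OF F(1)]] F(3) show thesis
      by (simp add: vanishes_at_iff[OF F(1)])
  qed
  have "form 2 (\<lambda>v. f v * f v)"
    using form_mult[OF f(1) f(1)] by (simp add: numeral_2_eq_2)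
  then obtain B where B: "B \<in> Z" "A \<noteq> B"
    using nonconicD[OF assms, of "\<lambda>v. f v * f v" v] f by auto
  obtain C where C: "C \<in> Z" "\<not> col A B C"
    using nonconic_two_lines[OF assms B(2) B(2)] by blast
  note ne = noncol_distinct[OF C(2)]
  obtain P where P: "P \<in> Z" "\<not> col A B P" "\<not> col A C P"
    using nonconic_two_lines[OF assms ne(1,2)] by blast
  obtain Q where Q: "Q \<in> Z" "\<not> col A B Q" "\<not> col B C Q"
    using nonconic_two_lines[OF assms ne(1,3)] by blast
  obtain R where R: "R \<in> Z" "\<not> col A C R" "\<not> col B C R"
    using nonconic_two_lines[OF assms ne(2,3)] by blast
  show ?thesis
  proof (cases "col B C P \<and> col A C Q \<and> col A B R")
    case True
    then have "tri A B C P Q R"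
      using C(2) P(2,3) Q(2,3) R(2,3) unfolding tri_def by (auto simp: col_refl)
    then show ?thesis
      using A B C P Q R by (blast intro: has_triI)
  next
    case False
    then have "gen4 A B C P \<or> gen4 A B C Q \<or> gen4 A B C R"
      using C(2) P(2,3) Q(2,3) R(2,3) unfolding gen4_def by blast
    then show ?thesis
      using A B C P Q R by blast
  qed
qed

text \<open>Two lines through \<open>V\<close> carry \<open>U\<close>, \<open>P\<close> and
  \<open>W\<close>, \<open>Q\<close>. As \<open>gen5 U P W Q D\<close> fails, \<open>D\<close> lies
  on UQ, PW or PQ, since \<open>gen4\<close> excludes UW; in each case \<open>V\<close> and the two
  points spanning this line form the triangle.\<close>

lemma tri_of_two_lines:
  assumes Z: "no_gen5 Z" and m: "V \<in> Z" "U \<in> Z" "W \<in> Z" "D \<in> Z" "P \<in> Z" "Q \<in> Z"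
    and g: "gen4 V U W D"
    and P: "col V U P" "P \<noteq> V" "P \<noteq> U" and Q: "col V W Q" "Q \<noteq> V" "Q \<noteq> W"
  shows "has_tri Z"
proof -
  have g': "\<not> col V U W" "\<not> col V U D" "\<not> col V W D" "\<not> col U W D" "\<not> col V W U"
    using g by (auto simp: gen4_def col_ac)
  have PW: "\<not> col V P W" and PD: "\<not> col V P D"
    using noncol_replace[OF g'(1) P(1,2)] noncol_replace[OF g'(2) P(1,2)] by auto
  have QU: "\<not> col V Q U" and QD: "\<not> col V Q D"
    using noncol_replace[OF g'(5) Q(1,2)] noncol_replace[OF g'(3) Q(1,2)] by auto
  have PQ: "\<not> col V P Q"
    using noncol_replace[of V W P Q] PW Q(1,2) by (auto simp: col_ac)
  have sw: "\<not> col U V W" "\<not> col U V Q" "\<not> col W V U" "\<not> col W V P" "\<not> col U V D" "\<not> col W V D"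
    using g' QU PW by (auto simp: col_ac)
  have b: "\<not> col U P W" "\<not> col U P Q" "\<not> col U P D"
    using noncol_replace[of U V W P] noncol_replace[of U V Q P] noncol_replace[of U V D P] sw P
    by (auto simp: col_ac)
  have c: "\<not> col W Q U" "\<not> col W Q P" "\<not> col W Q D"
    using noncol_replace[of W V U Q] noncol_replace[of W V P Q] noncol_replace[of W V D Q] sw Q
    by (auto simp: col_ac)
  have "\<not> gen5 U P W Q D"
    using Z m unfolding no_gen5_def by blast
  then consider "col U Q D" | "col P W D" | "col P Q D"
    using b c g'(4) unfolding gen5_def by (auto simp: col_ac)
  then show ?thesis
  proof cases
    case 1
    have "tri V U Q D W P"
      using 1 g' QU QD P Q unfolding tri_def by (auto simp: col_ac col_refl)
    then show ?thesis using m by (blast intro: has_triI)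
  next
    case 2
    have "tri V P W D Q U"
      using 2 g' PW PD P Q unfolding tri_def by (auto simp: col_ac col_refl)
    then show ?thesis using m by (blast intro: has_triI)
  next
    case 3
    have "tri V P Q D W U"
      using 3 g' PQ PD QD P Q unfolding tri_def by (auto simp: col_ac col_refl)
    then show ?thesis using m by (blast intro: has_triI)
  qed
qed

lemma tri_of_gen4_AC:
  assumes Z: "no_gen5 Z" and m: "A \<in> Z" "B \<in> Z" "C \<in> Z" "D \<in> Z" "P \<in> Z" "Q \<in> Z"
    and g: "gen4 A B C D"
    and P: "col A C P" "P \<notin> {A, B, C, D}"
    and Q: "col A B Q \<or> col C D Q \<or> col A D Q \<or> col B C Q" "Q \<notin> {A, B, C, D}"
  shows "has_tri Z"
proof -
  have gs: "gen4 A C B D" "gen4 C A D B" "gen4 A C D B" "gen4 C A B D"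
    using g by (auto simp: gen4_def col_ac)
  have P': "col C A P" "P \<noteq> A" "P \<noteq> C" using P by (auto simp: col_ac)
  consider "col A B Q" | "col C D Q" | "col A D Q" | "col C B Q"
    using Q(1) by (auto simp: col_ac)
  then show ?thesis
  proof cases
    case 1 then show ?thesis using tri_of_two_lines[OF Z _ _ _ _ _ _ gs(1), of P Q] m P P' Q by simp
  next
    case 2 then show ?thesis using tri_of_two_lines[OF Z _ _ _ _ _ _ gs(2), of P Q] m P P' Q by simp
  next
    case 3 then show ?thesis using tri_of_two_lines[OF Z _ _ _ _ _ _ gs(3), of P Q] m P P' Q by simp
  next
    case 4 then show ?thesis using tri_of_two_lines[OF Z _ _ _ _ _ _ gs(4), of P Q] m P P' Q by simp
  qed
qed

text \<open>Without five general points, every point of \<open>Z\<close> lies on one of the six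
  sides of the quadrangle. Each pair of opposite sides is a conic: a point \<open>P\<close> off one
  pair lies on another side, and a point \<open>Q\<close> off that side and its opposite lies on a
  side meeting it in a vertex.\<close>

lemma nonconic_has_tri:
  fixes Z :: "'k::field_char_0 proj_plane set"
  assumes "nonconic Z" and Z: "no_gen5 Z"
  shows "has_tri Z"
proof (rule ccontr)
  assume no: "\<not> has_tri Z"
  then obtain A B C D where m: "A \<in> Z" "B \<in> Z" "C \<in> Z" "D \<in> Z" and g: "gen4 A B C D"
    using tri_or_gen4[OF assms(1)] by blast
  have ne: "A \<noteq> B" "C \<noteq> D" "A \<noteq> C" "B \<noteq> D" "A \<noteq> D" "B \<noteq> C"
    using g unfolding gen4_def by (auto simp: col_refl)
  have six: "col A B P \<or> col C D P \<or> col A C P \<or> col B D P \<or> col A D P \<or> col B C P" if "P \<in> Z" for P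
    using Z g m that unfolding no_gen5_def gen5_def gen4_def by blast
  have gs: "gen4 B A D C" "gen4 A B D C" "gen4 B A C D"
    using g by (auto simp: gen4_def col_ac)
  obtain P where P: "P \<in> Z" "\<not> col A B P" "\<not> col C D P"
    using nonconic_two_lines[OF assms(1) ne(1,2)] by blast
  have P': "P \<notin> {A, B, C, D}"
    using P by (auto simp: col_refl)
  show False
  proof (cases "col A C P \<or> col B D P")
    case True
    obtain Q where Q: "Q \<in> Z" "\<not> col A C Q" "\<not> col B D Q"
      using nonconic_two_lines[OF assms(1) ne(3,4)] by blast
    then have Q': "Q \<notin> {A, B, C, D}" "col A B Q \<or> col C D Q \<or> col A D Q \<or> col B C Q"
      using six[OF Q(1)] by (auto simp: col_refl)
    show False
      using True
    proof
      assume "col A C P"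
      then show False
        using tri_of_gen4_AC[OF Z m P(1) Q(1) g _ P' Q'(2,1)] no by blast
    next
      assume "col B D P"
      moreover have "col B A Q \<or> col D C Q \<or> col B C Q \<or> col A D Q"
        using Q'(2) by (auto simp: col_ac)
      ultimately show False
        using tri_of_gen4_AC[OF Z m(2,1,4,3) P(1) Q(1) gs(1)] P' Q'(1) no by auto
    qed
  next
    case False
    obtain Q where Q: "Q \<in> Z" "\<not> col A D Q" "\<not> col B C Q"
      using nonconic_two_lines[OF assms(1) ne(5,6)] by blast
    then have Q': "Q \<notin> {A, B, C, D}" "col A B Q \<or> col C D Q \<or> col A C Q \<or> col B D Q"
      using six[OF Q(1)] by (auto simp: col_refl)
    have "col A D P \<or> col B C P"
      using six[OF P(1)] P False by blast
    then show False
    proof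
      assume "col A D P"
      moreover have "col A B Q \<or> col D C Q \<or> col A C Q \<or> col B D Q"
        using Q'(2) by (auto simp: col_ac)
      ultimately show False
        using tri_of_gen4_AC[OF Z m(1,2,4,3) P(1) Q(1) gs(2)] P' Q'(1) no by auto
    next
      assume "col B C P"
      moreover have "col B A Q \<or> col C D Q \<or> col B D Q \<or> col A C Q"
        using Q'(2) by (auto simp: col_ac)
      ultimately show False
        using tri_of_gen4_AC[OF Z m(2,1,3,4) P(1) Q(1) gs(3)] P' Q'(1) no by auto
    qed
  qed
qed

section \<open>A star together with a further point\<close>

lemma det3_linear:
  fixes a b c x y :: "'k::field_char_0 ^ 3"
  shows "det3 (x + y) b c = det3 x b c + det3 y b c" "det3 a (x + y) c = det3 a x c + det3 a y c"
    "det3 a b (x + y) = det3 a b x + det3 a b y"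
    "det3 (s *s x) b c = s * det3 x b c" "det3 a (s *s x) c = s * det3 a x c"
    "det3 a b (s *s x) = s * det3 a b x"
proof -
  show "det3 (x + y) b c = det3 x b c + det3 y b c" "det3 a (x + y) c = det3 a x c + det3 a y c"
    "det3 a b (x + y) = det3 a b x + det3 a b y"
    unfolding det3_def vector_add_component by algebra+
  have *: "det3 a b (s *s x) = s * det3 a b x" for a b
    using form_det3[of a b] by (simp add: form_def)
  then show "det3 a b (s *s x) = s * det3 a b x" .
  show "det3 (s *s x) b c = s * det3 x b c" "det3 a (s *s x) c = s * det3 a x c"
    using * det3_rotate by metis+
qed

lemma det3_alternating:
  fixes a b :: "'k::field_char_0 ^ 3"
  shows "det3 a a b = 0" "det3 a b a = 0" "det3 b a a = 0"
proof -
  show *: "det3 a b a = 0" "det3 b a a = 0"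
    unfolding det3_def by algebra+
  then show "det3 a a b = 0"
    using det3_rotate by metis
qed

text \<open>Menelaus against Ceva: in coordinates on the triangle, collinearity of X, Y, T reads a
  d' e = - b c f, concurrency of UX, VY, WT reads a d' e = b c f, and together they give 2 a d' e =
  0.\<close>

lemma fano:
  fixes U V W X Y T P :: "'k::field_char_0 proj_plane"
  assumes t: "tri U V W X Y T" and c: "col X Y T"
  shows "\<not> (col U X P \<and> col V Y P \<and> col W T P)"
proof
  assume P: "col U X P \<and> col V Y P \<and> col W T P"
  note tt = t[unfolded tri_def]
  note d = tri_distinct[OF t]
  define u v w where "u = rep U" and "v = rep V" and "w = rep W"
  define D where "D = det3 u v w"
  have perm: "det3 u w v = - D" "det3 v u w = - D" "det3 w v u = - D" "det3 v w u = D" "det3 w u v = D"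
    unfolding D_def det3_def by algebra+
  note perm = perm D_def[symmetric]
  have D: "D \<noteq> 0"
    using tt by (simp add: D_def u_def v_def w_def col_def)
  obtain a b where x: "rep X = a *s v + b *s w"
    using col_span[of V W X] tt d unfolding v_def w_def by auto
  obtain c d' where y: "rep Y = c *s u + d' *s w"
    using col_span[of U W Y] tt d unfolding u_def w_def by auto
  obtain e f where z: "rep T = e *s u + f *s v"
    using col_span[of U V T] tt d unfolding u_def v_def by auto
  have nz: "a \<noteq> 0" "b \<noteq> 0" "c \<noteq> 0" "d' \<noteq> 0" "e \<noteq> 0" "f \<noteq> 0"
    using x y z rep_eqI[of X a V] rep_eqI[of X b W] rep_eqI[of Y c U] rep_eqI[of Y d' W]
      rep_eqI[of T e U] rep_eqI[of T f V] tt d unfolding u_def v_def w_def by auto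
  define p1 p2 p3 where "p1 = det3 (rep P) v w" and "p2 = det3 u (rep P) w" and "p3 = det3 u v (rep P)"
  have p: "D *s rep P = p1 *s u + p2 *s v + p3 *s w"
    unfolding D_def p1_def p2_def p3_def by (rule det3_cramer)
  have scale: "det3 q r (D *s rep P) = D * det3 q r (rep P)" for q r
    using form_det3[of q r] by (simp add: form_def)
  have "D * (a * p3 - b * p2) = det3 u (rep X) (D *s rep P)"
    unfolding p x by (simp only: det3_linear det3_alternating perm) algebra
  then have 1: "a * p3 = b * p2"
    using P D by (simp add: scale col_def u_def)
  have "D * (d' * p1 - c * p3) = det3 v (rep Y) (D *s rep P)"
    unfolding p y by (simp only: det3_linear det3_alternating perm) algebra
  then have 2: "d' * p1 = c * p3"
    using P D by (simp add: scale col_def v_def)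
  have "D * (e * p2 - f * p1) = det3 w (rep T) (D *s rep P)"
    unfolding p z by (simp only: det3_linear det3_alternating perm) algebra
  then have 3: "e * p2 = f * p1"
    using P D by (simp add: scale col_def w_def)
  have "D * (a * d' * e + b * c * f) = det3 (rep X) (rep Y) (rep T)"
    unfolding x y z by (simp only: det3_linear det3_alternating perm) algebra
  then have 4: "a * d' * e + b * c * f = 0"
    using c D by (simp add: col_def)
  \<comment> \<open>By the relations \<open>2\<close> and \<open>3\<close>, p1 = 0 would make all
    coordinates of P vanish; so p1 may be cancelled after eliminating p2 and p3.\<close>
  have p1: "p1 \<noteq> 0"
  proof
    assume "p1 = 0"
    then have "p3 = 0" "p2 = 0"
      using 2 3 nz by auto
    then have "D *s rep P = 0"
      using p \<open>p1 = 0\<close> by simp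
    then show False
      using D rep_nonzero[of P] by simp
  qed
  have "(a * d' * e - b * c * f) * p1 = 0"
    using 1 2 3 by algebra
  then have "a * d' * e = b * c * f"
    using p1 by simp
  then have "2 * (a * d' * e) = 0"
    using 4 by simp
  then show False
    using nz by simp
qed

definition has_quasi_star :: "'k::field proj_plane set \<Rightarrow> bool"
  where "has_quasi_star Z \<longleftrightarrow> (\<exists>U V W X Y T. {U, V, W, X, Y, T} \<subseteq> Z \<and> tri U V W X Y T \<and> \<not> col X Y T)"

lemma has_quasi_starI:
  "tri U V W X Y T \<Longrightarrow> \<not> col X Y T \<Longrightarrow> {U, V, W, X, Y, T} \<subseteq> Z \<Longrightarrow> has_quasi_star Z"
  unfolding has_quasi_star_def by blast

lemma quasi_star_of_side_point:
  assumes t: "tri U V W X Y T" and c: "col X Y T" and Z: "{U, V, W, X, Y, T, P} \<subseteq> Z"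
    and P: "P \<notin> {U, V, W, X, Y, T}" "col U V P"
  shows "has_quasi_star Z"
proof -
  note tt = t[unfolded tri_def]
  have "tri U V W X Y P"
    using tt P unfolding tri_def by auto
  moreover have "\<not> col X Y P"
  proof
    assume XP: "col X Y P"
    have "X \<noteq> Y" using tri_distinct[OF t] by simp
    then have "col X T P"
      using col_trans[of X Y T P] c XP by simp
    moreover have "col U T P" "col V T P"
      using col_trans[of U V T P] col_trans'[of U V T P] tt P tri_distinct[OF t] by auto
    ultimately have "col T P X" "col T P U"
      by (auto simp: col_ac)
    moreover have "T \<noteq> P" using P by auto
    ultimately have "col T X U"
      using col_trans[of T P X U] by simp
    then show False
      using tri_noncol(13)[OF t] by (simp add: col_ac)
  qed
  ultimately show ?thesis
    using Z by (intro has_quasi_starI) auto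
qed

text \<open>The lines XY, UY and the diagonal UX form a triangle with further points T, W and
  P.\<close>

lemma quasi_star_of_diagonal_point:
  assumes t: "tri U V W X Y T" and c: "col X Y T" and Z: "{U, V, W, X, Y, T, P} \<subseteq> Z"
    and P: "P \<notin> {U, V, W, X, Y, T}" "col U X P" "\<not> col W T P"
  shows "has_quasi_star Z"
proof (rule has_quasi_starI)
  note tt = t[unfolded tri_def]
  show "tri U X Y T W P"
    using tt P c tri_distinct[OF t] tri_noncol(10)[OF t] unfolding tri_def by (auto simp: col_ac)
  show "\<not> col T W P"
    using P(3) by (simp add: col_ac)
qed (use Z in auto)

text \<open>The pairs of opposite vertices are U, X and V, Y and W, T. For \<open>P\<close> off the
  four lines, two such pairs with \<open>P\<close> are five general points unless \<open>P\<close>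
  is on the diagonal through one of the pairs. So \<open>P\<close> lies on at least two diagonals,
  by \<open>fano\<close> not on all three, and a diagonal through \<open>P\<close> is combined with
  one that misses it.\<close>

lemma quasi_star_of_star_point:
  fixes U V W X Y T P :: "'k::field_char_0 proj_plane"
  assumes ng: "no_gen5 Z" and t: "tri U V W X Y T" and c: "col X Y T"
    and Z: "{U, V, W, X, Y, T, P} \<subseteq> Z" and P: "P \<notin> {U, V, W, X, Y, T}"
  shows "has_quasi_star Z"
proof -
  note t' = t tri_rotate[OF t] tri_rotate[OF tri_rotate[OF t]]
  note tt = t[unfolded tri_def] and n = tri_noncol[OF t] and d = tri_distinct[OF t]
  have c': "col Y T X" "col T X Y" "col Y X T" "col X T Y" "col T Y X"
    using c by (auto simp: col_ac)
  show ?thesis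
  proof (cases "col U V P \<or> col V W P \<or> col W U P \<or> col T Y P")
    case True
    \<comment> \<open>The fourth line XY of the star becomes a side after relabelling: it is the
      side TY of the triangle T, Y, U.\<close>
    have s: "tri T Y U W V X" "col W V X"
      using tt d n c by (auto simp: tri_def col_ac)
    show ?thesis
      using True quasi_star_of_side_point[OF t'(1) c, of P Z] quasi_star_of_side_point[OF t'(2) c'(1), of P Z]
        quasi_star_of_side_point[OF t'(3) c'(2), of P Z] quasi_star_of_side_point[OF s, of P Z] Z P
      by (elim disjE) (simp_all add: insert_commute)
  next
    case False
    have off: "\<not> col U V P" "\<not> col V W P" "\<not> col U W P" "\<not> col X Y P" "\<not> col Y T P" "\<not> col X T P"
    proof -
      show "\<not> col U V P" "\<not> col V W P" "\<not> col U W P" "\<not> col Y T P"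
        using False by (auto simp: col_ac)
      show "\<not> col X Y P"
        using col_trans'[of X Y T P] c d False by (auto simp: col_ac)
      show "\<not> col X T P"
        using col_trans'[of X T Y P] c'(4) d False by (auto simp: col_ac)
    qed
    have lines: "\<not> col U T P" "\<not> col V T P" "\<not> col U Y P" "\<not> col W Y P" "\<not> col V X P" "\<not> col W X P"
      using col_trans[of U T V P] col_trans[of V T U P] col_trans[of U Y W P] col_trans[of W Y U P]
        col_trans[of V X W P] col_trans[of W X V P] tt d off by (auto simp: col_ac)
    have "\<not> gen5 U X V Y P" "\<not> gen5 U X W T P" "\<not> gen5 V Y W T P"
      using ng Z unfolding no_gen5_def by auto
    then have two: "col U X P \<or> col V Y P" "col U X P \<or> col W T P" "col V Y P \<or> col W T P"
      using off lines n unfolding gen5_def by (auto simp: col_ac)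
    show ?thesis
    proof (cases "col W T P")
      case False
      then show ?thesis
        using quasi_star_of_diagonal_point[OF t c Z P] two by blast
    next
      case True
      then consider "\<not> col U X P" | "\<not> col V Y P"
        using fano[OF t c, of P] by blast
      then show ?thesis
      proof cases
        case 1
        then have "col V Y P" using two by blast
        then show ?thesis
          using quasi_star_of_diagonal_point[OF t'(2) c'(1), of P Z] 1 Z P by (simp add: insert_commute)
      next
        case 2
        then show ?thesis
          using quasi_star_of_diagonal_point[OF t'(3) c'(2), of P Z] True Z P by (simp add: insert_commute)
      qed
    qed
  qed
qed

section \<open>The degree bound and the theorem\<close>

lemma nonconic_cases:
  fixes Z :: "'k::field_char_0 proj_plane set"
  assumes "nonconic Z" and "\<not> is_star 4 Z"
  shows "\<not> no_gen5 Z \<or> has_quasi_star Z"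
proof (rule ccontr)
  assume *: "\<not> ?thesis"
  then have ng: "no_gen5 Z" by blast
  obtain U V W X Y T where sub: "{U, V, W, X, Y, T} \<subseteq> Z" and t: "tri U V W X Y T"
    using nonconic_has_tri[OF assms(1) ng] unfolding has_tri_def by blast
  then have c: "col X Y T"
    using * has_quasi_starI[OF t _ sub] by blast
  then have "Z \<noteq> {U, V, W, X, Y, T}"
    using star_of_tri[OF t] assms(2) by metis
  then obtain P where "P \<in> Z" "P \<notin> {U, V, W, X, Y, T}"
    using sub by blast
  then show False
    using quasi_star_of_star_point[OF ng t c] sub * by blast
qed

lemma nonconic_degree_bound:
  fixes Z :: "'k::{alg_closed_field, field_char_0} proj_plane set"
  assumes "nonconic Z" and "\<not> is_star 4 Z"
    and f: "form d f" "f u \<noteq> 0" and v: "\<And>P. P \<in> Z \<Longrightarrow> vord f (rep P) m"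
  shows "9 * m \<le> 4 * d" and "4 * d = 9 * m \<Longrightarrow> 0 < m \<Longrightarrow> is_quasi_star 3 Z"
proof -
  have "9 * m \<le> 4 * d \<and> (4 * d = 9 * m \<longrightarrow> 0 < m \<longrightarrow> is_quasi_star 3 Z)"
  proof (cases "no_gen5 Z")
    case False
    then obtain A B C D E where m: "A \<in> Z" "B \<in> Z" "C \<in> Z" "D \<in> Z" "E \<in> Z" and g: "gen5 A B C D E"
      unfolding no_gen5_def by blast
    obtain q where q: "form 2 q" "\<exists>v. q v \<noteq> (0::'k)" and bound:
      "\<And>P f d m u. q (rep P) \<noteq> 0 \<Longrightarrow> form d f \<Longrightarrow> f u \<noteq> 0 \<Longrightarrow>
        (\<And>R. R \<in> {A, B, C, D, E, P} \<Longrightarrow> vord f (rep R) m) \<Longrightarrow> 7 * m \<le> 3 * d"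
      using gen5_seven_thirds[OF g] by blast
    obtain P where P: "P \<in> Z" "q (rep P) \<noteq> 0"
      using nonconicD[OF assms(1) q(1)] q(2) by blast
    have "7 * m \<le> 3 * d"
      by (rule bound[OF P(2) f]) (use m P v in auto)
    \<comment> \<open>7/3 exceeds 9/4, so equality with \<open>m > 0\<close> cannot occur in this
      case.\<close>
    then show ?thesis by auto
  next
    case True
    then obtain U V W X Y T where sub: "{U, V, W, X, Y, T} \<subseteq> Z" and t: "tri U V W X Y T"
      and c: "\<not> col X Y T"
      using nonconic_cases[OF assms(1,2)] unfolding has_quasi_star_def by blast
    have v': "vord f (rep R) m" if "R \<in> {U, V, W, X, Y, T}" for R
      using v sub that by blast
    have qb: "9 * m \<le> 4 * d"
      by (rule quasi_star_degree_bound(1)[OF t c f]) (rule v')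
    have "is_quasi_star 3 Z" if "4 * d = 9 * m" "0 < m"
    proof -
      have "Z = {U, V, W, X, Y, T}"
      proof
        show "Z \<subseteq> {U, V, W, X, Y, T}"
        proof
          fix Q assume "Q \<in> Z"
          show "Q \<in> {U, V, W, X, Y, T}"
            by (rule quasi_star_degree_bound(2)[OF t c f]) (rule v' that v[OF \<open>Q \<in> Z\<close>], assumption?)+
        qed
      qed (rule sub)
      then show ?thesis
        using quasi_star_of_tri[OF t c] by simp
    qed
    then show ?thesis
      using qb by blast
  qed
  then show "9 * m \<le> 4 * d" and "4 * d = 9 * m \<Longrightarrow> 0 < m \<Longrightarrow> is_quasi_star 3 Z"
    by auto
qed

section \<open>Bounds for the Waldschmidt constant from initial degrees\<close>

lemma initial_degree_mult_le:
  fixes Z :: "'k::field_char_0 proj_plane set"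
  assumes "finite Z" and "1 \<le> k"
  shows "\<alpha> Z (k * n) \<le> k * \<alpha> Z n"
  using assms(2)
proof (induction k rule: dec_induct)
  case (step k)
  then show ?case
    using initial_degree_subadditive[OF assms(1), of n "k * n"] by simp
qed simp

text \<open>Along the multiples of \<open>n\<close> the quotients stay at or below that of
  \<open>n\<close>, and a subsequence has the same limit.\<close>

lemma waldschmidt_le:
  fixes Z :: "'k::field_char_0 proj_plane set"
  assumes "finite Z" and "1 \<le> n"
  shows "waldschmidt Z \<le> real (\<alpha> Z n) / real n"
proof (rule LIMSEQ_le_const2)
  show "(\<lambda>k. real (\<alpha> Z (k * n)) / real (k * n)) \<longlonglongrightarrow> waldschmidt Z"
    using LIMSEQ_subseq_LIMSEQ[OF waldschmidt_limit[OF assms(1)], of "\<lambda>k. k * n"] assms(2)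
    by (simp add: strict_mono_def o_def)
  show "\<exists>N. \<forall>k\<ge>N. real (\<alpha> Z (k * n)) / real (k * n) \<le> real (\<alpha> Z n) / real n"
  proof (intro exI allI impI)
    fix k :: nat assume "1 \<le> k"
    then have "real (\<alpha> Z (k * n)) \<le> real k * real (\<alpha> Z n)"
      using initial_degree_mult_le[OF assms(1), of k n] by (metis of_nat_le_iff of_nat_mult)
    then show "real (\<alpha> Z (k * n)) / real (k * n) \<le> real (\<alpha> Z n) / real n"
      using \<open>1 \<le> k\<close> assms(2) by (simp add: field_simps)
  qed
qed

lemma waldschmidt_ge:
  fixes Z :: "'k::field_char_0 proj_plane set"
  assumes "finite Z" and "\<And>m. c * real m \<le> real (\<alpha> Z m)"
  shows "c \<le> waldschmidt Z"
proof (rule LIMSEQ_le_const[OF waldschmidt_limit[OF assms(1)]])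
  show "\<exists>N. \<forall>m\<ge>N. c \<le> real (\<alpha> Z m) / real m"
    using assms(2) by (intro exI[of _ 1]) (auto simp: le_divide_eq)
qed

lemma initial_degree_form:
  fixes Z :: "'k::field_char_0 proj_plane set"
  assumes "finite Z"
  obtains f u where "form (\<alpha> Z m) f" "f u \<noteq> 0" "\<And>P. P \<in> Z \<Longrightarrow> vord f (rep P) m"
proof -
  obtain F where F: "F \<in> symbolic_power Z m" "F \<noteq> 0" "is_form (\<alpha> Z m) F"
    by (rule initial_degree_attained[OF assms])
  then obtain u where "eval3 F u \<noteq> 0"
    using eval3_eq_0_iff by blast
  then show thesis
    using that[OF form_eval3[OF F(3)]] symbolic_power_vord[OF F(1)] by blast
qed

lemma initial_degree_curve:
  fixes Z :: "'k::field_char_0 proj_plane set"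
  assumes "is_curve d C" and "Z \<subseteq> C"
  shows "\<alpha> Z m \<le> m * d"
proof -
  obtain F where F: "F \<noteq> 0" "is_form d F" "C = {P. vanishes_at F P}"
    using assms(1) unfolding is_curve_def by blast
  show ?thesis
    by (rule initial_degree_le[OF symbolic_power_power poly3_power_neq_0 is_form_power])
      (use F assms(2) in auto)
qed

text \<open>The product of the four lines has degree 4; at each point of the star two of its factors
  lie in the point ideal, so the product lies in the square.\<close>

lemma initial_degree_star:
  fixes Z :: "'k::field_char_0 proj_plane set"
  assumes "is_star 4 Z"
  shows "\<alpha> Z 2 \<le> 4"
proof -
  obtain \<L> where g: "general_lines 4 \<L>" and Z: "Z = pairwise_intersections \<L>"
    using assms unfolding is_star_def by blast
  then have fin: "finite \<L>" and card: "card \<L> = 4" and "\<forall>L\<in>\<L>. is_line L"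
    by (simp_all add: general_lines_def)
  then have "\<forall>L\<in>\<L>. \<exists>F. F \<noteq> 0 \<and> is_form 1 F \<and> L = {P. vanishes_at F P}"
    by (simp add: is_curve_def)
  then obtain F where F: "\<And>L. L \<in> \<L> \<Longrightarrow> F L \<noteq> 0 \<and> is_form 1 (F L) \<and> L = {P. vanishes_at (F L) P}"
    by metis
  have "is_form (card \<M>) (prod F \<M>) \<and> prod F \<M> \<noteq> 0" if "\<M> \<subseteq> \<L>" for \<M>
    using finite_subset[OF that fin] that
  proof (induction \<M>)
    case empty
    then show ?case by (simp add: is_form_def)
  next
    case (insert L \<M>)
    then show ?case
      using is_form_mult[of 1 "F L" "card \<M>" "prod F \<M>"] F[of L] by (auto intro: poly3_mult_neq_0)
  qed
  then have form: "is_form 4 (prod F \<L>)" "prod F \<L> \<noteq> 0"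
    using card by (metis subset_refl)+
  have "prod F \<L> \<in> symbolic_power Z 2"
    unfolding symbolic_power_def
  proof
    fix P assume "P \<in> Z"
    then obtain L M where LM: "L \<in> \<L>" "M \<in> \<L>" "L \<noteq> M" "P \<in> L" "P \<in> M"
      unfolding Z pairwise_intersections_def by blast
    have I: "F L \<in> point_ideal P" "F M \<in> point_ideal P"
      unfolding point_ideal_def using F[OF LM(1)] F[OF LM(2)] LM(4,5) by (blast intro: ideal_gen_base)+
    have "F L \<in> ideal_power (point_ideal P) 1" "F M \<in> ideal_power (point_ideal P) 1"
      using ideal_power_power[OF I(1), of 1] ideal_power_power[OF I(2), of 1] by simp_all
    then have "F L * F M \<in> ideal_power (point_ideal P) 2"
      using ideal_power_add by (metis one_add_one)
    then have "prod F (\<L> - {L} - {M}) * (F L * F M) \<in> ideal_power (point_ideal P) 2"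
      by (rule ideal_power_mult_left)
    also have "prod F (\<L> - {L} - {M}) * (F L * F M) = prod F \<L>"
    proof -
      have "prod F \<L> = F L * prod F (\<L> - {L})" "prod F (\<L> - {L}) = F M * prod F (\<L> - {L} - {M})"
        using LM fin by (auto intro: prod.remove)
      then show ?thesis by (simp only: mult_ac)
    qed
    finally show "prod F \<L> \<in> ideal_power (point_ideal P) 2" .
  qed
  then show ?thesis
    using initial_degree_le form by blast
qed

theorem mainTheorem1:
  fixes Z :: "'k::{alg_closed_field, field_char_0} proj_plane set"
  assumes "finite Z" and "Z \<noteq> {}"
  shows "(waldschmidt Z < 9 / 4 \<longrightarrow>
           (((\<exists>L. is_line L \<and> Z \<subseteq> L) \<or> (\<exists>C. is_conic C \<and> Z \<subseteq> C)) \<or> is_star 4 Z) \<and>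
           ((\<exists>L. is_line L \<and> Z \<subseteq> L) \<longrightarrow> waldschmidt Z = 1) \<and>
           ((\<exists>C. is_conic C \<and> Z \<subseteq> C) \<longrightarrow> waldschmidt Z \<le> 2) \<and>
           (is_star 4 Z \<longrightarrow> waldschmidt Z = 2 \<and> card Z = 6)) \<and>
         ((\<exists>m\<ge>1. real (initial_degree (symbolic_power Z m)) / real m = 9 / 4) \<longrightarrow>
           is_quasi_star 3 Z)"
proof -
  note fin = assms(1)
  have conic: "\<alpha> Z m \<le> m * 2" if "\<exists>C. is_conic C \<and> Z \<subseteq> C" for m
    using that initial_degree_curve by blast
  have large: "9 * m \<le> 4 * \<alpha> Z m" if "nonconic Z" "\<not> is_star 4 Z" for m
  proof -
    obtain f u where f: "form (\<alpha> Z m) f" "f u \<noteq> 0" "\<And>P. P \<in> Z \<Longrightarrow> vord f (rep P) m"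
      using initial_degree_form[OF fin] by blast
    show ?thesis
      by (rule nonconic_degree_bound(1)[OF that f(1,2)]) (rule f(3))
  qed
  have 1: "nonconic Z \<longrightarrow> is_star 4 Z" if "waldschmidt Z < 9 / 4"
  proof (rule ccontr)
    assume "\<not> ?thesis"
    then have "9 / 4 * real m \<le> real (\<alpha> Z m)" for m
      using large[of m] by simp
    then have "9 / 4 \<le> waldschmidt Z"
      by (rule waldschmidt_ge[OF fin])
    then show False using that by simp
  qed
  have 2: "waldschmidt Z = 1" if "\<exists>L. is_line L \<and> Z \<subseteq> L"
  proof (rule antisym)
    have "\<alpha> Z 1 \<le> 1"
      using that initial_degree_curve[of 1 _ Z 1] by auto
    then show "waldschmidt Z \<le> 1"
      using waldschmidt_le[OF fin, of 1] by simp
    show "1 \<le> waldschmidt Z"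
    proof (rule waldschmidt_ge[OF fin])
      fix m
      obtain f u where "form (\<alpha> Z m) f" "f u \<noteq> 0" "\<And>P. P \<in> Z \<Longrightarrow> vord f (rep P) m"
        using initial_degree_form[OF fin] by blast
      then have "m \<le> \<alpha> Z m"
        using vord_le_degree assms(2) by blast
      then show "1 * real m \<le> real (\<alpha> Z m)" by simp
    qed
  qed
  have 3: "waldschmidt Z \<le> 2" if "\<exists>C. is_conic C \<and> Z \<subseteq> C"
    using waldschmidt_le[OF fin, of 1] conic[OF that, of 1] by simp
  have 4: "waldschmidt Z = 2" "card Z = 6" if "is_star 4 Z"
  proof -
    obtain U V W X Y T where t: "tri U V W X Y T" "col X Y T" and Z: "Z = {U, V, W, X, Y, T}"
      using tri_of_star[OF \<open>is_star 4 Z\<close>] by blast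
    show "card Z = 6"
      using tri_distinct[OF t(1)] unfolding Z by simp
    show "waldschmidt Z = 2"
    proof (rule antisym)
      show "waldschmidt Z \<le> 2"
        using waldschmidt_le[OF fin, of 2] initial_degree_star[OF \<open>is_star 4 Z\<close>] by simp
      show "2 \<le> waldschmidt Z"
      proof (rule waldschmidt_ge[OF fin])
        fix m
        obtain f u where f: "form (\<alpha> Z m) f" "f u \<noteq> 0" "\<And>P. P \<in> Z \<Longrightarrow> vord f (rep P) m"
          using initial_degree_form[OF fin] by blast
        have "2 * m \<le> \<alpha> Z m"
          by (rule star_degree_bound[OF t f(1,2)]) (use f(3) Z in simp)
        then show "2 * real m \<le> real (\<alpha> Z m)" by simp
      qed
    qed
  qed
  have 5: "is_quasi_star 3 Z" if m: "1 \<le> m" "real (\<alpha> Z m) / real m = 9 / 4" for m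
  proof -
    have "real (4 * \<alpha> Z m) = real (9 * m)"
      using m by (simp add: field_simps)
    then have eq: "4 * \<alpha> Z m = 9 * m"
      by (simp only: of_nat_eq_iff)
    \<comment> \<open>On a conic the initial degree would be at most 2 m, below 9/4 m.\<close>
    have "nonconic Z"
      using conic[of m] eq m(1) unfolding nonconic_def by fastforce
    moreover have "\<not> is_star 4 Z"
    proof
      assume "is_star 4 Z"
      \<comment> \<open>Since 9 m is a multiple of 4, m is even, and the bound for a star at
        exponent 2 scales to an initial degree of at most 2 m.\<close>
      have "even (9 * m)"
        unfolding eq[symmetric] by simp
      then obtain k where k: "m = k * 2"
        by (auto elim: evenE)
      then have "\<alpha> Z m \<le> k * 4"
        using initial_degree_mult_le[OF fin, of k 2] initial_degree_star[OF \<open>is_star 4 Z\<close>] m(1)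
        by (metis mult_le_mono2 order_trans mult_eq_0_iff not_one_le_zero less_one not_less)
      then show False
        using eq k m(1) by simp
    qed
    moreover obtain f u where f: "form (\<alpha> Z m) f" "f u \<noteq> 0" "\<And>P. P \<in> Z \<Longrightarrow> vord f (rep P) m"
      using initial_degree_form[OF fin] by blast
    ultimately show ?thesis
      using nonconic_degree_bound(2)[OF _ _ f eq] m(1) by simp
  qed
  show ?thesis
    using 1 2 3 4 5 unfolding nonconic_def by blast
qed

end
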